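(* Let $\tau=e^{2i\pi/3}$, $\gamma^2=2\pi/\sqrt3$, let $v(t)=\sum_{n\in\mathbb Z}c_n(t)\psi_n$ be a solution of $i\partial_tv+\lambda v=\Pi\big[2|\Psi_0|^2v+\Psi_0^2\,\overline v\big]$, and set $f(t,\xi)=\sum_nc_n(t)e^{-2\pi in\xi}$, $g(t,\xi)=\overline f(t,-\xi)=\sum_n\overline{c_n(t)}e^{-2\pi in\xi}$, $f_0=f(0,\cdot)$, $g_0=g(0,\cdot)$. Then for all $t\ge0$ (with $f=f(t)$, $g=g(t)$) $$\Big\|\frac{f+g}\mu\Big\|_{L^2([0,1])}+\|f\|_{L^2([0,1])}\lesssim\Big\|\frac{f_0+g_0}\mu\Big\|_{L^2([0,1])}+\|f_0\|_{L^2([0,1])},$$ and more generally, for all $j\in\mathbb R$, $$\Big\|\frac{f+g}{\mu^{j+1}}\Big\|_{L^2([0,1])}+\Big\|\frac{f-g}{\mu^j}\Big\|_{L^2([0,1])}\lesssim\Big\|\frac{f_0+g_0}{\mu^{j+1}}\Big\|_{L^2([0,1])}+\Big\|\frac{f_0-g_0}{\mu^j}\Big\|_{L^2([0,1])},$$ with implicit constants independent of $t$ and of the solution.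
   Context: $L$ is Lebesgue measure on $\mathbb C$. For a function $u$ on $\mathbb C$ of at most polynomial growth, $[\Pi u](z)=\frac1\pi e^{-|z|^2/2}\int_{\mathbb C}e^{\overline w z-|w|^2/2}u(w)\,dL(w)$. $\widetilde{\mathcal E}$ is the set of functions $u(z)=e^{-|z|^2/2}F(z)$ with $F$ entire such that $|u(z)|\lesssim\langle z\rangle^M$ for some $M$; $R_\alpha u(z)=e^{(\alpha\overline z-\overline\alpha z)/2}u(z+\alpha)$; $\mathcal F_\gamma=\{u\in\widetilde{\mathcal E}:R_\gamma u=u\}$; $S_\gamma=\{z:-\gamma/2<\mathrm{Re}\,z\le\gamma/2\}$. With $\tau=e^{2i\pi/3}$ and $\gamma^2=2\pi/\sqrt3$, a Hilbert basis of $L^2(S_\gamma)\cap\mathcal F_\gamma$ is $$\psi_k(z)=\Big(\frac2{\pi\gamma^2}\Big)^{1/4}\exp\Big(\frac{2ik\pi z}\gamma+i\pi\tau k^2+\frac{z^2}2-\frac{|z|^2}2\Big),\quad k\in\mathbb Z,$$ and $\Psi_0=\sum_{n\in\mathbb Z}\psi_n$. Define $$\ell(\xi)=1+2\sum_{k\ge1}e^{-\pi^2k^2/\gamma^2}\cos(2\pi k\xi),\qquad h(\xi)=2\sum_{k\ge0}e^{-\pi^2(2k+1)^2/\gamma^2}\cos(2(2k+1)\pi\xi),$$ $$\lambda=\frac1{\gamma\sqrt\pi}\big(\ell^2(0)-2h^2(0)\big),\quad a(\xi)=\frac2{\gamma\sqrt\pi}\big(\ell(\xi)\ell(0)-2h(\xi)h(0)\big)-\lambda,\quad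 b(\xi)=\frac1{\gamma\sqrt\pi}\big(\ell^2(\xi)-2h^2(\xi)\big),$$ $$\mu(\xi)=\big(a^2(\xi)-b^2(\xi)\big)^{1/2}.$$ ($\mu>0$ on $(0,1)$.) The inequalities are understood for initial data $v_0\in L^2(S_\gamma)\cap\mathcal F_\gamma$ for which the right-hand side is finite. *)

theory Defs
  imports "HOL-Analysis.Analysis"
begin

definition L2 :: "'a::euclidean_space set \<Rightarrow> ('a \<Rightarrow> complex) \<Rightarrow> bool" where
  "L2 S u \<longleftrightarrow> u \<in> borel_measurable (lebesgue_on S) \<and>
     integrable (lebesgue_on S) (\<lambda>x. (norm (u x))\<^sup>2)"

text \<open>Only meaningful for functions satisfying \<^const>\<open>L2\<close>: a divergent integral has value 0.\<close>

definition L2norm :: "'a::euclidean_space set \<Rightarrow> ('a \<Rightarrow> complex) \<Rightarrow> real" where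
  "L2norm S u = sqrt (integral\<^sup>L (lebesgue_on S) (\<lambda>x. (norm (u x))\<^sup>2))"

text \<open>\<open>u = (\<Sum>n\<in>\<int>. \<phi> n)\<close> with unconditional convergence in \<open>L\<^sup>2(S)\<close>; every member of the class of \<open>u\<close>
  modulo null sets qualifies as the sum.\<close>

definition L2_has_sum ::
  "'a::euclidean_space set \<Rightarrow> (int \<Rightarrow> 'a \<Rightarrow> complex) \<Rightarrow> ('a \<Rightarrow> complex) \<Rightarrow> bool" where
  "L2_has_sum S \<phi> u \<longleftrightarrow> (\<forall>n. L2 S (\<phi> n)) \<and> L2 S u \<and>
     ((\<lambda>N. L2norm S (\<lambda>x. u x - (\<Sum>n\<in>N. \<phi> n x))) \<longlongrightarrow> 0) (finite_subsets_at_top UNIV)"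

definition LLL_proj :: "(complex \<Rightarrow> complex) \<Rightarrow> complex \<Rightarrow> complex" where
  "LLL_proj u z = of_real (1 / pi) * exp (- of_real ((norm z)\<^sup>2 / 2)) *
     integral\<^sup>L lebesgue (\<lambda>w. exp (cnj w * z - of_real ((norm w)\<^sup>2 / 2)) * u w)"

definition LLL_tilde :: "(complex \<Rightarrow> complex) set" where
  "LLL_tilde = {u. (\<exists>F. F holomorphic_on UNIV \<and>
                      (\<forall>z. u z = exp (- of_real ((norm z)\<^sup>2 / 2)) * F z)) \<and>
                   (\<exists>M C. \<forall>z. norm (u z) \<le> C * sqrt (1 + (norm z)\<^sup>2) powr M)}"

definition magnetic_translation :: "complex \<Rightarrow> (complex \<Rightarrow> complex) \<Rightarrow> complex \<Rightarrow> complex" where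
  "magnetic_translation \<alpha> u z = exp ((\<alpha> * cnj z - cnj \<alpha> * z) / 2) * u (z + \<alpha>)"

definition LLL_periodic :: "real \<Rightarrow> (complex \<Rightarrow> complex) set" where
  "LLL_periodic r = {u \<in> LLL_tilde. magnetic_translation (of_real r) u = u}"

definition strip :: "real \<Rightarrow> complex set" where
  "strip r = {z. - r / 2 < Re z \<and> Re z \<le> r / 2}"

definition L2_LLL_periodic :: "real \<Rightarrow> (complex \<Rightarrow> complex) set" where
  "L2_LLL_periodic r = {u \<in> LLL_periodic r. L2 (strip r) u}"

definition \<tau> :: complex where
  "\<tau> = exp (2 * \<i> * of_real pi / 3)"

definition \<gamma> :: real where
  "\<gamma> = sqrt (2 * pi / sqrt 3)"

definition \<psi> :: "int \<Rightarrow> complex \<Rightarrow> complex" where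
  "\<psi> k z = of_real ((2 / (pi * \<gamma>\<^sup>2)) powr (1 / 4)) *
     exp (2 * \<i> * of_int k * of_real pi * z / of_real \<gamma> + \<i> * of_real pi * \<tau> * (of_int k)\<^sup>2
          + z\<^sup>2 / 2 - of_real ((norm z)\<^sup>2 / 2))"

definition \<Psi>\<^sub>0 :: "complex \<Rightarrow> complex" where
  "\<Psi>\<^sub>0 z = (\<Sum>\<^sub>\<infinity>n. \<psi> n z)"

definition ell :: "real \<Rightarrow> real" where
  "ell \<xi> = 1 + 2 * (\<Sum>\<^sub>\<infinity>k\<in>{1::nat..}. exp (- (pi\<^sup>2 * (real k)\<^sup>2 / \<gamma>\<^sup>2)) * cos (2 * pi * real k * \<xi>))"

definition hodd :: "real \<Rightarrow> real" where
  "hodd \<xi> = 2 * (\<Sum>\<^sub>\<infinity>k::nat. exp (- (pi\<^sup>2 * (2 * real k + 1)\<^sup>2 / \<gamma>\<^sup>2)) *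
                              cos (2 * (2 * real k + 1) * pi * \<xi>))"

definition lam :: real where
  "lam = 1 / (\<gamma> * sqrt pi) * ((ell 0)\<^sup>2 - 2 * (hodd 0)\<^sup>2)"

definition coeff_a :: "real \<Rightarrow> real" where
  "coeff_a \<xi> = 2 / (\<gamma> * sqrt pi) * (ell \<xi> * ell 0 - 2 * hodd \<xi> * hodd 0) - lam"

definition coeff_b :: "real \<Rightarrow> real" where
  "coeff_b \<xi> = 1 / (\<gamma> * sqrt pi) * ((ell \<xi>)\<^sup>2 - 2 * (hodd \<xi>)\<^sup>2)"

definition \<mu> :: "real \<Rightarrow> real" where
  "\<mu> \<xi> = sqrt ((coeff_a \<xi>)\<^sup>2 - (coeff_b \<xi>)\<^sup>2)"

text \<open>Strong solutions on \<open>[0, \<infinity>)\<close> with values in the Hilbert space \<open>L\<^sup>2(S\<^sub>\<gamma>) \<inter> F\<^sub>\<gamma>\<close>: the time derivative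
  \<open>v'\<close> is the limit of the difference quotients in the norm of that space (one-sided at \<open>t = 0\<close>).\<close>

definition has_L2_time_deriv ::
  "(real \<Rightarrow> complex \<Rightarrow> complex) \<Rightarrow> (complex \<Rightarrow> complex) \<Rightarrow> real \<Rightarrow> bool" where
  "has_L2_time_deriv v v' t \<longleftrightarrow>
     ((\<lambda>s. L2norm (strip \<gamma>) (\<lambda>z. (v s z - v t z) / of_real (s - t) - v' z)) \<longlongrightarrow> 0) (at t within {0..})"

definition linearised_LLL_solution :: "(real \<Rightarrow> complex \<Rightarrow> complex) \<Rightarrow> bool" where
  "linearised_LLL_solution v \<longleftrightarrow>
     (\<forall>t\<ge>0. v t \<in> L2_LLL_periodic \<gamma> \<and>
        (\<exists>v' \<in> L2_LLL_periodic \<gamma>. has_L2_time_deriv v v' t \<and>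
           (\<forall>z. \<i> * v' z + of_real lam * v t z =
              LLL_proj (\<lambda>w. 2 * of_real ((norm (\<Psi>\<^sub>0 w))\<^sup>2) * v t w + (\<Psi>\<^sub>0 w)\<^sup>2 * cnj (v t w)) z)))"

text \<open>A function on the circle is a 1-periodic function on the real line, so that \<open>f t (- \<xi>)\<close> makes
  sense for \<open>\<xi>\<close> in \<open>[0, 1]\<close>. It follows that \<open>g t\<close> is the sum of the series with coefficients \<open>cnj (c t n)\<close>.\<close>

definition solution_with_transforms ::
  "(real \<Rightarrow> complex \<Rightarrow> complex) \<Rightarrow> (real \<Rightarrow> int \<Rightarrow> complex) \<Rightarrow>
   (real \<Rightarrow> real \<Rightarrow> complex) \<Rightarrow> (real \<Rightarrow> real \<Rightarrow> complex) \<Rightarrow> bool" where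
  "solution_with_transforms v c f g \<longleftrightarrow>
     linearised_LLL_solution v \<and>
     (\<forall>t\<ge>0. L2_has_sum (strip \<gamma>) (\<lambda>n z. c t n * \<psi> n z) (v t)) \<and>
     (\<forall>t\<ge>0. \<forall>\<xi>. f t (\<xi> + 1) = f t \<xi>) \<and>
     (\<forall>t\<ge>0. L2_has_sum {0..1} (\<lambda>n \<xi>. c t n * exp (- 2 * of_real pi * \<i> * of_int n * of_real \<xi>)) (f t)) \<and>
     (\<forall>t\<ge>0. \<forall>\<xi>. g t \<xi> = cnj (f t (- \<xi>)))"

end

theory Submission
  imports Defs "HOL-Probability.Probability"
begin

text \<open>
  In the basis \<open>\<psi>\<^sub>n\<close> the equation becomes a convolution system for the coefficients \<open>c\<^sub>n\<close>, because
  \<open>\<integral> \<psi>\<^sub>n\<^sub>+\<^sub>p \<psi>\<^sub>n\<^sub>+\<^sub>q cnj(\<psi>\<^sub>n\<^sub>+\<^sub>p\<^sub>+\<^sub>q) cnj(\<psi>\<^sub>n) = \<kappa> (-1)^(pq) E\<^sub>p E\<^sub>q\<close> on a strip, with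
  \<open>\<kappa> = 1/(\<gamma>\<surd>\<pi>)\<close> and \<open>E\<^sub>p = exp(-\<pi>\<^sup>2p\<^sup>2/\<gamma>\<^sup>2)\<close>; the projection disappears since it is symmetric and fixes \<open>\<psi>\<^sub>n\<close>.
  Under the Fourier transform the system becomes \<open>i f' = a f + b g\<close>, hence for \<open>u = f + g\<close>, \<open>w = f - g\<close>
  the pair \<open>i u' = (a - b) w\<close>, \<open>i w' = (a + b) u\<close>, solved pointwise in \<open>\<xi>\<close> by
  \<open>u(t) = cos(\<mu>t) u\<^sub>0 - i (\<mu>/(a + b)) sin(\<mu>t) w\<^sub>0\<close> and \<open>\<mu> w(t) = \<mu> cos(\<mu>t) w\<^sub>0 - i (a + b) sin(\<mu>t) u\<^sub>0\<close>.
  Both estimates follow because \<open>a + b\<close> is bounded above and bounded away from zero, and because \<open>\<mu> > 0\<close> on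
  \<open>(0, 1)\<close>. The latter rests on \<open>a - b = \<kappa> (2 (h(0) - h(\<xi>))\<^sup>2 - (\<ell>(0) - \<ell>(\<xi>))\<^sup>2)\<close>: the terms with even
  index, by which the two differences differ, are negligible against the first odd one.
\<close>

subsection \<open>Square-integrable functions and orthonormal systems\<close>

text \<open>Solutions are differentiable only in the norm of the strip space, so a derivative in t
  need not exist pointwise in \<xi>, and the 2 x 2 system cannot be treated as a family of ordinary
  differential equations. It is solved weakly: data propagated from time t to a fixed T is paired
  with a fixed test function, the pairing is constant in t, and equality almost everywhere follows.
  The other obstacle is the passage from the strip to the circle. Equal coefficients identify two
  functions only inside the closed span of the system. Time derivatives lie in the span of the
  \<open>\<psi> n\<close> as limits of difference quotients; a f + b g lies in the span of the
  exponentials because the theta series are uniform limits of trigonometric polynomials. The final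
  constants depend on \<kappa> alone, for every j: the propagator couples f + g to f - g through
  exactly one factor \<mu>, so the weights cancel pointwise.\<close>

lemma borel_measurable_cnj [measurable (raw)]:
  "f \<in> borel_measurable M \<Longrightarrow> (\<lambda>x. cnj (f x)) \<in> borel_measurable M"
  by (rule measurable_compose[OF _ borel_measurable_continuous_onI]) (auto intro!: continuous_intros)

definition L2ip :: "'a::euclidean_space set \<Rightarrow> ('a \<Rightarrow> complex) \<Rightarrow> ('a \<Rightarrow> complex) \<Rightarrow> complex" where
  "L2ip S u w = integral\<^sup>L (lebesgue_on S) (\<lambda>x. u x * cnj (w x))"

lemma L2_measurable: "L2 S u \<Longrightarrow> u \<in> borel_measurable (lebesgue_on S)"
  by (simp add: L2_def)

lemma L2_dominated2:
  assumes "u \<in> borel_measurable (lebesgue_on S)" "L2 S v" "L2 S w"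
    "AE x in lebesgue_on S. norm (u x) \<le> norm (v x) + norm (w x)"
  shows "L2 S u"
proof -
  have "integrable (lebesgue_on S) (\<lambda>x. 2 * (norm (v x))\<^sup>2 + 2 * (norm (w x))\<^sup>2)"
    using assms by (auto simp: L2_def)
  then have "integrable (lebesgue_on S) (\<lambda>x. (norm (u x))\<^sup>2)"
  proof (rule Bochner_Integration.integrable_bound)
    show "(\<lambda>x. (norm (u x))\<^sup>2) \<in> borel_measurable (lebesgue_on S)"
      using assms(1) by measurable
    show "AE x in lebesgue_on S. norm ((norm (u x))\<^sup>2) \<le> norm (2 * (norm (v x))\<^sup>2 + 2 * (norm (w x))\<^sup>2)"
      using assms(4)
    proof eventually_elim
      case (elim x)
      have "(norm (u x))\<^sup>2 \<le> (norm (v x) + norm (w x))\<^sup>2"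
        using elim by (intro power_mono) auto
      also have "\<dots> \<le> 2 * (norm (v x))\<^sup>2 + 2 * (norm (w x))\<^sup>2"
        using sum_squares_bound[of "norm (v x)" "norm (w x)"] by (simp add: power2_sum)
      finally show ?case by simp
    qed
  qed
  then show ?thesis using assms by (simp add: L2_def)
qed

lemma L2_zero [simp]: "L2 S (\<lambda>x. 0)"
  by (simp add: L2_def)

lemma L2_dominated:
  assumes "u \<in> borel_measurable (lebesgue_on S)" "L2 S v"
    "AE x in lebesgue_on S. norm (u x) \<le> norm (v x)"
  shows "L2 S u"
  by (rule L2_dominated2[OF assms(1,2) L2_zero]) (use assms(3) in auto)

lemma L2_add: "L2 S u \<Longrightarrow> L2 S w \<Longrightarrow> L2 S (\<lambda>x. u x + w x)"
  by (rule L2_dominated2[of _ _ u w])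
    (auto simp: norm_triangle_ineq intro!: borel_measurable_add[OF L2_measurable L2_measurable])

lemma L2_bounded_mult:
  assumes "L2 S u" "b \<in> borel_measurable (lebesgue_on S)" "\<And>x. x \<in> S \<Longrightarrow> norm (b x) \<le> K"
  shows "L2 S (\<lambda>x. b x * u x)"
proof -
  have "integrable (lebesgue_on S) (\<lambda>x. K\<^sup>2 * (norm (u x))\<^sup>2)"
    using assms(1) by (auto simp: L2_def)
  then have "integrable (lebesgue_on S) (\<lambda>x. (norm (b x * u x))\<^sup>2)"
  proof (rule Bochner_Integration.integrable_bound)
    show "(\<lambda>x. (norm (b x * u x))\<^sup>2) \<in> borel_measurable (lebesgue_on S)"
      using L2_measurable[OF assms(1)] assms(2) by measurable
    show "AE x in lebesgue_on S. norm ((norm (b x * u x))\<^sup>2) \<le> norm (K\<^sup>2 * (norm (u x))\<^sup>2)"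
    proof (rule AE_I2)
      fix x assume "x \<in> space (lebesgue_on S)"
      then have "norm (b x) \<le> K" using assms(3) by simp
      then have "(norm (b x))\<^sup>2 \<le> K\<^sup>2" by (intro power_mono) auto
      then show "norm ((norm (b x * u x))\<^sup>2) \<le> norm (K\<^sup>2 * (norm (u x))\<^sup>2)"
        by (simp add: norm_mult power_mult_distrib mult_right_mono)
    qed
  qed
  then show ?thesis
    using L2_measurable[OF assms(1)] assms(2) by (simp add: L2_def)
qed

lemma L2_cmult: "L2 S u \<Longrightarrow> L2 S (\<lambda>x. c * u x)"
  by (rule L2_bounded_mult) auto

lemma L2_uminus: "L2 S u \<Longrightarrow> L2 S (\<lambda>x. - u x)"
  using L2_cmult[of S u "-1"] by simp

lemma L2_diff: "L2 S u \<Longrightarrow> L2 S w \<Longrightarrow> L2 S (\<lambda>x. u x - w x)"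
  using L2_add[OF _ L2_uminus, of S u w] by simp

lemma L2_divide: "L2 S u \<Longrightarrow> L2 S (\<lambda>x. u x / c)"
  using L2_cmult[of S u "inverse c"] by (simp add: field_simps)

lemma L2_sum: "finite N \<Longrightarrow> (\<And>n. n \<in> N \<Longrightarrow> L2 S (\<phi> n)) \<Longrightarrow> L2 S (\<lambda>x. \<Sum>n\<in>N. \<phi> n x)"
  by (induction N rule: finite_induct) (auto intro!: L2_add)

lemma L2_cnj: "L2 S u \<Longrightarrow> L2 S (\<lambda>x. cnj (u x))"
  unfolding L2_def by (auto intro: borel_measurable_cnj)

lemma L2_mult_cnj_integrable:
  assumes "L2 S u" "L2 S w"
  shows "integrable (lebesgue_on S) (\<lambda>x. u x * cnj (w x))"
proof (rule Bochner_Integration.integrable_bound)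
  show "integrable (lebesgue_on S) (\<lambda>x. (norm (u x))\<^sup>2 + (norm (w x))\<^sup>2)"
    using assms by (auto simp: L2_def)
  show "(\<lambda>x. u x * cnj (w x)) \<in> borel_measurable (lebesgue_on S)"
    using assms[THEN L2_measurable] by measurable
  show "AE x in lebesgue_on S. norm (u x * cnj (w x)) \<le> norm ((norm (u x))\<^sup>2 + (norm (w x))\<^sup>2)"
  proof (rule AE_I2)
    fix x
    have "norm (u x) * norm (w x) \<le> (norm (u x))\<^sup>2 + (norm (w x))\<^sup>2"
      using sum_squares_bound[of "norm (u x)" "norm (w x)"] mult_nonneg_nonneg[OF norm_ge_zero norm_ge_zero, of "u x" "w x"]
      unfolding mult.assoc by linarith
    then show "norm (u x * cnj (w x)) \<le> norm ((norm (u x))\<^sup>2 + (norm (w x))\<^sup>2)"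
      by (simp add: norm_mult)
  qed
qed

lemma L2ip_add_left: "L2 S u \<Longrightarrow> L2 S v \<Longrightarrow> L2 S w \<Longrightarrow> L2ip S (\<lambda>x. u x + v x) w = L2ip S u w + L2ip S v w"
  unfolding L2ip_def by (simp add: ring_distribs L2_mult_cnj_integrable)

lemma L2ip_diff_left: "L2 S u \<Longrightarrow> L2 S v \<Longrightarrow> L2 S w \<Longrightarrow> L2ip S (\<lambda>x. u x - v x) w = L2ip S u w - L2ip S v w"
  unfolding L2ip_def by (simp add: ring_distribs L2_mult_cnj_integrable)

lemma L2ip_cmult_left: "L2ip S (\<lambda>x. c * u x) w = c * L2ip S u w"
  unfolding L2ip_def by (simp add: mult.assoc)

lemma L2ip_cnj: "cnj (L2ip S u w) = L2ip S w u"
  unfolding L2ip_def by (subst Bochner_Integration.integral_cnj[symmetric]) (simp add: mult.commute)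

lemma L2ip_sum_left:
  assumes "finite N" "\<And>n. n \<in> N \<Longrightarrow> L2 S (\<phi> n)" "L2 S w"
  shows "L2ip S (\<lambda>x. \<Sum>n\<in>N. \<phi> n x) w = (\<Sum>n\<in>N. L2ip S (\<phi> n) w)"
  using assms by (induction N rule: finite_induct) (auto simp: L2ip_add_left L2_sum, simp add: L2ip_def)

lemma L2ip_self: "L2ip S u u = of_real ((L2norm S u)\<^sup>2)"
proof -
  have "L2ip S u u = integral\<^sup>L (lebesgue_on S) (\<lambda>x. of_real ((norm (u x))\<^sup>2))"
    unfolding L2ip_def by (simp add: complex_norm_square[symmetric])
  also have "\<dots> = of_real (integral\<^sup>L (lebesgue_on S) (\<lambda>x. (norm (u x))\<^sup>2))"
    by (rule integral_complex_of_real)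
  finally show ?thesis by (simp add: L2norm_def)
qed

lemma L2norm_nonneg [simp]: "0 \<le> L2norm S u"
  by (simp add: L2norm_def)

lemma L2norm_power2: "(L2norm S u)\<^sup>2 = integral\<^sup>L (lebesgue_on S) (\<lambda>x. (norm (u x))\<^sup>2)"
  by (simp add: L2norm_def)

lemma L2norm_cmult: "L2norm S (\<lambda>x. c * u x) = norm c * L2norm S u"
  unfolding L2norm_def by (simp add: norm_mult power_mult_distrib real_sqrt_mult)

lemma L2norm_uminus: "L2norm S (\<lambda>x. - u x) = L2norm S u"
  unfolding L2norm_def by simp

lemma L2norm_minus_commute: "L2norm S (\<lambda>x. u x - w x) = L2norm S (\<lambda>x. w x - u x)"
  unfolding L2norm_def by (simp add: norm_minus_commute)

lemma L2norm_mono: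
  assumes "u \<in> borel_measurable (lebesgue_on S)" "L2 S v" "AE x in lebesgue_on S. norm (u x) \<le> norm (v x)"
  shows "L2norm S u \<le> L2norm S v"
proof -
  have "L2 S u" using assms by (rule L2_dominated)
  then have "integral\<^sup>L (lebesgue_on S) (\<lambda>x. (norm (u x))\<^sup>2) \<le> integral\<^sup>L (lebesgue_on S) (\<lambda>x. (norm (v x))\<^sup>2)"
    using assms by (intro integral_mono_AE) (auto simp: L2_def elim!: eventually_mono intro!: power_mono)
  then show ?thesis by (simp add: L2norm_def)
qed

text \<open>The choice \<alpha> = r, \<beta> = p would give the claim at once, but both weights must
  be positive while p or r may vanish. Hence both are enlarged by a small d.\<close>

lemma quadratic_mean_bound:
  fixes p r I :: real
  assumes "0 \<le> p" "0 \<le> r" and *: "\<And>\<alpha> \<beta>. 0 < \<alpha> \<Longrightarrow> 0 < \<beta> \<Longrightarrow> 2 * \<alpha> * \<beta> * I \<le> \<alpha>\<^sup>2 * p\<^sup>2 + \<beta>\<^sup>2 * r\<^sup>2"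
  shows "I \<le> p * r"
proof (rule field_le_epsilon)
  fix e :: real assume "0 < e"
  \<comment> \<open>Since d \<le> 1, the square d * d is at most d, so the excess of (r + d) * (p +
    d) over p * r is at most d * (p + r + 1), which is at most e.\<close>
  define d where "d = min 1 (e / (p + r + 1))"
  have d: "0 < d" "d \<le> 1" "d * (p + r + 1) \<le> e"
    using \<open>0 < e\<close> assms mult_right_mono[of d "e / (p + r + 1)" "p + r + 1"] by (auto simp: d_def)
  have "2 * (r + d) * (p + d) * I \<le> (r + d)\<^sup>2 * p\<^sup>2 + (p + d)\<^sup>2 * r\<^sup>2"
    using assms d by (intro *) auto
  also have "\<dots> \<le> (r + d)\<^sup>2 * (p + d)\<^sup>2 + (p + d)\<^sup>2 * (r + d)\<^sup>2"
    using assms d by (intro add_mono mult_left_mono power_mono) auto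
  also have "\<dots> = 2 * (r + d) * (p + d) * ((r + d) * (p + d))"
    by (simp add: power2_eq_square algebra_simps)
  finally have "I \<le> (r + d) * (p + d)"
    using assms d by (subst (asm) mult_le_cancel_left_pos) auto
  also have "\<dots> \<le> p * r + d * (p + r + 1)"
    using mult_left_mono[OF d(2), of d] d(1) by (simp add: algebra_simps)
  finally show "I \<le> p * r + e" using d by simp
qed

text \<open>Integrating 2 \<alpha> \<beta> |u| |w| \<le> \<alpha>^2 |u|^2 + \<beta>^2 |w|^2 leaves a
  family of inequalities between numbers, which \<open>quadratic_mean_bound\<close>
  optimises.\<close>

lemma L2ip_Cauchy_Schwarz:
  assumes "L2 S u" "L2 S w"
  shows "norm (L2ip S u w) \<le> L2norm S u * L2norm S w"
proof (rule quadratic_mean_bound)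
  fix \<alpha> \<beta> :: real assume "0 < \<alpha>" "0 < \<beta>"
  have "norm (L2ip S u w) \<le> integral\<^sup>L (lebesgue_on S) (\<lambda>x. norm (u x * cnj (w x)))"
    unfolding L2ip_def by (rule integral_norm_bound)
  then have "2 * \<alpha> * \<beta> * norm (L2ip S u w) \<le> 2 * \<alpha> * \<beta> * integral\<^sup>L (lebesgue_on S) (\<lambda>x. norm (u x * cnj (w x)))"
    using \<open>0 < \<alpha>\<close> \<open>0 < \<beta>\<close> by simp
  also have "\<dots> = integral\<^sup>L (lebesgue_on S) (\<lambda>x. 2 * \<alpha> * \<beta> * norm (u x * cnj (w x)))"
    by simp
  also have "\<dots> \<le> integral\<^sup>L (lebesgue_on S) (\<lambda>x. \<alpha>\<^sup>2 * (norm (u x))\<^sup>2 + \<beta>\<^sup>2 * (norm (w x))\<^sup>2)"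
  proof (rule integral_mono)
    show "integrable (lebesgue_on S) (\<lambda>x. 2 * \<alpha> * \<beta> * norm (u x * cnj (w x)))"
      using L2_mult_cnj_integrable[OF assms] by (intro integrable_mult_right integrable_norm)
    show "integrable (lebesgue_on S) (\<lambda>x. \<alpha>\<^sup>2 * (norm (u x))\<^sup>2 + \<beta>\<^sup>2 * (norm (w x))\<^sup>2)"
      using assms by (auto simp: L2_def)
    show "2 * \<alpha> * \<beta> * norm (u x * cnj (w x)) \<le> \<alpha>\<^sup>2 * (norm (u x))\<^sup>2 + \<beta>\<^sup>2 * (norm (w x))\<^sup>2" for x
      using sum_squares_bound[of "\<alpha> * norm (u x)" "\<beta> * norm (w x)"]
      by (simp add: norm_mult power_mult_distrib mult_ac)
  qed
  also have "\<dots> = \<alpha>\<^sup>2 * (L2norm S u)\<^sup>2 + \<beta>\<^sup>2 * (L2norm S w)\<^sup>2"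
    unfolding L2norm_power2 using assms by (subst Bochner_Integration.integral_add) (auto simp: L2_def)
  finally show "2 * \<alpha> * \<beta> * norm (L2ip S u w) \<le> \<alpha>\<^sup>2 * (L2norm S u)\<^sup>2 + \<beta>\<^sup>2 * (L2norm S w)\<^sup>2" .
qed auto

lemma L2norm_add_power2:
  assumes "L2 S u" "L2 S w"
  shows "(L2norm S (\<lambda>x. u x + w x))\<^sup>2 = (L2norm S u)\<^sup>2 + (L2norm S w)\<^sup>2 + 2 * Re (L2ip S u w)"
proof -
  have *: "(norm (u x + w x))\<^sup>2 = (norm (u x))\<^sup>2 + (norm (w x))\<^sup>2 + 2 * Re (u x * cnj (w x))" for x
    by (simp only: cmod_power2) (simp add: power2_eq_square algebra_simps)
  have "integral\<^sup>L (lebesgue_on S) (\<lambda>x. Re (u x * cnj (w x))) = Re (L2ip S u w)"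
    unfolding L2ip_def by (rule integral_Re[OF L2_mult_cnj_integrable[OF assms]])
  moreover have "integrable (lebesgue_on S) (\<lambda>x. Re (u x * cnj (w x)))"
    by (rule integrable_Re[OF L2_mult_cnj_integrable[OF assms]])
  ultimately show ?thesis
    unfolding L2norm_power2 * using assms by (simp add: L2_def del: times_complex.sel)
qed

lemma L2norm_triangle:
  assumes "L2 S u" "L2 S w"
  shows "L2norm S (\<lambda>x. u x + w x) \<le> L2norm S u + L2norm S w"
proof (rule power2_le_imp_le)
  have "Re (L2ip S u w) \<le> L2norm S u * L2norm S w"
    using L2ip_Cauchy_Schwarz[OF assms] complex_Re_le_cmod order_trans by blast
  then show "(L2norm S (\<lambda>x. u x + w x))\<^sup>2 \<le> (L2norm S u + L2norm S w)\<^sup>2"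
    by (simp add: L2norm_add_power2[OF assms] power2_sum)
qed simp

lemma L2norm_triangle_diff:
  assumes "L2 S u" "L2 S w"
  shows "L2norm S u \<le> L2norm S w + L2norm S (\<lambda>x. u x - w x)"
  using L2norm_triangle[OF assms(2) L2_diff[OF assms]] by simp

lemma L2norm_triangle3:
  assumes "L2 S u" "L2 S v" "L2 S w"
  shows "L2norm S (\<lambda>x. u x - w x) \<le> L2norm S (\<lambda>x. u x - v x) + L2norm S (\<lambda>x. v x - w x)"
  using L2norm_triangle[OF L2_diff[OF assms(1,2)] L2_diff[OF assms(2,3)]] by simp

lemma L2norm_abs_diff:
  assumes "L2 S u" "L2 S w"
  shows "\<bar>L2norm S u - L2norm S w\<bar> \<le> L2norm S (\<lambda>x. u x - w x)"
  using L2norm_triangle_diff[OF assms] L2norm_triangle_diff[OF assms(2,1)] L2norm_minus_commute[of S u w]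
  by linarith

text \<open>The sum of the nonnegative functions p |v| and r |w| dominates u, so monotonicity and
  the triangle inequality suffice. In this form the pointwise bounds on the solution become the norm
  estimates of the theorem.\<close>

lemma L2norm_le_combination:
  assumes "u \<in> borel_measurable (lebesgue_on S)" "L2 S v" "L2 S w" "0 \<le> p" "0 \<le> r"
    and "AE x in lebesgue_on S. norm (u x) \<le> p * norm (v x) + r * norm (w x)"
  shows "L2 S u" "L2norm S u \<le> p * L2norm S v + r * L2norm S w"
proof -
  define v' where "v' = (\<lambda>x. of_real (p * norm (v x)) :: complex)"
  define w' where "w' = (\<lambda>x. of_real (r * norm (w x)) :: complex)"
  have L2: "L2 S v'" "L2 S w'"
    using assms(2,3) unfolding v'_def w'_def L2_def
    by (auto simp: norm_mult power_mult_distrib)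
  have AE: "AE x in lebesgue_on S. norm (u x) \<le> norm (v' x + w' x)"
    using assms(6) unfolding v'_def w'_def of_real_add[symmetric] norm_of_real
    by (rule eventually_mono) auto
  show "L2 S u"
    using L2_dominated[OF assms(1) L2_add[OF L2] AE] .
  have "L2norm S u \<le> L2norm S (\<lambda>x. v' x + w' x)"
    by (rule L2norm_mono[OF assms(1) L2_add[OF L2] AE])
  also have "\<dots> \<le> L2norm S v' + L2norm S w'"
    by (rule L2norm_triangle[OF L2])
  also have "L2norm S v' = p * L2norm S v"
    unfolding v'_def L2norm_def using assms(4) by (simp add: norm_mult power_mult_distrib real_sqrt_mult)
  also have "L2norm S w' = r * L2norm S w"
    unfolding w'_def L2norm_def using assms(5) by (simp add: norm_mult power_mult_distrib real_sqrt_mult)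
  finally show "L2norm S u \<le> p * L2norm S v + r * L2norm S w" .
qed

lemma L2norm_bounded_mult:
  assumes "L2 S u" "b \<in> borel_measurable (lebesgue_on S)" "\<And>x. x \<in> S \<Longrightarrow> norm (b x) \<le> K" "0 \<le> K"
  shows "L2norm S (\<lambda>x. b x * u x) \<le> K * L2norm S u"
proof -
  have "L2norm S (\<lambda>x. b x * u x) \<le> K * L2norm S u + 0 * L2norm S u"
    by (rule L2norm_le_combination(2)[OF _ assms(1,1,4) order_refl])
      (use assms in \<open>auto intro!: borel_measurable_times[OF _ L2_measurable] mult_right_mono AE_I2 simp: norm_mult\<close>)
  then show ?thesis by simp
qed

section \<open>Unconditional sums and orthonormal expansions\<close>

lemma L2_has_sumD:
  assumes "L2_has_sum S \<phi> u"
  shows "L2 S (\<phi> n)" "L2 S u"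
    "((\<lambda>N. L2norm S (\<lambda>x. u x - (\<Sum>n\<in>N. \<phi> n x))) \<longlongrightarrow> 0) (finite_subsets_at_top UNIV)"
  using assms unfolding L2_has_sum_def by auto

text \<open>Continuity of the inner product. It replaces a sum of functions by a sum of numbers,
  where uniqueness of limits identifies coefficients and matrix elements.\<close>

lemma L2_has_sum_ip:
  assumes "L2_has_sum S \<phi> u" "L2 S w"
  shows "((\<lambda>n. L2ip S (\<phi> n) w) has_sum L2ip S u w) UNIV"
  unfolding has_sum_def
proof (rule LIM_zero_cancel, rule Lim_null_comparison)
  note L2 = L2_has_sumD[OF assms(1)]
  show "((\<lambda>N. L2norm S (\<lambda>x. u x - (\<Sum>n\<in>N. \<phi> n x)) * L2norm S w) \<longlongrightarrow> 0) (finite_subsets_at_top UNIV)"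
    by (rule tendsto_mult_left_zero[OF L2(3)])
  show "\<forall>\<^sub>F N in finite_subsets_at_top UNIV. norm ((\<Sum>n\<in>N. L2ip S (\<phi> n) w) - L2ip S u w)
     \<le> L2norm S (\<lambda>x. u x - (\<Sum>n\<in>N. \<phi> n x)) * L2norm S w"
  proof (rule eventually_finite_subsets_at_top_weakI)
    fix N :: "int set" assume N: "finite N"
    have "L2ip S (\<lambda>x. u x - (\<Sum>n\<in>N. \<phi> n x)) w = L2ip S u w - (\<Sum>n\<in>N. L2ip S (\<phi> n) w)"
      using N L2 assms(2) by (subst L2ip_diff_left) (auto intro!: L2_sum simp: L2ip_sum_left)
    then have "norm ((\<Sum>n\<in>N. L2ip S (\<phi> n) w) - L2ip S u w) = norm (L2ip S (\<lambda>x. u x - (\<Sum>n\<in>N. \<phi> n x)) w)"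
      by (simp add: norm_minus_commute)
    also have "\<dots> \<le> L2norm S (\<lambda>x. u x - (\<Sum>n\<in>N. \<phi> n x)) * L2norm S w"
      using N L2 assms(2) by (intro L2ip_Cauchy_Schwarz L2_diff L2_sum) auto
    finally show "norm ((\<Sum>n\<in>N. L2ip S (\<phi> n) w) - L2ip S u w) \<le> L2norm S (\<lambda>x. u x - (\<Sum>n\<in>N. \<phi> n x)) * L2norm S w" .
  qed
qed

lemma L2_has_sum_linear:
  assumes "L2_has_sum S \<phi> u" "L2_has_sum S \<eta> w"
  shows "L2_has_sum S (\<lambda>n x. p * \<phi> n x + r * \<eta> n x) (\<lambda>x. p * u x + r * w x)"
  unfolding L2_has_sum_def
proof (intro conjI allI)
  note A = L2_has_sumD[OF assms(1)] and B = L2_has_sumD[OF assms(2)]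
  show "L2 S (\<lambda>x. p * \<phi> n x + r * \<eta> n x)" for n
    using A B by (intro L2_add L2_cmult)
  show "L2 S (\<lambda>x. p * u x + r * w x)"
    using A B by (intro L2_add L2_cmult)
  have "((\<lambda>N. norm p * L2norm S (\<lambda>x. u x - (\<Sum>n\<in>N. \<phi> n x)) + norm r * L2norm S (\<lambda>x. w x - (\<Sum>n\<in>N. \<eta> n x)))
      \<longlongrightarrow> norm p * 0 + norm r * 0) (finite_subsets_at_top UNIV)"
    by (intro tendsto_intros A B)
  then show "((\<lambda>N. L2norm S (\<lambda>x. p * u x + r * w x - (\<Sum>n\<in>N. p * \<phi> n x + r * \<eta> n x))) \<longlongrightarrow> 0) (finite_subsets_at_top UNIV)"
  proof (rule Lim_null_comparison[rotated, OF tendsto_eq_rhs])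
    show "\<forall>\<^sub>F N in finite_subsets_at_top UNIV. norm (L2norm S (\<lambda>x. p * u x + r * w x - (\<Sum>n\<in>N. p * \<phi> n x + r * \<eta> n x)))
      \<le> norm p * L2norm S (\<lambda>x. u x - (\<Sum>n\<in>N. \<phi> n x)) + norm r * L2norm S (\<lambda>x. w x - (\<Sum>n\<in>N. \<eta> n x))"
    proof (rule eventually_finite_subsets_at_top_weakI)
      fix N :: "int set" assume N: "finite N"
      have "L2norm S (\<lambda>x. p * (u x - (\<Sum>n\<in>N. \<phi> n x)) + r * (w x - (\<Sum>n\<in>N. \<eta> n x)))
        \<le> L2norm S (\<lambda>x. p * (u x - (\<Sum>n\<in>N. \<phi> n x))) + L2norm S (\<lambda>x. r * (w x - (\<Sum>n\<in>N. \<eta> n x)))"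
        using N A B by (intro L2norm_triangle L2_cmult L2_diff L2_sum) auto
      then show "norm (L2norm S (\<lambda>x. p * u x + r * w x - (\<Sum>n\<in>N. p * \<phi> n x + r * \<eta> n x)))
      \<le> norm p * L2norm S (\<lambda>x. u x - (\<Sum>n\<in>N. \<phi> n x)) + norm r * L2norm S (\<lambda>x. w x - (\<Sum>n\<in>N. \<eta> n x))"
        unfolding L2norm_cmult by (simp add: sum.distrib sum_distrib_left algebra_simps)
    qed
  qed simp
qed

text \<open>Shared by the functions \<open>\<psi> n\<close> on the strip and the exponentials on the
  unit interval. The isometry between the two spans is what carries the equation from one side to
  the other.\<close>

locale L2_orthonormal =
  fixes S :: "'a::euclidean_space set" and \<phi> :: "int \<Rightarrow> 'a \<Rightarrow> complex"
  assumes L2_basis: "L2 S (\<phi> n)"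
    and ip_basis: "L2ip S (\<phi> m) (\<phi> n) = (if m = n then 1 else 0)"
begin

lemma L2_combination: "finite N \<Longrightarrow> L2 S (\<lambda>x. \<Sum>n\<in>N. c n * \<phi> n x)"
  by (intro L2_sum L2_cmult L2_basis)

lemma ip_combination:
  assumes "finite N"
  shows "L2ip S (\<lambda>x. \<Sum>n\<in>N. c n * \<phi> n x) (\<phi> k) = (if k \<in> N then c k else 0)"
proof -
  have "L2ip S (\<lambda>x. \<Sum>n\<in>N. c n * \<phi> n x) (\<phi> k) = (\<Sum>n\<in>N. c n * L2ip S (\<phi> n) (\<phi> k))"
    using assms by (subst L2ip_sum_left) (auto intro!: L2_cmult L2_basis simp: L2ip_cmult_left)
  also have "\<dots> = (\<Sum>n\<in>N. if n = k then c n else 0)"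
    by (intro sum.cong) (auto simp: ip_basis)
  finally show ?thesis using assms by simp
qed

lemma norm_combination:
  assumes "finite N"
  shows "(L2norm S (\<lambda>x. \<Sum>n\<in>N. c n * \<phi> n x))\<^sup>2 = (\<Sum>n\<in>N. (norm (c n))\<^sup>2)"
proof -
  let ?u = "\<lambda>x. \<Sum>n\<in>N. c n * \<phi> n x"
  have "L2ip S ?u ?u = (\<Sum>n\<in>N. c n * L2ip S (\<phi> n) ?u)"
    using assms by (subst L2ip_sum_left) (auto intro!: L2_cmult L2_basis L2_combination simp: L2ip_cmult_left)
  also have "\<dots> = (\<Sum>n\<in>N. c n * cnj (c n))"
  proof (intro sum.cong refl)
    fix n assume "n \<in> N"
    then show "c n * L2ip S (\<phi> n) ?u = c n * cnj (c n)"
      using ip_combination[OF assms, of c n] L2ip_cnj[of S ?u "\<phi> n"] by simp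
  qed
  also have "\<dots> = of_real (\<Sum>n\<in>N. (norm (c n))\<^sup>2)"
    by (simp add: complex_norm_square flip: of_real_power)
  finally show ?thesis
    unfolding L2ip_self of_real_eq_iff .
qed

lemma coeff_eq:
  assumes "L2_has_sum S (\<lambda>n x. c n * \<phi> n x) u"
  shows "L2ip S u (\<phi> k) = c k"
proof -
  have "((\<lambda>n. L2ip S (\<lambda>x. c n * \<phi> n x) (\<phi> k)) has_sum L2ip S u (\<phi> k)) UNIV"
    by (rule L2_has_sum_ip[OF assms L2_basis])
  then have "((\<lambda>n. if n = k then c n else 0) has_sum L2ip S u (\<phi> k)) UNIV"
    by (rule has_sum_cong[THEN iffD1, rotated]) (auto simp: L2ip_cmult_left ip_basis)
  moreover have "((\<lambda>n. if n = k then c n else 0) has_sum c k) UNIV"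
    using has_sum_finite_neutralI[of "{k}" UNIV "\<lambda>n. if n = k then c n else 0"] by auto
  ultimately show ?thesis by (rule has_sum_unique)
qed

lemma Parseval:
  assumes "L2_has_sum S (\<lambda>n x. c n * \<phi> n x) u"
  shows "((\<lambda>n. (norm (c n))\<^sup>2) has_sum (L2norm S u)\<^sup>2) UNIV"
proof -
  let ?s = "\<lambda>N x. \<Sum>n\<in>N. c n * \<phi> n x"
  note A = L2_has_sumD[OF assms]
  have "((\<lambda>N. L2norm S (?s N)) \<longlongrightarrow> L2norm S u) (finite_subsets_at_top UNIV)"
  proof (rule LIM_zero_cancel, rule Lim_null_comparison[OF _ A(3)])
    show "\<forall>\<^sub>F N in finite_subsets_at_top UNIV. norm (L2norm S (?s N) - L2norm S u) \<le> L2norm S (\<lambda>x. u x - ?s N x)"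
      by (rule eventually_finite_subsets_at_top_weakI)
        (use L2norm_abs_diff[OF A(2) L2_combination] in \<open>simp add: abs_minus_commute\<close>)
  qed
  then have "((\<lambda>N. (L2norm S (?s N))\<^sup>2) \<longlongrightarrow> (L2norm S u)\<^sup>2) (finite_subsets_at_top UNIV)"
    by (rule tendsto_power)
  then show ?thesis
    unfolding has_sum_def
    by (rule Lim_transform_eventually)
      (auto intro!: eventually_finite_subsets_at_top_weakI simp: norm_combination)
qed

text \<open>Pythagoras: the residual of the projection onto the indices N is orthogonal to that
  span, and the difference between the projection and a competitor supported in N0 lies in it, once
  the competitor is extended by zero to N.\<close>

lemma best_approximation:
  assumes "L2 S u" "finite N" "finite N0" "N0 \<subseteq> N"
  shows "L2norm S (\<lambda>x. u x - (\<Sum>n\<in>N. L2ip S u (\<phi> n) * \<phi> n x)) \<le> L2norm S (\<lambda>x. u x - (\<Sum>n\<in>N0. c n * \<phi> n x))"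
proof (rule power2_le_imp_le)
  define p where "p = (\<lambda>x. \<Sum>n\<in>N. L2ip S u (\<phi> n) * \<phi> n x)"
  define q where "q = (\<lambda>x. \<Sum>n\<in>N. (L2ip S u (\<phi> n) - (if n \<in> N0 then c n else 0)) * \<phi> n x)"
  have L2: "L2 S p" "L2 S q" "L2 S (\<lambda>x. u x - p x)"
    unfolding p_def q_def using assms by (auto intro!: L2_combination L2_diff)
  have eq: "u x - (\<Sum>n\<in>N0. c n * \<phi> n x) = (u x - p x) + q x" for x
  proof -
    have "(\<Sum>n\<in>N0. c n * \<phi> n x) = (\<Sum>n\<in>N. (if n \<in> N0 then c n else 0) * \<phi> n x)"
      using assms by (intro sum.mono_neutral_cong_left) auto
    then show ?thesis by (simp add: p_def q_def left_diff_distrib sum_subtractf)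
  qed
  have ort: "L2ip S (\<lambda>x. u x - p x) (\<phi> n) = 0" if "n \<in> N" for n
    using that assms L2 unfolding p_def
    by (subst L2ip_diff_left) (auto simp: L2_basis L2_combination ip_combination)
  have "L2ip S q (\<lambda>x. u x - p x) = (\<Sum>n\<in>N. (L2ip S u (\<phi> n) - (if n \<in> N0 then c n else 0)) * L2ip S (\<phi> n) (\<lambda>x. u x - p x))"
    unfolding q_def using assms L2 by (subst L2ip_sum_left) (auto intro!: L2_cmult L2_basis simp: L2ip_cmult_left)
  also have "\<dots> = 0"
    using ort by (intro sum.neutral) (metis L2ip_cnj complex_cnj_zero mult_zero_right)
  finally have "L2ip S (\<lambda>x. u x - p x) q = 0"
    by (metis L2ip_cnj complex_cnj_zero)
  then have "(L2norm S (\<lambda>x. (u x - p x) + q x))\<^sup>2 = (L2norm S (\<lambda>x. u x - p x))\<^sup>2 + (L2norm S q)\<^sup>2"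
    using L2norm_add_power2[OF L2(3,2)] by simp
  then show "(L2norm S (\<lambda>x. u x - (\<Sum>n\<in>N. L2ip S u (\<phi> n) * \<phi> n x)))\<^sup>2 \<le> (L2norm S (\<lambda>x. u x - (\<Sum>n\<in>N0. c n * \<phi> n x)))\<^sup>2"
    unfolding eq by (simp add: p_def)
qed simp

text \<open>A finite partial sum of a nearby expandable w is close to u, and by
  \<open>best_approximation\<close> every projection of u onto a larger finite index set is at least
  as close. This is convergence along finite sets, so the expandable functions form a closed
  set.\<close>

lemma has_sum_of_approximable:
  assumes "L2 S u" and approx: "\<And>e. 0 < e \<Longrightarrow> \<exists>c w. L2_has_sum S (\<lambda>n x. c n * \<phi> n x) w \<and> L2norm S (\<lambda>x. u x - w x) < e"
  shows "L2_has_sum S (\<lambda>n x. L2ip S u (\<phi> n) * \<phi> n x) u"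
  unfolding L2_has_sum_def
proof (intro conjI allI)
  show "L2 S (\<lambda>x. L2ip S u (\<phi> n) * \<phi> n x)" for n by (intro L2_cmult L2_basis)
  show "L2 S u" by fact
  show "((\<lambda>N. L2norm S (\<lambda>x. u x - (\<Sum>n\<in>N. L2ip S u (\<phi> n) * \<phi> n x))) \<longlongrightarrow> 0) (finite_subsets_at_top UNIV)"
  proof (rule tendstoI)
    fix e :: real assume "0 < e"
    then obtain c w where w: "L2_has_sum S (\<lambda>n x. c n * \<phi> n x) w" "L2norm S (\<lambda>x. u x - w x) < e / 2"
      using approx[of "e / 2"] by auto
    note A = L2_has_sumD[OF w(1)]
    have "\<forall>\<^sub>F N in finite_subsets_at_top UNIV. L2norm S (\<lambda>x. w x - (\<Sum>n\<in>N. c n * \<phi> n x)) < e / 2"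
      using tendstoD[OF A(3), of "e / 2"] \<open>0 < e\<close> by simp
    then obtain N0 where N0: "finite N0" "L2norm S (\<lambda>x. w x - (\<Sum>n\<in>N0. c n * \<phi> n x)) < e / 2"
      unfolding eventually_finite_subsets_at_top by blast
    have "L2norm S (\<lambda>x. u x - (\<Sum>n\<in>N0. c n * \<phi> n x)) < e"
      using L2norm_triangle3[OF assms(1) A(2) L2_combination[OF N0(1), of c]] w N0 by linarith
    then have "L2norm S (\<lambda>x. u x - (\<Sum>n\<in>N. L2ip S u (\<phi> n) * \<phi> n x)) < e" if "finite N" "N0 \<subseteq> N" for N
      using best_approximation[OF assms(1) that(1) N0(1) that(2), of c] by linarith
    then show "\<forall>\<^sub>F N in finite_subsets_at_top UNIV. dist (L2norm S (\<lambda>x. u x - (\<Sum>n\<in>N. L2ip S u (\<phi> n) * \<phi> n x))) 0 < e"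
      unfolding eventually_finite_subsets_at_top using N0(1) by (intro exI[of _ N0]) simp
  qed
qed

end

text \<open>Both squared norms are the same sum by Parseval. Applied to difference quotients minus
  derivatives, this transports differentiability in time.\<close>

lemma L2_isometry:
  assumes "L2_orthonormal S \<phi>" "L2_orthonormal S' \<phi>'"
    and "L2_has_sum S (\<lambda>n x. c n * \<phi> n x) u" "L2_has_sum S' (\<lambda>n x. c n * \<phi>' n x) w"
  shows "L2norm S u = L2norm S' w"
proof -
  have "(L2norm S u)\<^sup>2 = (L2norm S' w)\<^sup>2"
    using L2_orthonormal.Parseval[OF assms(1,3)] L2_orthonormal.Parseval[OF assms(2,4)] by (rule has_sum_unique)
  then show ?thesis by (simp add: power2_eq_iff_nonneg)
qed

subsection \<open>Integration over strips\<close>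

lemma borel_measurable_Complex [measurable (raw)]:
  assumes "f \<in> borel_measurable M" "g \<in> borel_measurable M"
  shows "(\<lambda>x. Complex (f x) (g x)) \<in> borel_measurable M"
  using assms unfolding Complex_eq by measurable

lemma borel_measurable_cis [measurable (raw)]:
  "f \<in> borel_measurable M \<Longrightarrow> (\<lambda>x. cis (f x)) \<in> borel_measurable M"
  by (rule measurable_compose[OF _ borel_measurable_continuous_onI]) (auto intro!: continuous_intros)

text \<open>The image of the product measure gives every box its area, which characterises Lebesgue
  measure. It makes Fubini available in the coordinates x and y.\<close>

lemma lborel_complex: "(lborel :: complex measure) = distr (lborel \<Otimes>\<^sub>M lborel) borel (\<lambda>p. Complex (fst p) (snd p))"
proof (rule lborel_eqI)
  have m: "(\<lambda>p. Complex (fst p) (snd p)) \<in> borel_measurable (lborel \<Otimes>\<^sub>M lborel)"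
    by measurable
  fix l u :: complex
  assume lu: "\<And>b. b \<in> Basis \<Longrightarrow> l \<bullet> b \<le> u \<bullet> b"
  have "(\<lambda>p. Complex (fst p) (snd p)) -` box l u = box (Re l, Im l) (Re u, Im u)"
    by (auto simp: box_def Basis_prod_def Basis_complex_def)
  moreover have "emeasure lborel (box (Re l, Im l) (Re u, Im u)) = ennreal ((Re u - Re l) * (Im u - Im l))"
    using lu[of 1] lu[of \<i>] by (subst emeasure_lborel_box) (auto simp: Basis_prod_def Basis_complex_def prod.union_disjoint)
  ultimately show "emeasure (distr (lborel \<Otimes>\<^sub>M lborel) borel (\<lambda>p. Complex (fst p) (snd p))) (box l u) = (\<Prod>b\<in>Basis. (u - l) \<bullet> b)"
    using emeasure_distr[OF m, of "box l u"]
    by (simp add: lborel_prod Basis_complex_def del: emeasure_lborel_box_eq)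
qed simp

lemma integral_lebesgue_complex:
  fixes f :: "complex \<Rightarrow> 'b::{banach, second_countable_topology}"
  assumes "f \<in> borel_measurable borel"
  shows "integral\<^sup>L lebesgue f = integral\<^sup>L (lborel \<Otimes>\<^sub>M lborel) (\<lambda>p. f (Complex (fst p) (snd p)))"
  using assms by (subst integral_completion) (simp, subst lborel_complex, subst integral_distr, simp_all)

lemma integrable_lebesgue_complex:
  fixes f :: "complex \<Rightarrow> 'b::{banach, second_countable_topology}"
  assumes "f \<in> borel_measurable borel"
  shows "integrable lebesgue f \<longleftrightarrow> integrable (lborel \<Otimes>\<^sub>M lborel) (\<lambda>p. f (Complex (fst p) (snd p)))"
  using assms by (subst integrable_completion) (simp, subst lborel_complex, subst integrable_distr_eq, simp_all)

lemma borel_strip [measurable, simp]: "strip r \<in> sets borel"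
  unfolding strip_def by measurable

lemma indicator_strip: "indicator (strip r) (Complex x y) = (indicator {- r / 2<..r / 2} x :: real)"
  by (simp add: strip_def indicator_def)

lemma integral_strip:
  fixes f :: "complex \<Rightarrow> 'b::{banach, second_countable_topology}"
  assumes "f \<in> borel_measurable borel"
  shows "integral\<^sup>L (lebesgue_on (strip r)) f =
    integral\<^sup>L (lborel \<Otimes>\<^sub>M lborel) (\<lambda>p. indicator {- r / 2<..r / 2} (fst p) *\<^sub>R f (Complex (fst p) (snd p)))"
  using assms by (subst integral_restrict_space) (simp, subst integral_lebesgue_complex, simp, simp add: indicator_strip)

lemma integrable_strip:
  fixes f :: "complex \<Rightarrow> 'b::{banach, second_countable_topology}"
  assumes "f \<in> borel_measurable borel"
  shows "integrable (lebesgue_on (strip r)) f \<longleftrightarrow>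
    integrable (lborel \<Otimes>\<^sub>M lborel) (\<lambda>p. indicator {- r / 2<..r / 2} (fst p) *\<^sub>R f (Complex (fst p) (snd p)))"
  using assms by (subst integrable_restrict_space) (simp, subst integrable_lebesgue_complex, simp, simp add: indicator_strip)

lemma borel_measurable_lebesgue_on_borel: "f \<in> borel_measurable borel \<Longrightarrow> f \<in> borel_measurable (lebesgue_on S)"
  by (intro measurable_restrict_space1 measurable_completion) simp

lemma integrable_pair_mult:
  fixes f :: "'a::euclidean_space \<Rightarrow> complex" and g :: "'b::euclidean_space \<Rightarrow> complex"
  assumes "integrable lborel f" "integrable lborel g"
  shows "integrable (lborel \<Otimes>\<^sub>M lborel) (\<lambda>p. f (fst p) * g (snd p))"
    and "integral\<^sup>L (lborel \<Otimes>\<^sub>M lborel) (\<lambda>p. f (fst p) * g (snd p)) = integral\<^sup>L lborel f * integral\<^sup>L lborel g"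
proof -
  have [measurable]: "f \<in> borel_measurable borel" "g \<in> borel_measurable borel"
    using assms by (auto dest: borel_measurable_integrable)
  show *: "integrable (lborel \<Otimes>\<^sub>M lborel) (\<lambda>p. f (fst p) * g (snd p))"
  proof (rule lborel_pair.Fubini_integrable)
    show "integrable lborel (\<lambda>x. \<integral>y. norm (f (fst (x, y)) * g (snd (x, y))) \<partial>lborel)"
      using assms by (simp add: norm_mult)
    show "AE x in lborel. integrable lborel (\<lambda>y. f (fst (x, y)) * g (snd (x, y)))"
      using assms by simp
  qed simp
  show "integral\<^sup>L (lborel \<Otimes>\<^sub>M lborel) (\<lambda>p. f (fst p) * g (snd p)) = integral\<^sup>L lborel f * integral\<^sup>L lborel g"
    using lborel_pair.integral_fst'[OF *] by simp
qed

lemma cis_int_period_integral_Icc: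
  fixes k :: int
  assumes "0 < r"
  shows "has_bochner_integral lborel (\<lambda>x. indicator {c..c + r} x *\<^sub>R cis (2 * pi * k * x / r)) (if k = 0 then of_real r else 0)"
proof (cases "k = 0")
  case True
  have "has_bochner_integral lborel (\<lambda>x. indicator {c..c + r} x *\<^sub>R (1::complex)) (of_real (c + r) - of_real c)"
    by (rule has_bochner_integral_FTC_Icc) (use assms in \<open>auto intro!: derivative_eq_intros\<close>)
  then show ?thesis using True assms by (simp add: scaleR_conv_of_real)
next
  case False
  define b where "b = 2 * pi * k / r"
  have b: "b \<noteq> 0" using False assms by (simp add: b_def)
  have "has_bochner_integral lborel (\<lambda>x. indicator {c..c + r} x *\<^sub>R cis (b * x))
    (cis (b * (c + r)) / (\<i> * of_real b) - cis (b * c) / (\<i> * of_real b))"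
  proof (rule has_bochner_integral_FTC_Icc)
    show "((\<lambda>x. cis (b * x) / (\<i> * complex_of_real b)) has_vector_derivative cis (b * x)) (at x within {c..c + r})" for x
      unfolding cis_conv_exp using b
      by (auto intro!: derivative_eq_intros has_vector_derivative_real_field simp: field_simps)
  qed (use assms in \<open>auto intro!: continuous_intros\<close>)
  moreover have "cis (b * (c + r)) = cis (b * c)"
  proof -
    have "b * (c + r) = b * c + 2 * pi * k"
      using assms by (simp add: b_def field_simps)
    then show ?thesis
      using cis_multiple_2pi[of "of_int k"] by (simp flip: cis_mult)
  qed
  ultimately show ?thesis using False by (simp add: b_def mult_ac)
qed

text \<open>The fundamental theorem of calculus is applied on a closed interval; the half-open one
  of \<open>strip\<close> differs from it by a null point.\<close>

lemma cis_int_period_integral: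
  fixes k :: int
  assumes "0 < r"
  shows "has_bochner_integral lborel (\<lambda>x. indicator {- r / 2<..r / 2} x *\<^sub>R cis (2 * pi * k * x / r)) (if k = 0 then of_real r else 0)"
proof -
  have Icc: "has_bochner_integral lborel (\<lambda>x. indicator {- r / 2..r / 2} x *\<^sub>R cis (2 * pi * k * x / r)) (if k = 0 then of_real r else 0)"
    using cis_int_period_integral_Icc[OF assms, of "- r / 2" k] by simp
  show ?thesis
  proof (rule has_bochner_integral_cong_AE[THEN iffD1, OF _ _ _ Icc])
    show "AE x in lborel. indicator {- r / 2..r / 2} x *\<^sub>R cis (2 * pi * k * x / r) = indicator {- r / 2<..r / 2} x *\<^sub>R cis (2 * pi * k * x / r)"
      using AE_lborel_singleton[of "- r / 2"] by eventually_elim (auto simp: indicator_def)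
  qed measurable
qed

text \<open>Products of the functions \<open>\<psi> k\<close> and their conjugates, in equal number,
  have this separated form. The vanishing of nonzero modes in x yields both orthogonality and the
  conservation law k1 + k2 = k3 + k4.\<close>

lemma strip_integral_mode:
  fixes k :: int and R :: "real \<Rightarrow> complex"
  assumes "0 < r" and R: "integrable lborel R" and F: "\<And>x y. F (Complex x y) = cis (2 * pi * k * x / r) * R y"
  shows "integrable (lebesgue_on (strip r)) F"
    and "integral\<^sup>L (lebesgue_on (strip r)) F = (if k = 0 then of_real r * integral\<^sup>L lborel R else 0)"
proof -
  have [measurable]: "R \<in> borel_measurable borel"
    using R by (auto dest: borel_measurable_integrable)
  have F': "F = (\<lambda>z. cis (2 * pi * k * Re z / r) * R (Im z))"
    using F by (metis complex.collapse)
  have [measurable]: "F \<in> borel_measurable borel"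
    unfolding F' by measurable
  note X = cis_int_period_integral[OF assms(1), of k, unfolded has_bochner_integral_iff]
  have eq: "indicator {- r / 2<..r / 2} (fst p) *\<^sub>R F (Complex (fst p) (snd p)) =
      (indicator {- r / 2<..r / 2} (fst p) *\<^sub>R cis (2 * pi * k * fst p / r)) * R (snd p)" for p
    by (simp add: F)
  note P = integrable_pair_mult[OF conjunct1[OF X] R]
  show "integrable (lebesgue_on (strip r)) F"
    by (subst integrable_strip) (simp_all only: eq P, simp)
  show "integral\<^sup>L (lebesgue_on (strip r)) F = (if k = 0 then of_real r * integral\<^sup>L lborel R else 0)"
    by (subst integral_strip) (simp_all only: eq P X, simp_all)
qed

section \<open>Gaussian integrals\<close>

lemma gaussian_integral:
  fixes c a :: real
  assumes "0 < c"
  shows "has_bochner_integral lborel (\<lambda>x. exp (- (c * (x + a)\<^sup>2))) (sqrt (pi / c))"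
proof -
  define \<sigma> where "\<sigma> = 1 / sqrt (2 * c)"
  have \<sigma>: "0 < \<sigma>" "2 * \<sigma>\<^sup>2 = 1 / c" "2 * pi * \<sigma>\<^sup>2 = pi / c"
    using assms by (auto simp: \<sigma>_def power_divide)
  have "has_bochner_integral lborel (\<lambda>x. sqrt (pi / c) * normal_density (-a) \<sigma> x) (sqrt (pi / c) * 1)"
    using \<sigma> by (intro has_bochner_integral_mult_right) (auto simp: has_bochner_integral_iff)
  then show ?thesis
    using assms unfolding normal_density_def \<sigma>(2,3) by (simp add: mult.commute)
qed

text \<open>The Fourier transform is read off from the characteristic function of the standard
  normal distribution, up to the normalising factor sqrt (2 pi).\<close>

lemma gaussian_fourier:
  fixes t :: real
  shows "has_bochner_integral lborel (\<lambda>x. of_real (exp (- (x\<^sup>2 / 2))) * cis (t * x)) (of_real (sqrt (2 * pi) * exp (- (t\<^sup>2 / 2))))"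
proof -
  have "char std_normal_distribution t = (\<integral>x. std_normal_density x *\<^sub>R iexp (t * x) \<partial>lborel)"
    unfolding char_def by (subst integral_density) auto
  then have "(\<integral>x. std_normal_density x *\<^sub>R iexp (t * x) \<partial>lborel) = of_real (exp (- (t\<^sup>2) / 2))"
    by (simp add: char_std_normal_distribution)
  moreover have "integrable lborel (\<lambda>x. std_normal_density x *\<^sub>R iexp (t * x))"
  proof (rule Bochner_Integration.integrable_bound)
    show "integrable lborel (normal_density 0 1)" by simp
  qed auto
  ultimately have "has_bochner_integral lborel (\<lambda>x. sqrt (2 * pi) *\<^sub>R (std_normal_density x *\<^sub>R iexp (t * x))) (sqrt (2 * pi) *\<^sub>R of_real (exp (- (t\<^sup>2) / 2)))"
    by (intro has_bochner_integral_scaleR_right) (simp add: has_bochner_integral_iff)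
  then show ?thesis
    by (simp add: std_normal_density_def scaleR_conv_of_real cis_conv_exp mult_ac)
qed

section \<open>Sums over the integers and termwise integration\<close>

lemma summable_on_int_power_abs:
  fixes \<rho> :: real
  assumes "0 \<le> \<rho>" "\<rho> < 1"
  shows "(\<lambda>k::int. \<rho> ^ nat \<bar>k\<bar>) summable_on UNIV"
proof -
  have g: "(\<lambda>n::nat. \<rho> ^ n) summable_on UNIV"
    using assms by (intro norm_summable_imp_summable_on) (simp add: summable_geometric)
  have 1: "(\<lambda>k::int. \<rho> ^ nat \<bar>k\<bar>) summable_on {0..}"
    using g by (subst summable_on_reindex_bij_witness[where i = int and j = nat and T = UNIV and h = "\<lambda>n. \<rho> ^ n"]) auto
  have 2: "(\<lambda>k::int. \<rho> ^ nat \<bar>k\<bar>) summable_on {..<0}"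
    using summable_on_subset_banach[OF g, of "{1..}"]
    by (subst summable_on_reindex_bij_witness[where i = "\<lambda>n. - int n" and j = "\<lambda>k. nat (- k)" and T = "{1..}" and h = "\<lambda>n. \<rho> ^ n"]) auto
  have "{0..} \<union> {..<0} = (UNIV :: int set)" by auto
  then show ?thesis using summable_on_Un_disjoint[OF 1 2] by fastforce
qed

text \<open>The bound B, uniform in x, makes B * |H| a common majorant of all partial sums of
  absolute values. Hence the integrals of the absolute values are summable and the resulting sum of
  integrals is absolute.\<close>

lemma has_sum_integral:
  fixes \<phi> :: "int \<Rightarrow> 'a \<Rightarrow> complex" and H :: "'a \<Rightarrow> complex"
  assumes meas: "\<And>k. \<phi> k \<in> borel_measurable M" and H: "integrable M H"
    and summ: "\<And>x. x \<in> space M \<Longrightarrow> (\<lambda>k. norm (\<phi> k x)) summable_on UNIV"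
    and bnd: "\<And>x. x \<in> space M \<Longrightarrow> (\<Sum>\<^sub>\<infinity>k. norm (\<phi> k x)) \<le> B"
  shows "((\<lambda>k. integral\<^sup>L M (\<lambda>x. \<phi> k x * H x)) has_sum integral\<^sup>L M (\<lambda>x. (\<Sum>\<^sub>\<infinity>k. \<phi> k x) * H x)) UNIV"
proof -
  \<comment> \<open>Enumerating the integers turns the unordered sum into a series, to which
    \<open>sums_integral\<close> applies; absolute convergence leads back to
    \<open>has_sum\<close>.\<close>
  define e where "e = int_decode"
  have e: "bij e" by (simp add: e_def bij_int_decode)
  define f where "f n x = \<phi> (e n) x * H x" for n x
  have term_le: "(\<Sum>k\<in>F. norm (\<phi> k x)) \<le> B" if "finite F" "x \<in> space M" for F x
    using finite_sum_le_infsum[OF summ[OF that(2)] that(1)] bnd[OF that(2)] by auto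
  have \<phi>_le: "norm (\<phi> k x) \<le> B" if "x \<in> space M" for k x
    using term_le[of "{k}" x] that by simp
  have [measurable]: "H \<in> borel_measurable M" "\<phi> k \<in> borel_measurable M" for k
    using H meas by auto
  have int: "integrable M (f n)" for n
    unfolding f_def
  proof (rule Bochner_Integration.integrable_bound)
    show "integrable M (\<lambda>x. of_real B * H x)" using H by simp
    show "AE x in M. norm (\<phi> (e n) x * H x) \<le> norm (of_real B * H x)"
      using \<phi>_le by (intro AE_I2) (auto simp: norm_mult intro!: mult_right_mono order_trans[OF _ abs_ge_self])
  qed simp
  have sumx: "summable (\<lambda>n. norm (f n x))" if "x \<in> space M" for x
  proof (rule summableI_nonneg_bounded)
    fix N
    have "(\<Sum>n<N. norm (f n x)) = (\<Sum>n<N. norm (\<phi> (e n) x)) * norm (H x)"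
      by (simp add: f_def norm_mult sum_distrib_right)
    also have "(\<Sum>n<N. norm (\<phi> (e n) x)) = (\<Sum>k\<in>e ` {..<N}. norm (\<phi> k x))"
      using e by (subst sum.reindex) (auto intro: inj_on_subset[OF bij_is_inj] simp: o_def)
    also have "\<dots> * norm (H x) \<le> B * norm (H x)"
      using that by (intro mult_right_mono term_le) auto
    finally show "(\<Sum>n<N. norm (f n x)) \<le> B * norm (H x)" .
  qed simp
  have sumI: "summable (\<lambda>n. \<integral>x. norm (f n x) \<partial>M)"
  proof (rule summableI_nonneg_bounded)
    fix N
    have "(\<Sum>n<N. \<integral>x. norm (f n x) \<partial>M) = (\<integral>x. (\<Sum>n<N. norm (f n x)) \<partial>M)"
      using int by (subst Bochner_Integration.integral_sum) auto
    also have "\<dots> \<le> (\<integral>x. B * norm (H x) \<partial>M)"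
    proof (rule integral_mono)
      fix x assume x: "x \<in> space M"
      have "(\<Sum>n<N. norm (f n x)) = (\<Sum>n<N. norm (\<phi> (e n) x)) * norm (H x)"
        by (simp add: f_def norm_mult sum_distrib_right)
      also have "(\<Sum>n<N. norm (\<phi> (e n) x)) = (\<Sum>k\<in>e ` {..<N}. norm (\<phi> k x))"
        using e by (subst sum.reindex) (auto intro: inj_on_subset[OF bij_is_inj] simp: o_def)
      also have "\<dots> * norm (H x) \<le> B * norm (H x)"
        using x by (intro mult_right_mono term_le) auto
      finally show "(\<Sum>n<N. norm (f n x)) \<le> B * norm (H x)" .
    qed (use int H in auto)
    finally show "(\<Sum>n<N. \<integral>x. norm (f n x) \<partial>M) \<le> (\<integral>x. B * norm (H x) \<partial>M)" .
  qed simp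
  have "(\<lambda>n. integral\<^sup>L M (f n)) sums (\<integral>x. (\<Sum>n. f n x) \<partial>M)"
    using int sumI by (intro sums_integral AE_I2 sumx) auto
  moreover have "summable (\<lambda>n. norm (integral\<^sup>L M (f n)))"
    by (rule summable_comparison_test'[OF sumI, of 0]) (auto intro!: integral_norm_bound)
  ultimately have "((\<lambda>n. integral\<^sup>L M (f n)) has_sum (\<integral>x. (\<Sum>n. f n x) \<partial>M)) UNIV"
    by (intro norm_summable_imp_has_sum)
  moreover have "(\<Sum>n. f n x) = (\<Sum>\<^sub>\<infinity>k. \<phi> k x) * H x" if "x \<in> space M" for x
  proof -
    have "((\<lambda>k. \<phi> k x) has_sum (\<Sum>\<^sub>\<infinity>k. \<phi> k x)) UNIV"
      using abs_summable_summable[OF summ[OF that]] by (rule has_sum_infsum)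
    then have "((\<lambda>n. \<phi> (e n) x) has_sum (\<Sum>\<^sub>\<infinity>k. \<phi> k x)) UNIV"
      unfolding has_sum_reindex_bij_betw[OF e, of "\<lambda>k. \<phi> k x"] .
    then have "(\<lambda>n. \<phi> (e n) x) sums (\<Sum>\<^sub>\<infinity>k. \<phi> k x)" by (rule has_sum_imp_sums)
    then have "(\<lambda>n. f n x) sums ((\<Sum>\<^sub>\<infinity>k. \<phi> k x) * H x)"
      unfolding f_def by (rule sums_mult2)
    then show ?thesis by (rule sums_unique[symmetric])
  qed
  ultimately have "((\<lambda>n. integral\<^sup>L M (\<lambda>x. \<phi> (e n) x * H x)) has_sum integral\<^sup>L M (\<lambda>x. (\<Sum>\<^sub>\<infinity>k. \<phi> k x) * H x)) UNIV"
    unfolding f_def by (metis (no_types, lifting) Bochner_Integration.integral_cong)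
  then show ?thesis
    using has_sum_reindex_bij_betw[OF e, of "\<lambda>k. integral\<^sup>L M (\<lambda>x. \<phi> k x * H x)"] by simp
qed

lemma borel_measurable_infsum_int:
  fixes \<phi> :: "int \<Rightarrow> 'a \<Rightarrow> complex"
  assumes [measurable]: "\<And>k. \<phi> k \<in> borel_measurable M"
    and summ: "\<And>x. x \<in> space M \<Longrightarrow> (\<lambda>k. norm (\<phi> k x)) summable_on UNIV"
  shows "(\<lambda>x. \<Sum>\<^sub>\<infinity>k. \<phi> k x) \<in> borel_measurable M"
proof -
  have "(\<Sum>\<^sub>\<infinity>k. \<phi> k x) = (\<Sum>n. \<phi> (int_decode n) x)" if "x \<in> space M" for x
  proof -
    have "((\<lambda>k. \<phi> k x) has_sum (\<Sum>\<^sub>\<infinity>k. \<phi> k x)) UNIV"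
      using abs_summable_summable[OF summ[OF that]] by (rule has_sum_infsum)
    then have "((\<lambda>n. \<phi> (int_decode n) x) has_sum (\<Sum>\<^sub>\<infinity>k. \<phi> k x)) UNIV"
      unfolding has_sum_reindex_bij_betw[OF bij_int_decode, of "\<lambda>k. \<phi> k x"] .
    then show ?thesis
      by (metis has_sum_imp_sums sums_unique)
  qed
  then show ?thesis
    by (subst measurable_cong[where g = "\<lambda>x. \<Sum>n. \<phi> (int_decode n) x"]) auto
qed

subsection \<open>The functions \<open>\<psi>\<^sub>k\<close>\<close>

lemma gamma_pos [simp]: "0 < \<gamma>" "\<gamma> \<noteq> 0"
  by (simp_all add: \<gamma>_def)

lemma gamma_power2: "\<gamma>\<^sup>2 = 2 * pi / sqrt 3"
  by (simp add: \<gamma>_def)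

lemma pi_over_gamma_power2: "(pi / \<gamma>)\<^sup>2 = pi * sqrt 3 / 2"
  unfolding power_divide gamma_power2 by (simp add: power2_eq_square)

lemma tau_eq: "\<tau> = Complex (- 1 / 2) (sqrt 3 / 2)"
proof -
  have "\<tau> = cis (2 * pi / 3)"
    by (simp add: \<tau>_def cis_conv_exp mult_ac)
  then show ?thesis
    by (simp add: cis.ctr cos_120 sin_120)
qed

definition amp :: real where
  "amp = (2 / (pi * \<gamma>\<^sup>2)) powr (1 / 4)"

lemma amp_pos [simp]: "0 < amp"
  by (simp add: amp_def)

lemma amp_power4: "amp ^ 4 = 2 / (pi * \<gamma>\<^sup>2)"
  by (simp add: amp_def powr_powr flip: powr_realpow)

lemma amp_power2: "amp\<^sup>2 = sqrt 2 / (sqrt pi * \<gamma>)"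
proof -
  have "amp\<^sup>2 = sqrt (amp ^ 4)"
    by (simp add: real_sqrt_unique[symmetric] real_sqrt_power[symmetric] flip: power_mult)
  then show ?thesis
    unfolding amp_power4 by (simp add: real_sqrt_divide real_sqrt_mult less_imp_le)
qed

text \<open>Here the value of \<gamma> enters: pi * Im \<tau> equals (pi / \<gamma>)^2, so the real
  part of the exponent is a complete square and |\<psi> k| is a Gaussian in y centred at - k pi /
  \<gamma>. The real part - 1/2 of \<tau> leaves the phase - pi k^2 / 2, the source of the signs
  below.\<close>

lemma psi_Complex:
  "\<psi> k (Complex x y) = of_real (amp * exp (- (y + k * pi / \<gamma>)\<^sup>2)) * cis (2 * pi * k * x / \<gamma> + x * y - pi * k\<^sup>2 / 2)"
proof -
  define z where "z = Complex x y"
  have n: "(norm z)\<^sup>2 = x\<^sup>2 + y\<^sup>2" by (simp add: z_def cmod_power2)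
  have pg: "pi * pi * (k * k) / (\<gamma> * \<gamma>) = pi * sqrt 3 / 2 * (k * k)"
    using pi_over_gamma_power2 by (simp add: power2_eq_square field_simps)
  have "2 * \<i> * of_int k * of_real pi * z / of_real \<gamma> + \<i> * of_real pi * \<tau> * (of_int k)\<^sup>2 + z\<^sup>2 / 2 - of_real ((norm z)\<^sup>2 / 2)
     = of_real (- (y + k * pi / \<gamma>)\<^sup>2) + \<i> * of_real (2 * pi * k * x / \<gamma> + x * y - pi * k\<^sup>2 / 2)" (is "?L = ?R")
  proof (rule complex_eqI)
    show "Re ?L = Re ?R"
      unfolding n by (simp add: z_def tau_eq power2_eq_square Re_divide_of_real) (use pg in \<open>simp add: algebra_simps add_divide_distrib diff_divide_distrib\<close>)
    show "Im ?L = Im ?R"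
      unfolding n by (simp add: z_def tau_eq power2_eq_square Im_divide_of_real)
  qed
  then have "\<psi> k z = of_real amp * exp (of_real (- (y + k * pi / \<gamma>)\<^sup>2) + \<i> * of_real (2 * pi * k * x / \<gamma> + x * y - pi * k\<^sup>2 / 2))"
    unfolding \<psi>_def amp_def by simp
  moreover have "exp (of_real X + \<i> * of_real Y) = of_real (exp X) * cis Y" for X Y
    by (simp add: exp_add cis_conv_exp exp_of_real)
  ultimately show ?thesis
    unfolding z_def of_real_mult by (simp only: mult.assoc of_int_power)
qed

lemma norm_psi: "norm (\<psi> k (Complex x y)) = amp * exp (- (y + k * pi / \<gamma>)\<^sup>2)"
  unfolding psi_Complex norm_mult norm_of_real norm_cis by (simp add: less_imp_le)

lemma psi_measurable [measurable]: "\<psi> k \<in> borel_measurable borel"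
  unfolding \<psi>_def[abs_def] by (intro borel_measurable_continuous_onI continuous_intros) auto

definition theta_coeff :: "int \<Rightarrow> real" where
  "theta_coeff k = exp (- (pi\<^sup>2 * k\<^sup>2 / \<gamma>\<^sup>2))"

lemma theta_coeff_pos [simp]: "0 < theta_coeff k" "0 \<le> theta_coeff k" "\<bar>theta_coeff k\<bar> = theta_coeff k"
  by (simp_all add: theta_coeff_def)

lemma theta_coeff_minus [simp]: "theta_coeff (- k) = theta_coeff k"
  by (simp add: theta_coeff_def)

text \<open>The sign (-1)^(p q), written by cases because p q may be negative.\<close>

definition parity_sign :: "int \<Rightarrow> int \<Rightarrow> real" where
  "parity_sign p q = (if odd p \<and> odd q then -1 else 1)"

lemma parity_sign_commute: "parity_sign p q = parity_sign q p"
  by (auto simp: parity_sign_def)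

lemma parity_sign_minus [simp]: "parity_sign (- p) q = parity_sign p q" "parity_sign p (- q) = parity_sign p q"
  by (auto simp: parity_sign_def)

lemma cis_pi_mult_int: "cis (pi * of_int (p * q)) = of_real (parity_sign p q)"
  by (simp add: complex_eq_iff parity_sign_def del: of_int_mult)

definition \<kappa> :: real where
  "\<kappa> = 1 / (\<gamma> * sqrt pi)"

lemma kappa_pos [simp]: "0 < \<kappa>" "\<kappa> \<noteq> 0"
  by (simp_all add: \<kappa>_def)

lemma gaussian_product_integral:
  fixes d e :: real
  assumes "0 < c" "\<And>y. Q y = c * (y + d)\<^sup>2 + e"
  shows "has_bochner_integral lborel (\<lambda>y. of_real (exp (- Q y)) :: complex) (of_real (exp (- e) * sqrt (pi / c)))"
proof -
  have "has_bochner_integral lborel (\<lambda>y. exp (- e) * exp (- (c * (y + d)\<^sup>2))) (exp (- e) * sqrt (pi / c))"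
    by (intro has_bochner_integral_mult_right gaussian_integral assms)
  moreover have "exp (- e) * exp (- (c * (y + d)\<^sup>2)) = exp (- Q y)" for y
    unfolding assms(2) exp_add[symmetric] by (rule arg_cong[where f = exp]) simp
  ultimately have "has_bochner_integral lborel (\<lambda>y. exp (- Q y)) (exp (- e) * sqrt (pi / c))"
    by (simp only:)
  then show ?thesis by (rule has_bochner_integral_of_real)
qed

lemma cis_diff: "cis (s - t) = cis s * cnj (cis t)"
  by (simp add: cis_cnj cis_mult)

text \<open>The common phase cis (x y) cancels against its conjugate, leaving the mode m - n in x
  times a Gaussian in y. The constant \<open>amp\<close> is the one for which \<gamma> * amp^2 *
  sqrt (pi / 2) = 1.\<close>

lemma psi_orthonormal: "L2_orthonormal (strip \<gamma>) \<psi>"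
proof -
  have key: "integrable (lebesgue_on (strip \<gamma>)) (\<lambda>z. \<psi> m z * cnj (\<psi> n z)) \<and>
    integral\<^sup>L (lebesgue_on (strip \<gamma>)) (\<lambda>z. \<psi> m z * cnj (\<psi> n z)) = (if m = n then 1 else 0)" for m n
  proof -
    define Q where "Q y = (y + m * pi / \<gamma>)\<^sup>2 + (y + n * pi / \<gamma>)\<^sup>2" for y :: real
    define R where "R y = of_real (amp\<^sup>2) * cis (- (pi * m\<^sup>2 / 2) + pi * n\<^sup>2 / 2) * of_real (exp (- Q y))" for y :: real
    have Q: "Q y = 2 * (y + (m + n) / 2 * pi / \<gamma>)\<^sup>2 + ((m - n) * pi / \<gamma>)\<^sup>2 / 2" for y
      by (simp add: Q_def power2_eq_square field_simps)
    have R: "has_bochner_integral lborel R (of_real (amp\<^sup>2) * cis (- (pi * m\<^sup>2 / 2) + pi * n\<^sup>2 / 2)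
        * of_real (exp (- (((m - n) * pi / \<gamma>)\<^sup>2 / 2)) * sqrt (pi / 2)))"
      unfolding R_def by (intro has_bochner_integral_mult_right gaussian_product_integral[OF _ Q]) simp
    have F: "\<psi> m (Complex x y) * cnj (\<psi> n (Complex x y)) = cis (2 * pi * (m - n) * x / \<gamma>) * R y" for x y
    proof -
      have "cis (2 * pi * m * x / \<gamma> + x * y - pi * m\<^sup>2 / 2) * cnj (cis (2 * pi * n * x / \<gamma> + x * y - pi * n\<^sup>2 / 2))
         = cis (2 * pi * (m - n) * x / \<gamma>) * cis (- (pi * m\<^sup>2 / 2) + pi * n\<^sup>2 / 2)"
        unfolding cis_diff[symmetric] cis_mult by (rule arg_cong[where f = cis]) (simp add: field_simps)
      moreover have "exp (- (y + m * pi / \<gamma>)\<^sup>2) * exp (- (y + n * pi / \<gamma>)\<^sup>2) = exp (- Q y)"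
        by (simp add: Q_def flip: exp_add)
      ultimately show ?thesis
        unfolding psi_Complex R_def complex_cnj_mult complex_cnj_complex_of_real
        by (simp add: power2_eq_square mult_ac flip: of_real_mult)
    qed
    note S = strip_integral_mode[where k = "m - n", OF gamma_pos(1) _ F[unfolded of_int_diff[symmetric]]]
    have "amp\<^sup>2 * (\<gamma> * sqrt (pi / 2)) = 1"
      by (simp add: amp_power2 real_sqrt_divide)
    then have "complex_of_real \<gamma> * (of_real (amp\<^sup>2) * of_real (sqrt (pi / 2))) = 1"
      by (simp only: of_real_mult[symmetric] mult_ac of_real_1)
    then show ?thesis
      using S R unfolding has_bochner_integral_iff by auto
  qed
  show ?thesis
  proof
    show "L2 (strip \<gamma>) (\<psi> n)" for n
    proof -
      have "integrable (lebesgue_on (strip \<gamma>)) (\<lambda>z. Re (\<psi> n z * cnj (\<psi> n z)))"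
        using key[of n n] by (intro integrable_Re) blast
      then show ?thesis
        unfolding L2_def by (auto simp: borel_measurable_lebesgue_on_borel complex_norm_square[symmetric] simp del: of_real_power times_complex.sel)
    qed
    show "L2ip (strip \<gamma>) (\<psi> m) (\<psi> n) = (if m = n then 1 else 0)" for m n
      using key unfolding L2ip_def by blast
  qed
qed

text \<open>On the surviving indices put p = k1 - k4 and q = k2 - k4, so that k3 = k4 + p + q. The
  squared deviations of the four indices from their mean then add up to p^2 + q^2, and k1^2 + k2^2 -
  k3^2 - k4^2 = - 2 p q; the first gives the two theta factors, the second the sign.\<close>

lemma psi_quartic:
  "integral\<^sup>L (lebesgue_on (strip \<gamma>)) (\<lambda>z. \<psi> k1 z * \<psi> k2 z * cnj (\<psi> k3 z) * cnj (\<psi> k4 z)) =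
     (if k1 + k2 = k3 + k4 then of_real (\<kappa> * parity_sign (k1 - k4) (k2 - k4) * theta_coeff (k1 - k4) * theta_coeff (k2 - k4)) else 0)"
proof -
  define Q where "Q y = (y + k1 * pi / \<gamma>)\<^sup>2 + (y + k2 * pi / \<gamma>)\<^sup>2 + (y + k3 * pi / \<gamma>)\<^sup>2 + (y + k4 * pi / \<gamma>)\<^sup>2" for y :: real
  define d where "d = (k1 + k2 + k3 + k4) / 4 * (pi / \<gamma>)"
  define e where "e = (real_of_int k1 ^ 2 + real_of_int k2 ^ 2 + real_of_int k3 ^ 2 + real_of_int k4 ^ 2) * (pi / \<gamma>)\<^sup>2 - 4 * d\<^sup>2"
  define ph where "ph = - (pi * k1\<^sup>2 / 2) - pi * k2\<^sup>2 / 2 + pi * k3\<^sup>2 / 2 + pi * k4\<^sup>2 / 2"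
  define R where "R y = of_real (amp ^ 4) * cis ph * of_real (exp (- Q y))" for y :: real
  have Q: "Q y = 4 * (y + d)\<^sup>2 + e" for y
    by (simp add: Q_def e_def d_def power2_eq_square field_simps)
  have R: "has_bochner_integral lborel R (of_real (amp ^ 4) * cis ph * of_real (exp (- e) * sqrt (pi / 4)))"
    unfolding R_def by (intro has_bochner_integral_mult_right gaussian_product_integral[OF _ Q]) simp
  have F: "\<psi> k1 (Complex x y) * \<psi> k2 (Complex x y) * cnj (\<psi> k3 (Complex x y)) * cnj (\<psi> k4 (Complex x y))
     = cis (2 * pi * of_int (k1 + k2 - k3 - k4) * x / \<gamma>) * R y" for x y
  proof -
    let ?t = "\<lambda>k::int. 2 * pi * k * x / \<gamma> + x * y - pi * k\<^sup>2 / 2"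
    let ?g = "\<lambda>k::int. exp (- (y + k * pi / \<gamma>)\<^sup>2)"
    have "cis (?t k1) * cis (?t k2) * cnj (cis (?t k3)) * cnj (cis (?t k4)) = cis (2 * pi * of_int (k1 + k2 - k3 - k4) * x / \<gamma>) * cis ph"
      unfolding cis_diff[symmetric] cis_mult by (rule arg_cong[where f = cis]) (simp add: ph_def field_simps)
    moreover have "?g k1 * ?g k2 * ?g k3 * ?g k4 = exp (- Q y)"
      by (simp add: Q_def flip: exp_add)
    moreover have "\<psi> k1 (Complex x y) * \<psi> k2 (Complex x y) * cnj (\<psi> k3 (Complex x y)) * cnj (\<psi> k4 (Complex x y))
      = of_real (amp ^ 4) * (cis (?t k1) * cis (?t k2) * cnj (cis (?t k3)) * cnj (cis (?t k4))) * of_real (?g k1 * ?g k2 * ?g k3 * ?g k4)"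
      unfolding psi_Complex complex_cnj_mult complex_cnj_complex_of_real of_real_mult of_real_power
      by (simp only: power4_eq_xxxx mult_ac)
    ultimately show ?thesis
      unfolding R_def by (simp only: mult_ac)
  qed
  have I: "integral\<^sup>L (lebesgue_on (strip \<gamma>)) (\<lambda>z. \<psi> k1 z * \<psi> k2 z * cnj (\<psi> k3 z) * cnj (\<psi> k4 z)) =
     (if k1 + k2 - k3 - k4 = 0 then of_real \<gamma> * (of_real (amp ^ 4) * cis ph * of_real (exp (- e) * sqrt (pi / 4))) else 0)"
    using strip_integral_mode(2)[OF gamma_pos(1) _ F] R unfolding has_bochner_integral_iff by auto
  show ?thesis
  proof (cases "k1 + k2 = k3 + k4")
    case True
    define p q where "p = k1 - k4" and "q = k2 - k4"
    have k: "k1 = k4 + p" "k2 = k4 + q" "k3 = k4 + p + q"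
      using True by (auto simp: p_def q_def)
    have ph: "ph = pi * of_int (p * q)"
      unfolding ph_def k by (simp add: power2_eq_square field_simps)
    have e: "- e = - (pi\<^sup>2 * p\<^sup>2 / \<gamma>\<^sup>2) + - (pi\<^sup>2 * q\<^sup>2 / \<gamma>\<^sup>2)"
      unfolding e_def d_def k by (simp add: power2_eq_square field_simps)
    have kap: "\<gamma> * (amp ^ 4 * sqrt (pi / 4)) = \<kappa>"
      unfolding amp_power4 \<kappa>_def by (simp add: real_sqrt_divide power2_eq_square field_simps)
    have "of_real \<gamma> * (of_real (amp ^ 4) * cis ph * of_real (exp (- e) * sqrt (pi / 4))) =
      of_real (\<gamma> * (amp ^ 4 * sqrt (pi / 4)) * parity_sign p q * theta_coeff p * theta_coeff q)"
      unfolding ph cis_pi_mult_int e exp_add theta_coeff_def by simp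
    then show ?thesis
      using True I unfolding kap by (simp add: p_def q_def)
  qed (use I in auto)
qed

text \<open>The bound is uniform in z: at a given height one index j has the nearest centre, the
  other terms decay at least geometrically in the distance from j, and the sum of that geometric
  majorant does not depend on j.\<close>

lemma psi_norm_summable:
  obtains B where "\<And>z. (\<lambda>k. norm (\<psi> k z)) summable_on UNIV" "\<And>z. (\<Sum>\<^sub>\<infinity>k. norm (\<psi> k z)) \<le> B" "0 \<le> B"
proof -
  define a where "a = (pi / \<gamma>)\<^sup>2"
  define \<rho> where "\<rho> = exp (- a / 4)"
  have \<rho>: "0 < \<rho>" "\<rho> < 1" by (auto simp: \<rho>_def a_def)
  have s: "(\<lambda>k::int. amp * \<rho> ^ nat \<bar>k\<bar>) summable_on UNIV"
    using summable_on_int_power_abs[of \<rho>] \<rho> by (intro summable_on_cmult_right) auto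
  have "\<exists>j::int. \<forall>k. norm (\<psi> k z) \<le> amp * \<rho> ^ nat \<bar>k - j\<bar>" for z
  proof -
    \<comment> \<open>The real index whose Gaussian would be centred exactly at height Im z.\<close>
    define t where "t = - Im z * \<gamma> / pi"
    define j where "j = round t"
    have j: "\<bar>real_of_int j - t\<bar> \<le> 1 / 2" unfolding j_def by (rule of_int_round_abs_le)
    have "norm (\<psi> k z) \<le> amp * \<rho> ^ nat \<bar>k - j\<bar>" for k
    proof -
      \<comment> \<open>Rounding costs at most 1/2, so |k - t| \<ge> |k - j| / 2 when k differs from
        j; squaring gives the 1/4, and |k - j|^2 \<ge> |k - j| makes the exponent linear.\<close>
      have sq: "of_int \<bar>k - j\<bar> / 4 \<le> (of_int k - t)\<^sup>2"
      proof (cases "k = j")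
        case False
        then have d: "1 \<le> \<bar>real_of_int k - of_int j\<bar>" by linarith
        then have "\<bar>real_of_int k - of_int j\<bar> / 2 \<le> \<bar>of_int k - t\<bar>"
            using j abs_triangle_ineq4[of "of_int k - t" "of_int j - t"] by simp
        then have "(\<bar>real_of_int k - of_int j\<bar> / 2)\<^sup>2 \<le> \<bar>of_int k - t\<bar>\<^sup>2" by (intro power_mono) auto
        moreover have "\<bar>real_of_int k - of_int j\<bar> * 1 \<le> \<bar>real_of_int k - of_int j\<bar> * \<bar>real_of_int k - of_int j\<bar>"
          using d by (intro mult_left_mono) auto
        ultimately show ?thesis by (simp add: power2_eq_square)
      qed auto
      have "(Im z + k * pi / \<gamma>) = (of_int k - t) * (pi / \<gamma>)"
        by (simp add: t_def field_simps)
      then have "(Im z + k * pi / \<gamma>)\<^sup>2 = (of_int k - t)\<^sup>2 * a"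
        by (simp only: power_mult_distrib a_def)
      moreover have "of_int \<bar>k - j\<bar> / 4 * a \<le> (of_int k - t)\<^sup>2 * a"
        using sq by (intro mult_right_mono) (auto simp: a_def)
      moreover have "\<rho> ^ nat \<bar>k - j\<bar> = exp (- (of_int \<bar>k - j\<bar> / 4 * a))"
        unfolding \<rho>_def exp_of_nat_mult[symmetric] by simp
      ultimately show ?thesis
        using norm_psi[of k "Re z" "Im z"] by (simp add: less_imp_le mult_left_mono)
    qed
    then show ?thesis by blast
  qed
  then obtain j :: "complex \<Rightarrow> int" where j: "\<And>z k. norm (\<psi> k z) \<le> amp * \<rho> ^ nat \<bar>k - j z\<bar>" by metis
  have shift: "((\<lambda>k. amp * \<rho> ^ nat \<bar>k - m\<bar>) has_sum (\<Sum>\<^sub>\<infinity>k::int. amp * \<rho> ^ nat \<bar>k\<bar>)) UNIV" for m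
    using has_sum_infsum[OF s]
    by (subst has_sum_reindex_bij_witness[where i = "\<lambda>k. k + m" and j = "\<lambda>k. k - m" and T = UNIV and h = "\<lambda>k::int. amp * \<rho> ^ nat \<bar>k\<bar>"]) auto
  have S: "(\<lambda>k. norm (\<psi> k z)) summable_on UNIV" for z
    by (rule summable_on_comparison_test[OF has_sum_imp_summable[OF shift[of "j z"]]]) (use j in auto)
  have "(\<Sum>\<^sub>\<infinity>k. norm (\<psi> k z)) \<le> (\<Sum>\<^sub>\<infinity>k::int. amp * \<rho> ^ nat \<bar>k\<bar>)" for z
    by (rule has_sum_mono[OF has_sum_infsum[OF S] shift[of "j z"]]) (use j in auto)
  moreover have "0 \<le> (\<Sum>\<^sub>\<infinity>k::int. amp * \<rho> ^ nat \<bar>k\<bar>)"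
    using \<rho> by (intro infsum_nonneg) (simp add: less_imp_le)
  ultimately show ?thesis using S that by blast
qed

lemma Psi0_measurable [measurable]: "\<Psi>\<^sub>0 \<in> borel_measurable borel"
  unfolding \<Psi>\<^sub>0_def[abs_def]
  by (rule borel_measurable_infsum_int) (auto intro: psi_norm_summable)

lemma Psi0_bounded: obtains B where "\<And>z. norm (\<Psi>\<^sub>0 z) \<le> B" "0 \<le> B"
proof -
  obtain B where B: "\<And>z. (\<lambda>k. norm (\<psi> k z)) summable_on UNIV" "\<And>z. (\<Sum>\<^sub>\<infinity>k. norm (\<psi> k z)) \<le> B" "0 \<le> B"
    using psi_norm_summable by metis
  have "norm (\<Psi>\<^sub>0 z) \<le> B" for z
    unfolding \<Psi>\<^sub>0_def using norm_infsum_bound[OF B(1)[of z]] B(2)[of z] by linarith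
  then show ?thesis using B(3) that by blast
qed

lemma Psi0_integral_expand:
  assumes "integrable (lebesgue_on (strip \<gamma>)) H"
  shows "((\<lambda>k. integral\<^sup>L (lebesgue_on (strip \<gamma>)) (\<lambda>z. \<psi> k z * H z)) has_sum integral\<^sup>L (lebesgue_on (strip \<gamma>)) (\<lambda>z. \<Psi>\<^sub>0 z * H z)) UNIV"
proof -
  obtain B where B: "\<And>z. (\<lambda>k. norm (\<psi> k z)) summable_on UNIV" "\<And>z. (\<Sum>\<^sub>\<infinity>k. norm (\<psi> k z)) \<le> B"
    using psi_norm_summable by metis
  show ?thesis
    unfolding \<Psi>\<^sub>0_def
    by (rule has_sum_integral[OF borel_measurable_lebesgue_on_borel[OF psi_measurable] assms B(1,2)])
qed

subsection \<open>The projection onto the lowest Landau level\<close>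

lemma integral_lborel_shift:
  fixes f :: "'a::euclidean_space \<Rightarrow> 'b::{banach, second_countable_topology}"
  assumes "f \<in> borel_measurable borel"
  shows "integral\<^sup>L lborel (\<lambda>x. f (c + x)) = integral\<^sup>L lborel f"
proof -
  have "integral\<^sup>L (distr lborel borel ((+) c)) f = integral\<^sup>L lborel (\<lambda>x. f (c + x))"
    using assms by (subst integral_distr) auto
  then show ?thesis by (simp add: lborel_distr_plus)
qed

lemma integrable_indicator_Ioc:
  fixes l u :: real and K :: "'b::{banach, second_countable_topology}"
  shows "integrable lborel (\<lambda>x. indicator {l<..u} x *\<^sub>R K)"
proof -
  have "emeasure lborel {l<..u} < \<infinity>"
    by (rule emeasure_bounded_finite) simp
  then show ?thesis
    by (intro integrable_scaleR_left integrable_real_indicator) auto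
qed

text \<open>A shift by whole periods changes nothing, and for a shift of at most one period the
  piece lost at one end of the window is a translate of the piece gained at the other.\<close>

lemma integral_periodic_shift:
  fixes G :: "real \<Rightarrow> complex"
  assumes G [measurable]: "G \<in> borel_measurable borel" and T: "0 < T"
    and per: "\<And>x. G (x + T) = G x" and bnd: "\<And>x. norm (G x) \<le> K"
  shows "integral\<^sup>L lborel (\<lambda>x. indicator {- T / 2<..T / 2} x *\<^sub>R G (x + r)) =
         integral\<^sup>L lborel (\<lambda>x. indicator {- T / 2<..T / 2} x *\<^sub>R G x)"
proof -
  interpret G: periodic_fun_simple G T by standard (rule per)
  define \<Phi> where "\<Phi> c d = integral\<^sup>L lborel (\<lambda>x. indicator {c<..d} x *\<^sub>R G x)" for c d
  have int: "integrable lborel (\<lambda>x. indicator {c<..d} x *\<^sub>R G x)" for c d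
  proof (rule Bochner_Integration.integrable_bound)
    show "integrable lborel (\<lambda>x. indicator {c<..d} x *\<^sub>R K)"
      by (rule integrable_indicator_Ioc)
    show "AE x in lborel. norm (indicator {c<..d} x *\<^sub>R G x) \<le> norm (indicator {c<..d} x *\<^sub>R K)"
      using bnd by (intro AE_I2) (auto simp: indicator_def intro: order_trans[OF _ abs_ge_self])
  qed simp
  have split: "\<Phi> c e = \<Phi> c d + \<Phi> d e" if "c \<le> d" "d \<le> e" for c d e
    unfolding \<Phi>_def using that
    by (subst Bochner_Integration.integral_add[symmetric, OF int int]) (auto intro!: Bochner_Integration.integral_cong simp: indicator_def)
  have shift: "integral\<^sup>L lborel (\<lambda>x. indicator {c<..d} x *\<^sub>R G (x + r)) = \<Phi> (c + r) (d + r)" for c d r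
    unfolding \<Phi>_def
    by (subst integral_lborel_shift[of _ r, symmetric]) (auto intro!: Bochner_Integration.integral_cong simp: indicator_def add.commute)
  have per\<Phi>: "\<Phi> (c + of_int k * T) (d + of_int k * T) = \<Phi> c d" for c d and k :: int
    using shift[of c d "of_int k * T"] by (simp add: G.plus_of_int \<Phi>_def)
  have local: "\<Phi> d (d + T) = \<Phi> c (c + T)" if "c \<le> d" "d \<le> c + T" for c d
    using split[of c d "c + T"] split[of d "c + T" "d + T"] that per\<Phi>[of c 1 d] by simp
  \<comment> \<open>Chosen so that r + k T lies between 0 and T, the range that \<open>local\<close>
    covers.\<close>
  define k where "k = \<lfloor>- r / T\<rfloor> + 1"
  have "\<Phi> (- T / 2 + r) (T / 2 + r) = \<Phi> (- T / 2 + r + of_int k * T) (T / 2 + r + of_int k * T)"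
    by (rule per\<Phi>[symmetric])
  also have "\<dots> = \<Phi> (- T / 2) (- T / 2 + T)"
  proof -
    have "of_int k - 1 \<le> - r / T" "- r / T < of_int k"
      unfolding k_def by linarith+
    then have "0 \<le> r + of_int k * T" "r + of_int k * T \<le> T"
      using T by (auto simp: field_simps)
    then show ?thesis
      using local[of "- T / 2" "- T / 2 + r + of_int k * T"] by (simp add: algebra_simps)
  qed
  finally show ?thesis
    unfolding shift by (simp add: \<Phi>_def)
qed

text \<open>The factor exp |x| is at most exp x + exp (- x), and each of these merges with the
  Gaussian by completing the square. Functions in the spaces considered grow at most like exp |Im
  z|, so this is the majorant behind every application of Fubini to the projection.\<close>

lemma integrable_exp_abs_gaussian:
  fixes c d :: real
  assumes "0 < c"
  shows "integrable lborel (\<lambda>x. exp (\<bar>x\<bar> - c * (x + d)\<^sup>2))"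
proof -
  have *: "integrable lborel (\<lambda>x. exp (s * x - c * (x + d)\<^sup>2))" for s :: real
  proof -
    have eq: "exp (s * x - c * (x + d)\<^sup>2) = exp (s\<^sup>2 / (4 * c) - s * d) * exp (- (c * (x + (d - s / (2 * c)))\<^sup>2))" for x
      unfolding exp_add[symmetric] using assms by (intro arg_cong[where f = exp]) (simp add: power2_eq_square field_simps)
    show ?thesis
      unfolding eq using gaussian_integral[OF assms] by (auto simp: has_bochner_integral_iff)
  qed
  show ?thesis
  proof (rule Bochner_Integration.integrable_bound[OF Bochner_Integration.integrable_add[OF *[of 1] *[of "-1"]]])
    show "AE x in lborel. norm (exp (\<bar>x\<bar> - c * (x + d)\<^sup>2)) \<le> norm (exp (1 * x - c * (x + d)\<^sup>2) + exp (- 1 * x - c * (x + d)\<^sup>2))"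
    proof (rule AE_I2)
      fix x
      have "exp (\<bar>x\<bar> - c * (x + d)\<^sup>2) \<le> exp (1 * x - c * (x + d)\<^sup>2) + exp (- 1 * x - c * (x + d)\<^sup>2)"
        by (cases "0 \<le> x") (auto simp: add_increasing add_increasing2)
      then show "norm (exp (\<bar>x\<bar> - c * (x + d)\<^sup>2)) \<le> norm (exp (1 * x - c * (x + d)\<^sup>2) + exp (- 1 * x - c * (x + d)\<^sup>2))"
        unfolding real_norm_def abs_exp_cancel by linarith
    qed
  qed simp
qed

text \<open>Invariance under the magnetic translation by \<gamma>, solved for the translated value.
  Unlike membership in \<open>LLL_periodic\<close> it asks for no holomorphy, so it also applies to
  \<open>linearised_potential u\<close>.\<close>

definition quasi_periodic :: "(complex \<Rightarrow> complex) \<Rightarrow> bool" where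
  "quasi_periodic U \<longleftrightarrow> (\<forall>z. U (z + of_real \<gamma>) = cis (\<gamma> * Im z) * U z)"

text \<open>Once the gauge phases cis (- x y) and cis (- s t) are split off, the kernel depends on
  the real parts only through s - x. Translating the integration variable makes this difference the
  new variable \<open>fst p\<close>.\<close>

lemma LLL_proj_convolution:
  assumes [measurable]: "U \<in> borel_measurable borel"
  shows "cis (- (x * y)) * LLL_proj U (Complex x y) = of_real (1 / pi) *
    (\<integral>p. of_real (exp (- ((fst p)\<^sup>2 / 2)) * exp (- ((y - snd p)\<^sup>2 / 2))) * cis (fst p * (y + snd p)) *
       (cis (- ((x + fst p) * snd p)) * U (Complex (x + fst p) (snd p))) \<partial>(lborel \<Otimes>\<^sub>M lborel))"
proof -
  define H where "H p = of_real (exp (- ((fst p - x)\<^sup>2 / 2)) * exp (- ((y - snd p)\<^sup>2 / 2))) * cis ((fst p - x) * (y + snd p)) *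
       (cis (- (fst p * snd p)) * U (Complex (fst p) (snd p)))" for p
  have [measurable]: "H \<in> borel_measurable borel"
    unfolding H_def[abs_def] borel_prod[symmetric] by measurable
  have eq: "cis (- (x * y)) * (exp (- of_real ((norm (Complex x y))\<^sup>2 / 2)) *
      (exp (cnj (Complex s t) * Complex x y - of_real ((norm (Complex s t))\<^sup>2 / 2)) * U (Complex s t))) = H (s, t)" for s t
  proof -
    have "cis (- (x * y)) * (exp (- of_real ((norm (Complex x y))\<^sup>2 / 2)) * exp (cnj (Complex s t) * Complex x y - of_real ((norm (Complex s t))\<^sup>2 / 2)))
      = of_real (exp (- ((s - x)\<^sup>2 / 2)) * exp (- ((y - t)\<^sup>2 / 2))) * (cis ((s - x) * (y + t)) * cis (- (s * t)))"
      unfolding cis_mult unfolding cis_conv_exp exp_of_real[symmetric] of_real_mult exp_add[symmetric]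
      by (rule arg_cong[where f = exp], simp add: complex_eq_iff cmod_power2, simp add: power2_eq_square field_simps)
    then show ?thesis by (simp add: H_def mult.assoc)
  qed
  have "cis (- (x * y)) * LLL_proj U (Complex x y) = of_real (1 / pi) *
     (cis (- (x * y)) * (exp (- of_real ((norm (Complex x y))\<^sup>2 / 2)) *
       (\<integral>w. exp (cnj w * Complex x y - of_real ((norm w)\<^sup>2 / 2)) * U w \<partial>lebesgue)))"
    by (simp add: LLL_proj_def)
  also have "(\<integral>w. exp (cnj w * Complex x y - of_real ((norm w)\<^sup>2 / 2)) * U w \<partial>lebesgue)
      = (\<integral>p. exp (cnj (Complex (fst p) (snd p)) * Complex x y - of_real ((norm (Complex (fst p) (snd p)))\<^sup>2 / 2)) * U (Complex (fst p) (snd p)) \<partial>(lborel \<Otimes>\<^sub>M lborel))"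
    by (rule integral_lebesgue_complex) measurable
  also have "cis (- (x * y)) * (exp (- of_real ((norm (Complex x y))\<^sup>2 / 2)) * \<dots>) = (\<integral>p. H p \<partial>(lborel \<Otimes>\<^sub>M lborel))"
    unfolding integral_mult_right_zero[symmetric] eq prod.collapse ..
  also have "\<dots> = (\<integral>p. H ((x, 0) + p) \<partial>lborel)"
    unfolding lborel_prod by (rule integral_lborel_shift[symmetric]) measurable
  finally show ?thesis
    by (simp add: H_def lborel_prod add.commute)
qed

text \<open>With \<open>a = \<pi>n/\<gamma>\<close> and \<open>P\<close> the periodic factor of \<open>U\<close>, the \<open>n\<close>-th Fourier coefficient in \<open>x\<close> of the projection at
  height \<open>y\<close> is \<open>exp(-(y + a)\<^sup>2)\<close> times a number independent of \<open>y\<close>, and that number is a multiple of the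
  inner product of \<open>U\<close> with \<open>\<psi>\<^sub>n\<close>.\<close>

lemma LLL_proj_ip_psi:
  assumes U [measurable]: "U \<in> borel_measurable borel" and qp: "quasi_periodic U"
    and bnd: "\<And>z. norm (U z) \<le> C * exp \<bar>Im z\<bar>"
    and PiU [measurable]: "LLL_proj U \<in> borel_measurable borel" and L2: "L2 (strip \<gamma>) (LLL_proj U)"
  shows "L2ip (strip \<gamma>) (LLL_proj U) (\<psi> n) = L2ip (strip \<gamma>) U (\<psi> n)"
proof -
  let ?E = "\<lambda>y t. complex_of_real (exp (\<bar>t\<bar> - 1 / 2 * (t + - y)\<^sup>2))"
  let ?G = "\<lambda>r. complex_of_real (exp (- (r\<^sup>2 / 2)))"
  let ?I = "{- \<gamma> / 2<..\<gamma> / 2}"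
  let ?L2 = "lborel \<Otimes>\<^sub>M lborel :: (real \<times> real) measure"
  define a where "a = n * pi / \<gamma>"
  define P where "P s t = cis (- (s * t)) * U (Complex s t)" for s t
  define Q where "Q t = (\<integral>x. indicator ?I x *\<^sub>R (cis (- (2 * a * x)) * P x t) \<partial>lborel)" for t
  define K where "K = (\<integral>t. of_real (exp (- (t + a)\<^sup>2)) * Q t \<partial>lborel)"
  define ph where "ph = cis (pi * n\<^sup>2 / 2)"
  have Pm [measurable]: "(\<lambda>p. P (fst p) (snd p)) \<in> borel_measurable borel"
    unfolding P_def borel_prod[symmetric] by measurable
  have Pm' [measurable (raw)]: "(\<lambda>x. P (f x) (g x)) \<in> borel_measurable M" if "f \<in> borel_measurable M" "g \<in> borel_measurable M" for M and f g :: "'z \<Rightarrow> real"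
    using that unfolding P_def by measurable
  have Pb: "norm (P s t) \<le> C * exp \<bar>t\<bar>" for s t
    using bnd[of "Complex s t"] by (simp add: P_def norm_mult)
  have C: "0 \<le> C" using bnd[of 0] norm_ge_zero[of "U 0"] by (simp del: norm_ge_zero)
  have Pper: "P (s + \<gamma>) t = P s t" for s t
  proof -
    have "U (Complex s t + of_real \<gamma>) = cis (\<gamma> * t) * U (Complex s t)"
      using qp by (simp add: quasi_periodic_def)
    moreover have "Complex s t + of_real \<gamma> = Complex (s + \<gamma>) t"
      by (simp add: complex_eq_iff)
    ultimately have "P (s + \<gamma>) t = (cis (- ((s + \<gamma>) * t)) * cis (\<gamma> * t)) * U (Complex s t)"
      by (simp add: P_def mult.assoc)
    then show ?thesis by (simp add: P_def cis_mult algebra_simps)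
  qed
  have cper: "cis (- (2 * a * (x + \<gamma>))) = cis (- (2 * a * x))" for x
  proof -
    have "- (2 * a * (x + \<gamma>)) = - (2 * a * x) + - (2 * pi * n)"
      unfolding a_def by (simp add: distrib_left)
    moreover have "cis (- (2 * pi * n)) = 1"
      using cis_multiple_2pi[of "- of_int n"] by simp
    ultimately show ?thesis by (metis cis_mult mult.right_neutral)
  qed
  have Qm [measurable]: "Q \<in> borel_measurable borel"
    unfolding Q_def[abs_def] by measurable
  have intI: "integrable lborel (\<lambda>x. indicator ?I x *\<^sub>R (c::'z::{banach, second_countable_topology}))" for c
    by (rule integrable_indicator_Ioc)
  have Qb: "norm (Q t) \<le> \<gamma> * C * exp \<bar>t\<bar>" for t
  proof -
    have "norm (Q t) \<le> (\<integral>x. indicator ?I x *\<^sub>R (C * exp \<bar>t\<bar>) \<partial>lborel)"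
      unfolding Q_def
    proof (rule Bochner_Integration.integral_norm_bound_integral[OF _ intI])
      show "integrable lborel (\<lambda>x. indicator ?I x *\<^sub>R (cis (- (2 * a * x)) * P x t))"
        by (rule Bochner_Integration.integrable_bound[OF intI[of "C * exp \<bar>t\<bar>"]])
          (use Pb C in \<open>auto simp: indicator_def norm_mult\<close>)
    qed (use Pb C in \<open>auto simp: indicator_def norm_mult\<close>)
    also have "\<dots> = \<gamma> * C * exp \<bar>t\<bar>"
      by (simp add: less_imp_le)
    finally show ?thesis .
  qed
  have gint: "integrable lborel (\<lambda>t. complex_of_real (exp (\<bar>t\<bar> - c * (t + d)\<^sup>2)))" if "0 < c" for c d
    using integrable_exp_abs_gaussian[OF that] by simp
  have gint': "integrable lborel (\<lambda>t. complex_of_real (exp (- (t\<^sup>2 / 2))))"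
    using gaussian_integral[of "1/2" 0] by (auto simp: has_bochner_integral_iff)
  define W where "W y p = of_real (exp (- ((fst p)\<^sup>2 / 2)) * exp (- ((y - snd p)\<^sup>2 / 2))) * cis (fst p * (y + snd p))" for y :: real and p :: "real \<times> real"
  have Wm [measurable]: "W y \<in> borel_measurable borel" for y
    unfolding W_def[abs_def] borel_prod[symmetric] by measurable
  have Wint: "integrable lborel (\<lambda>p. ?G (fst p) * ?E y (snd p))" for y :: real
    unfolding lborel_prod[symmetric] by (rule integrable_pair_mult(1)[OF gint' gint]) simp
  have J: "(\<integral>x. indicator ?I x *\<^sub>R (cis (- (2 * a * x)) * (cis (- (x * y)) * LLL_proj U (Complex x y))) \<partial>lborel)
     = of_real (sqrt (2 * pi) / pi * exp (- (y + a)\<^sup>2)) * K" for y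
  proof -
    \<comment> \<open>The integrand at q = (x, (r, t)), where r is the horizontal offset in the
      convolution and t the height of the argument of U. Fubini will move the x-integral
      inside.\<close>
    define F where "F q = (indicator ?I (fst q) *\<^sub>R cis (- (2 * a * fst q))) * (W y (snd q) * P (fst q + fst (snd q)) (snd (snd q)))" for q :: "real \<times> real \<times> real"
    have "F \<in> borel_measurable (borel \<Otimes>\<^sub>M (borel \<Otimes>\<^sub>M borel))"
      unfolding F_def[abs_def] W_def by measurable
    then have [measurable]: "F \<in> borel_measurable (lborel \<Otimes>\<^sub>M lborel)"
      by (simp add: lborel_prod borel_prod)
    have F: "integrable (lborel \<Otimes>\<^sub>M lborel) F"
    proof (rule Bochner_Integration.integrable_bound)
      show "integrable (lborel \<Otimes>\<^sub>M (lborel :: (real \<times> real) measure)) (\<lambda>q. (indicator ?I (fst q) *\<^sub>R of_real C) *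
         (?G (fst (snd q)) * ?E y (snd (snd q))))"
        by (rule integrable_pair_mult(1)[OF intI Wint])
      show "AE q in lborel \<Otimes>\<^sub>M lborel. norm (F q) \<le> norm ((indicator ?I (fst q) *\<^sub>R complex_of_real C) *
         (?G (fst (snd q)) * ?E y (snd (snd q))))"
      proof (rule AE_I2)
        fix q :: "real \<times> real \<times> real"
        obtain x r t where q: "q = (x, r, t)" by (cases q) auto
        have "exp (- ((y - t)\<^sup>2 / 2)) * norm (P (x + r) t) \<le> exp (- ((y - t)\<^sup>2 / 2)) * (C * exp \<bar>t\<bar>)"
          using Pb by (intro mult_left_mono) auto
        also have "\<dots> = C * exp (\<bar>t\<bar> - 1 / 2 * (t + - y)\<^sup>2)"
          using exp_add[of "\<bar>t\<bar>" "- ((y - t)\<^sup>2 / 2)"] by (simp add: power2_commute[of y t] mult_ac)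
        finally show "norm (F q) \<le> norm ((indicator ?I (fst q) *\<^sub>R complex_of_real C) *
         (?G (fst (snd q)) * ?E y (snd (snd q))))"
          unfolding q F_def W_def using C by (simp add: norm_mult indicator_def)
      qed
    qed simp
    have "(\<integral>x. indicator ?I x *\<^sub>R (cis (- (2 * a * x)) * (cis (- (x * y)) * LLL_proj U (Complex x y))) \<partial>lborel)
       = of_real (1 / pi) * (\<integral>x. (\<integral>p. F (x, p) \<partial>lborel) \<partial>lborel)"
      unfolding LLL_proj_convolution[OF U] integral_mult_right_zero[symmetric]
      by (intro Bochner_Integration.integral_cong refl) (simp add: F_def W_def P_def lborel_prod mult_ac flip: integral_mult_right_zero)
    also have "(\<integral>x. (\<integral>p. F (x, p) \<partial>lborel) \<partial>lborel) = (\<integral>p. (\<integral>x. F (x, p) \<partial>lborel) \<partial>lborel)"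
      using lborel_pair.Fubini_integral[of "\<lambda>x p. F (x, p)"] F by simp
    also have "(\<lambda>p. (\<integral>x. F (x, p) \<partial>lborel)) = (\<lambda>p. W y p * cis (2 * a * fst p) * Q (snd p))"
    proof
      fix p :: "real \<times> real"
      have "(\<integral>x. F (x, p) \<partial>lborel) = (\<integral>x. (W y p * cis (2 * a * fst p)) * (indicator ?I x *\<^sub>R (cis (- (2 * a * (x + fst p))) * P (x + fst p) (snd p))) \<partial>lborel)"
      proof (intro Bochner_Integration.integral_cong refl)
        fix x
        have "cis (- (2 * a * x)) = cis (2 * a * fst p) * cis (- (2 * a * (x + fst p)))"
          unfolding cis_mult by (simp add: algebra_simps)
        then show "F (x, p) = (W y p * cis (2 * a * fst p)) * (indicator ?I x *\<^sub>R (cis (- (2 * a * (x + fst p))) * P (x + fst p) (snd p)))"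
          by (simp add: F_def scaleR_conv_of_real mult_ac)
      qed
      also have "\<dots> = W y p * cis (2 * a * fst p) * (\<integral>x. indicator ?I x *\<^sub>R (cis (- (2 * a * (x + fst p))) * P (x + fst p) (snd p)) \<partial>lborel)"
        by (rule integral_mult_right_zero)
      \<comment> \<open>The exponential and P both have period \<gamma> in x, so the shift by
        \<open>fst p\<close> is invisible over a full period.\<close>
      also have "(\<integral>x. indicator ?I x *\<^sub>R (cis (- (2 * a * (x + fst p))) * P (x + fst p) (snd p)) \<partial>lborel) = Q (snd p)"
        unfolding Q_def
      proof (rule integral_periodic_shift[where G = "\<lambda>x. cis (- (2 * a * x)) * P x (snd p)"])
        show "norm (cis (- (2 * a * x)) * P x (snd p)) \<le> C * exp \<bar>snd p\<bar>" for x
          using Pb by (simp add: norm_mult)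
      qed (use cper Pper in auto)
      finally show "(\<integral>x. F (x, p) \<partial>lborel) = W y p * cis (2 * a * fst p) * Q (snd p)" .
    qed
    also have "(\<integral>p. W y p * cis (2 * a * fst p) * Q (snd p) \<partial>lborel) = of_real (sqrt (2 * pi) * exp (- (y + a)\<^sup>2)) * K"
    proof -
      define G where "G p = W y p * cis (2 * a * fst p) * Q (snd p)" for p
      have [measurable]: "G \<in> borel_measurable (lborel \<Otimes>\<^sub>M lborel)"
        unfolding G_def[abs_def] W_def by measurable
      have G: "integrable (lborel \<Otimes>\<^sub>M lborel) G"
      proof (rule Bochner_Integration.integrable_bound)
        show "integrable (lborel \<Otimes>\<^sub>M lborel) (\<lambda>p. of_real (\<gamma> * C) * (?G (fst p) * ?E y (snd p)))"
          using Wint[of y] unfolding lborel_prod by (rule integrable_mult_right)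
        show "AE p in lborel \<Otimes>\<^sub>M lborel. norm (G p) \<le> norm (of_real (\<gamma> * C) * (?G (fst p) * ?E y (snd p)))"
        proof (rule AE_I2)
          fix p :: "real \<times> real"
          obtain r t where p: "p = (r, t)" by (cases p) auto
          have "exp (- ((y - t)\<^sup>2 / 2)) * norm (Q t) \<le> exp (- ((y - t)\<^sup>2 / 2)) * (\<gamma> * C * exp \<bar>t\<bar>)"
            using Qb by (intro mult_left_mono) auto
          also have "\<dots> = \<gamma> * C * exp (\<bar>t\<bar> - 1 / 2 * (t + - y)\<^sup>2)"
            using exp_add[of "\<bar>t\<bar>" "- ((y - t)\<^sup>2 / 2)"] by (simp add: power2_commute[of y t] mult_ac)
          finally show "norm (G p) \<le> norm (of_real (\<gamma> * C) * (?G (fst p) * ?E y (snd p)))"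
            unfolding p G_def W_def using C by (simp add: norm_mult mult_ac less_imp_le abs_mult)
        qed
      qed simp
      have "(\<integral>p. G p \<partial>lborel) = (\<integral>t. (\<integral>r. G (r, t) \<partial>lborel) \<partial>lborel)"
        using lborel_pair.integral_snd[of "\<lambda>r t. G (r, t)"] G by (simp add: lborel_prod)
      also have "\<dots> = (\<integral>t. of_real (sqrt (2 * pi) * exp (- (y + a)\<^sup>2)) * (of_real (exp (- (t + a)\<^sup>2)) * Q t) \<partial>lborel)"
      proof (intro Bochner_Integration.integral_cong refl)
        fix t
        \<comment> \<open>The offset r now occurs only in a Gaussian and a phase, so its integral is
          a Fourier transform at frequency y + t + 2 a.\<close>
        have "(\<integral>r. G (r, t) \<partial>lborel) = (\<integral>r. (of_real (exp (- (r\<^sup>2 / 2))) * cis ((y + t + 2 * a) * r)) * (of_real (exp (- ((y - t)\<^sup>2 / 2))) * Q t) \<partial>lborel)"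
        proof (intro Bochner_Integration.integral_cong refl)
          fix r
          have "cis ((y + t + 2 * a) * r) = cis (r * (y + t)) * cis (2 * a * r)"
            unfolding cis_mult by (simp add: algebra_simps)
          then show "G (r, t) = (of_real (exp (- (r\<^sup>2 / 2))) * cis ((y + t + 2 * a) * r)) * (of_real (exp (- ((y - t)\<^sup>2 / 2))) * Q t)"
            by (simp add: G_def W_def mult_ac)
        qed
        also have "\<dots> = of_real (sqrt (2 * pi) * exp (- ((y + t + 2 * a)\<^sup>2 / 2))) * (of_real (exp (- ((y - t)\<^sup>2 / 2))) * Q t)"
          using gaussian_fourier[of "y + t + 2 * a"] by (simp add: has_bochner_integral_iff)
        also have "\<dots> = of_real (sqrt (2 * pi)) * of_real (exp (- ((y + t + 2 * a)\<^sup>2 / 2)) * exp (- ((y - t)\<^sup>2 / 2))) * Q t"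
          by simp
        \<comment> \<open>With A = y + a and B = t + a the exponents are (A + B)^2 / 2 and (A - B)^2
          / 2, whose sum A^2 + B^2 separates the two heights.\<close>
        also have "exp (- ((y + t + 2 * a)\<^sup>2 / 2)) * exp (- ((y - t)\<^sup>2 / 2)) = exp (- (y + a)\<^sup>2) * exp (- (t + a)\<^sup>2)"
          unfolding exp_add[symmetric] by (rule arg_cong[where f = exp]) (simp add: power2_eq_square field_simps)
        finally show "(\<integral>r. G (r, t) \<partial>lborel) = of_real (sqrt (2 * pi) * exp (- (y + a)\<^sup>2)) * (of_real (exp (- (t + a)\<^sup>2)) * Q t)"
          by simp
      qed
      also have "\<dots> = of_real (sqrt (2 * pi) * exp (- (y + a)\<^sup>2)) * K"
        unfolding K_def by (rule integral_mult_right_zero)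
      finally show ?thesis unfolding G_def .
    qed
    finally show ?thesis by simp
  qed
  have psi: "cnj (\<psi> n (Complex x y)) = of_real amp * ph * of_real (exp (- (y + a)\<^sup>2)) * (cis (- (2 * a * x)) * cis (- (x * y)))" for x y
  proof -
    have "cis (- (2 * pi * n * x / \<gamma> + x * y - pi * n\<^sup>2 / 2)) = ph * (cis (- (2 * a * x)) * cis (- (x * y)))"
      unfolding ph_def cis_mult by (rule arg_cong[where f = cis]) (simp add: a_def field_simps)
    then show ?thesis
      unfolding psi_Complex by (simp add: cis_cnj a_def mult_ac)
  qed
  have "L2ip (strip \<gamma>) (LLL_proj U) (\<psi> n) = of_real amp * ph * K"
  proof -
    define G where "G p = indicator ?I (fst p) *\<^sub>R (LLL_proj U (Complex (fst p) (snd p)) * cnj (\<psi> n (Complex (fst p) (snd p))))" for p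
    have G: "integrable (lborel \<Otimes>\<^sub>M lborel) G"
      using L2_mult_cnj_integrable[OF L2 L2_orthonormal.L2_basis[OF psi_orthonormal, of n]]
      unfolding G_def by (subst (asm) integrable_strip) simp_all
    have "L2ip (strip \<gamma>) (LLL_proj U) (\<psi> n) = (\<integral>p. G p \<partial>(lborel \<Otimes>\<^sub>M lborel))"
      unfolding L2ip_def G_def by (rule integral_strip) measurable
    also have "\<dots> = (\<integral>y. (\<integral>x. G (x, y) \<partial>lborel) \<partial>lborel)"
      using lborel_pair.integral_snd[of "\<lambda>r t. G (r, t)"] G by simp
    also have "\<dots> = (\<integral>y. (of_real amp * ph * of_real (sqrt (2 * pi) / pi) * K) * of_real (exp (- (2 * (y + a)\<^sup>2))) \<partial>lborel)"
    proof (intro Bochner_Integration.integral_cong refl)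
      fix y
      have "(\<integral>x. G (x, y) \<partial>lborel) = (\<integral>x. (of_real amp * ph * of_real (exp (- (y + a)\<^sup>2))) *
          (indicator ?I x *\<^sub>R (cis (- (2 * a * x)) * (cis (- (x * y)) * LLL_proj U (Complex x y)))) \<partial>lborel)"
        by (intro Bochner_Integration.integral_cong refl) (simp add: G_def psi scaleR_conv_of_real mult_ac)
      also have "\<dots> = (of_real amp * ph * of_real (exp (- (y + a)\<^sup>2))) * (of_real (sqrt (2 * pi) / pi * exp (- (y + a)\<^sup>2)) * K)"
        unfolding integral_mult_right_zero J ..
      also have "\<dots> = (of_real amp * ph * of_real (sqrt (2 * pi) / pi) * K) * of_real (exp (- (y + a)\<^sup>2) * exp (- (y + a)\<^sup>2))"
        by simp
      also have "exp (- (y + a)\<^sup>2) * exp (- (y + a)\<^sup>2) = exp (- (2 * (y + a)\<^sup>2))"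
        unfolding exp_add[symmetric] by simp
      finally show "(\<integral>x. G (x, y) \<partial>lborel) = (of_real amp * ph * of_real (sqrt (2 * pi) / pi) * K) * of_real (exp (- (2 * (y + a)\<^sup>2)))" .
    qed
    also have "\<dots> = (of_real amp * ph * of_real (sqrt (2 * pi) / pi) * K) * of_real (sqrt (pi / 2))"
      using gaussian_integral[of 2 a] by (simp add: has_bochner_integral_iff)
    also have "\<dots> = of_real amp * ph * K * of_real (sqrt (2 * pi) / pi * sqrt (pi / 2))"
      by simp
    \<comment> \<open>The factor contributed by the projection and the one from the height integral
      cancel: this is where the projection acts as the identity on coefficients.\<close>
    also have "sqrt (2 * pi) / pi * sqrt (pi / 2) = 1"
      by (simp add: real_sqrt_mult real_sqrt_divide)
    finally show ?thesis by simp
  qed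
  moreover have "L2ip (strip \<gamma>) U (\<psi> n) = of_real amp * ph * K"
  proof -
    define G where "G p = indicator ?I (fst p) *\<^sub>R (U (Complex (fst p) (snd p)) * cnj (\<psi> n (Complex (fst p) (snd p))))" for p
    have Gm [measurable]: "G \<in> borel_measurable (lborel \<Otimes>\<^sub>M lborel)"
      unfolding G_def[abs_def] by measurable
    have G_eq: "G (x, y) = (of_real amp * ph * of_real (exp (- (y + a)\<^sup>2))) * (indicator ?I x *\<^sub>R (cis (- (2 * a * x)) * P x y))" for x y
      by (simp add: G_def psi P_def scaleR_conv_of_real mult_ac)
    have G: "integrable (lborel \<Otimes>\<^sub>M lborel) G"
    proof (rule Bochner_Integration.integrable_bound)
      show "integrable (lborel \<Otimes>\<^sub>M lborel) (\<lambda>p. (indicator ?I (fst p) *\<^sub>R of_real (amp * C)) * complex_of_real (exp (\<bar>snd p\<bar> - 1 * (snd p + a)\<^sup>2)))"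
        by (rule integrable_pair_mult(1)[OF intI gint]) simp
      show "AE p in lborel \<Otimes>\<^sub>M lborel. norm (G p) \<le> norm ((indicator ?I (fst p) *\<^sub>R complex_of_real (amp * C)) * complex_of_real (exp (\<bar>snd p\<bar> - 1 * (snd p + a)\<^sup>2)))"
      proof (rule AE_I2)
        fix p :: "real \<times> real"
        obtain x t where p: "p = (x, t)" by (cases p) auto
        have "exp (- (t + a)\<^sup>2) * norm (P x t) \<le> exp (- (t + a)\<^sup>2) * (C * exp \<bar>t\<bar>)"
          using Pb by (intro mult_left_mono) auto
        also have "\<dots> = C * exp (\<bar>t\<bar> - 1 * (t + a)\<^sup>2)"
          using exp_add[of "\<bar>t\<bar>" "- (t + a)\<^sup>2"] by (simp add: mult_ac)
        finally show "norm (G p) \<le> norm ((indicator ?I (fst p) *\<^sub>R complex_of_real (amp * C)) * complex_of_real (exp (\<bar>snd p\<bar> - 1 * (snd p + a)\<^sup>2)))"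
          unfolding p G_eq using C by (simp add: norm_mult indicator_def ph_def less_imp_le abs_mult)
      qed
    qed simp
    have "L2ip (strip \<gamma>) U (\<psi> n) = (\<integral>p. G p \<partial>(lborel \<Otimes>\<^sub>M lborel))"
      unfolding L2ip_def G_def by (rule integral_strip) measurable
    also have "\<dots> = (\<integral>y. (\<integral>x. G (x, y) \<partial>lborel) \<partial>lborel)"
      using lborel_pair.integral_snd[of "\<lambda>r t. G (r, t)"] G by simp
    also have "\<dots> = (\<integral>y. (of_real amp * ph) * (of_real (exp (- (y + a)\<^sup>2)) * Q y) \<partial>lborel)"
      unfolding G_eq integral_mult_right_zero Q_def by (simp only: mult.assoc integral_mult_right_zero)
    also have "\<dots> = of_real amp * ph * K"
      unfolding K_def by (rule integral_mult_right_zero)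
    finally show ?thesis .
  qed
  ultimately show ?thesis by simp
qed

subsection \<open>Fourier series and the theta functions\<close>

lemma integral_unit_interval:
  fixes F :: "real \<Rightarrow> complex"
  assumes "F \<in> borel_measurable borel"
  shows "integral\<^sup>L (lebesgue_on {0..1}) F = integral\<^sup>L lborel (\<lambda>x. indicator {0..1} x *\<^sub>R F x)"
    and "integrable (lebesgue_on {0..1}) F \<longleftrightarrow> integrable lborel (\<lambda>x. indicator {0..1} x *\<^sub>R F x)"
  using assms by (simp_all add: integral_restrict_space integral_completion integrable_restrict_space integrable_completion)

lemma cis_unit_integral:
  fixes k :: int
  shows "has_bochner_integral (lebesgue_on {0..1}) (\<lambda>x. cis (2 * pi * k * x)) (if k = 0 then 1 else 0)"
  using cis_int_period_integral_Icc[of 1 0 k] unfolding has_bochner_integral_iff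
  by (simp add: integral_unit_interval)

definition fourier_basis :: "int \<Rightarrow> real \<Rightarrow> complex" where
  "fourier_basis n \<xi> = cis (- (2 * pi * n * \<xi>))"

lemma fourier_basis_exp: "fourier_basis n \<xi> = exp (- 2 * of_real pi * \<i> * of_int n * of_real \<xi>)"
  by (simp add: fourier_basis_def cis_conv_exp mult_ac)

lemma fourier_basis_measurable [measurable]: "fourier_basis n \<in> borel_measurable borel"
  unfolding fourier_basis_def[abs_def] by measurable

lemma cis_fourier_basis: "cis (2 * pi * of_int k * \<xi>) * fourier_basis n \<xi> = fourier_basis (n - k) \<xi>"
  unfolding fourier_basis_def cis_mult by (simp add: algebra_simps)

lemma fourier_orthonormal: "L2_orthonormal {0..1} fourier_basis"
proof
  show "L2 {0..1} (fourier_basis n)" for n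
    using finite_measure.integrable_const[OF finite_measure_lebesgue_on, of "{0..1::real}" "1::real"]
    by (auto simp: L2_def fourier_basis_def intro!: borel_measurable_lebesgue_on_borel)
  have "fourier_basis m x * cnj (fourier_basis n x) = cis (2 * pi * of_int (n - m) * x)" for m n x
    unfolding fourier_basis_def cis_cnj cis_mult by (simp add: algebra_simps)
  then show "L2ip {0..1} (fourier_basis m) (fourier_basis n) = (if m = n then 1 else 0)" for m n
    unfolding L2ip_def using cis_unit_integral[of "n - m"] by (auto simp: has_bochner_integral_iff)
qed

text \<open>Membership in the closed linear span, expressed as convergence of the expansion in the
  function's own coefficients. Two members with equal coefficients agree almost everywhere, which
  mere square integrability would not give.\<close>

definition spanned :: "'a::euclidean_space set \<Rightarrow> (int \<Rightarrow> 'a \<Rightarrow> complex) \<Rightarrow> ('a \<Rightarrow> complex) \<Rightarrow> bool" where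
  "spanned S \<phi> u \<longleftrightarrow> L2_has_sum S (\<lambda>n x. L2ip S u (\<phi> n) * \<phi> n x) u"

lemma spanned_L2: "spanned S \<phi> u \<Longrightarrow> L2 S u"
  by (auto simp: spanned_def dest: L2_has_sumD)

context L2_orthonormal
begin

lemma spannedI: "L2_has_sum S (\<lambda>n x. c n * \<phi> n x) u \<Longrightarrow> spanned S \<phi> u"
  unfolding spanned_def by (simp add: coeff_eq)

lemma spanned_limit:
  assumes "L2 S u" "\<And>e. 0 < e \<Longrightarrow> \<exists>w. spanned S \<phi> w \<and> L2norm S (\<lambda>x. u x - w x) < e"
  shows "spanned S \<phi> u"
  unfolding spanned_def using assms(2)
  by (intro has_sum_of_approximable assms(1)) (metis spanned_def)

lemma spanned_linear:
  assumes "spanned S \<phi> u" "spanned S \<phi> w"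
  shows "spanned S \<phi> (\<lambda>x. p * u x + r * w x)"
  using L2_has_sum_linear[OF assms[unfolded spanned_def], of p r]
  by (intro spannedI[where c = "\<lambda>n. p * L2ip S u (\<phi> n) + r * L2ip S w (\<phi> n)"]) (simp add: algebra_simps)

lemma spanned_cmult: "spanned S \<phi> u \<Longrightarrow> spanned S \<phi> (\<lambda>x. p * u x)"
  using spanned_linear[of u u p 0] by simp

lemma spanned_basis: "spanned S \<phi> (\<phi> k)"
proof (rule spannedI)
  show "L2_has_sum S (\<lambda>n x. (if n = k then 1 else 0) * \<phi> n x) (\<phi> k)"
    unfolding L2_has_sum_def
  proof (intro conjI allI L2_cmult L2_basis)
    have "\<phi> k x - (\<Sum>n\<in>N. (if n = k then 1 else 0) * \<phi> n x) = 0" if "finite N" "{k} \<subseteq> N" for N x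
    proof -
      have "(\<Sum>n\<in>N. (if n = k then 1 else 0) * \<phi> n x) = (\<Sum>n\<in>N. if n = k then \<phi> n x else 0)"
        by (intro sum.cong) auto
      then show ?thesis using that by simp
    qed
    then have "\<forall>\<^sub>F N in finite_subsets_at_top UNIV. L2norm S (\<lambda>x. \<phi> k x - (\<Sum>n\<in>N. (if n = k then 1 else 0) * \<phi> n x)) = 0"
      unfolding eventually_finite_subsets_at_top by (intro exI[of _ "{k}"]) (auto simp: L2norm_def)
    then show "((\<lambda>N. L2norm S (\<lambda>x. \<phi> k x - (\<Sum>n\<in>N. (if n = k then 1 else 0) * \<phi> n x))) \<longlongrightarrow> 0) (finite_subsets_at_top UNIV)"
      by (rule tendsto_eventually)
  qed
qed

lemma spanned_zero: "spanned S \<phi> (\<lambda>x. 0)"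
  using spanned_cmult[OF spanned_basis, of 0] by simp

lemma spanned_sum: "finite N \<Longrightarrow> (\<And>n. n \<in> N \<Longrightarrow> spanned S \<phi> (u n)) \<Longrightarrow> spanned S \<phi> (\<lambda>x. \<Sum>n\<in>N. u n x)"
proof (induction N rule: finite_induct)
  case (insert n N)
  then show ?case using spanned_linear[of "u n" "\<lambda>x. \<Sum>n\<in>N. u n x" 1 1] by simp
qed (simp add: spanned_zero)

end

text \<open>Multiplication by cis (2 pi k \<xi>) preserves the norm and only shifts the index of the
  exponentials, so it maps approximating partial sums to approximating partial sums.\<close>

lemma spanned_cis_mult:
  assumes "spanned {0..1} fourier_basis u"
  shows "spanned {0..1} fourier_basis (\<lambda>\<xi>. cis (2 * pi * of_int k * \<xi>) * u \<xi>)"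
proof -
  interpret L2_orthonormal "{0..1}" fourier_basis by (rule fourier_orthonormal)
  let ?c = "\<lambda>n. L2ip {0..1} u (fourier_basis n)"
  have cm: "(\<lambda>\<xi>. cis (2 * pi * of_int k * \<xi>)) \<in> borel_measurable (lebesgue_on {0..1})"
    by (intro borel_measurable_lebesgue_on_borel) measurable
  show ?thesis
  proof (rule spanned_limit)
    show "L2 {0..1} (\<lambda>\<xi>. cis (2 * pi * of_int k * \<xi>) * u \<xi>)"
      by (rule L2_bounded_mult[OF spanned_L2[OF assms] cm, of 1]) simp
    fix e :: real assume "0 < e"
    have "\<forall>\<^sub>F N in finite_subsets_at_top UNIV. L2norm {0..1} (\<lambda>x. u x - (\<Sum>n\<in>N. ?c n * fourier_basis n x)) < e"
      using tendstoD[OF L2_has_sumD(3)[OF assms[unfolded spanned_def]] \<open>0 < e\<close>] by simp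
    then obtain N where N: "finite N" "L2norm {0..1} (\<lambda>x. u x - (\<Sum>n\<in>N. ?c n * fourier_basis n x)) < e"
      unfolding eventually_finite_subsets_at_top by blast
    let ?w = "\<lambda>\<xi>. cis (2 * pi * of_int k * \<xi>) * (\<Sum>n\<in>N. ?c n * fourier_basis n \<xi>)"
    have "?w = (\<lambda>\<xi>. \<Sum>n\<in>N. ?c n * fourier_basis (n - k) \<xi>)"
      unfolding sum_distrib_left by (intro ext sum.cong refl) (simp add: mult.left_commute[of "cis _"] cis_fourier_basis)
    then have w: "spanned {0..1} fourier_basis ?w"
      using N(1) by (simp only:) (intro spanned_sum spanned_cmult spanned_basis)
    have d: "L2norm {0..1} (\<lambda>\<xi>. cis (2 * pi * of_int k * \<xi>) * u \<xi> - ?w \<xi>) = L2norm {0..1} (\<lambda>x. u x - (\<Sum>n\<in>N. ?c n * fourier_basis n x))"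
      unfolding right_diff_distrib[symmetric] L2norm_def by (simp only: norm_mult norm_cis mult_1_left)
    show "\<exists>w. spanned {0..1} fourier_basis w \<and> L2norm {0..1} (\<lambda>\<xi>. cis (2 * pi * of_int k * \<xi>) * u \<xi> - w \<xi>) < e"
      by (rule exI[of _ ?w], rule conjI, rule w, unfold d, rule N(2))
  qed
qed

text \<open>Abstracts the two theta series: the weights \<open>theta_coeff\<close> give
  \<open>ell\<close>, and their restriction to odd indices gives \<open>hodd\<close>. Evenness makes
  the sums real; summability makes convergence uniform in \<xi>.\<close>

locale even_summable =
  fixes w :: "int \<Rightarrow> real"
  assumes w_even: "w (- k) = w k" and w_nonneg: "0 \<le> w k" and w_summable: "w summable_on UNIV"
begin

definition series :: "real \<Rightarrow> complex" where
  "series \<xi> = (\<Sum>\<^sub>\<infinity>k. of_real (w k) * cis (2 * pi * k * \<xi>))"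

lemma norm_term: "norm (of_real (w k) * cis (2 * pi * k * \<xi>)) = w k"
  by (simp add: norm_mult w_nonneg)

lemma term_summable: "(\<lambda>k. norm (of_real (w k) * cis (2 * pi * k * \<xi>))) summable_on UNIV"
  unfolding norm_term by (rule w_summable)

lemma series_has_sum: "((\<lambda>k. of_real (w k) * cis (2 * pi * k * \<xi>)) has_sum series \<xi>) UNIV"
  unfolding series_def by (rule has_sum_infsum[OF abs_summable_summable[OF term_summable]])

lemma series_measurable [measurable]: "series \<in> borel_measurable borel"
  unfolding series_def[abs_def] by (rule borel_measurable_infsum_int) (measurable, rule term_summable)

lemma norm_series_le: "norm (series \<xi>) \<le> (\<Sum>\<^sub>\<infinity>k. w k)"
  unfolding series_def using norm_infsum_bound[OF term_summable] by (simp only: norm_term)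

lemma series_integral:
  assumes "integrable (lebesgue_on {0..1}) H"
  shows "((\<lambda>k. of_real (w k) * integral\<^sup>L (lebesgue_on {0..1}) (\<lambda>\<xi>. cis (2 * pi * k * \<xi>) * H \<xi>)) has_sum
    integral\<^sup>L (lebesgue_on {0..1}) (\<lambda>\<xi>. series \<xi> * H \<xi>)) UNIV"
proof -
  have "((\<lambda>k. integral\<^sup>L (lebesgue_on {0..1}) (\<lambda>\<xi>. of_real (w k) * cis (2 * pi * k * \<xi>) * H \<xi>)) has_sum
    integral\<^sup>L (lebesgue_on {0..1}) (\<lambda>\<xi>. series \<xi> * H \<xi>)) UNIV"
    unfolding series_def
    by (rule has_sum_integral[OF _ assms term_summable, of _ "\<Sum>\<^sub>\<infinity>k. w k"])
      (auto simp: norm_term simp del: of_real_mult intro!: borel_measurable_lebesgue_on_borel)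
  then show ?thesis by (simp only: mult.assoc integral_mult_right_zero)
qed

lemma series_coeff: "integral\<^sup>L (lebesgue_on {0..1}) (\<lambda>\<xi>. series \<xi> * cis (2 * pi * of_int j * \<xi>)) = of_real (w j)"
proof -
  have "cis (2 * pi * of_int k * \<xi>) * cis (2 * pi * of_int j * \<xi>) = cis (2 * pi * of_int (k + j) * \<xi>)" for k \<xi>
    unfolding cis_mult by (simp add: algebra_simps)
  then have I: "integral\<^sup>L (lebesgue_on {0..1}) (\<lambda>\<xi>. cis (2 * pi * of_int k * \<xi>) * cis (2 * pi * of_int j * \<xi>)) = (if k + j = 0 then 1 else 0)" for k
    using cis_unit_integral[of "k + j"] by (simp only: has_bochner_integral_iff)
  have "((\<lambda>k. complex_of_real (w k) * (if k + j = 0 then 1 else 0)) has_sum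
    integral\<^sup>L (lebesgue_on {0..1}) (\<lambda>\<xi>. series \<xi> * cis (2 * pi * of_int j * \<xi>))) UNIV"
    using series_integral[of "\<lambda>\<xi>. cis (2 * pi * of_int j * \<xi>)"] cis_unit_integral[of j] unfolding I has_bochner_integral_iff by blast
  moreover have "((\<lambda>k. complex_of_real (w k) * (if k + j = 0 then 1 else 0)) has_sum complex_of_real (w j)) UNIV"
    using has_sum_finite_neutralI[of "{- j}" UNIV "\<lambda>k. complex_of_real (w k) * (if k + j = 0 then 1 else 0)"]
    by (auto simp: w_even)
  ultimately show ?thesis by (rule has_sum_unique)
qed

text \<open>Expanding one factor termwise pairs its mode k with the coefficient of index k + j of
  the other. The resulting autocorrelation is the shape in which the matrix of
  \<open>\<Psi>\<^sub>0\<close> squared appears on the strip.\<close>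

lemma series_square_coeff:
  "((\<lambda>k. of_real (w k * w (k + j))) has_sum integral\<^sup>L (lebesgue_on {0..1}) (\<lambda>\<xi>. series \<xi> * (series \<xi> * cis (2 * pi * of_int j * \<xi>)))) UNIV"
proof -
  have "L2 {0..1} (\<lambda>\<xi>. series \<xi> * fourier_basis (- j) \<xi>)"
    by (rule L2_bounded_mult[OF L2_orthonormal.L2_basis[OF fourier_orthonormal] _ norm_series_le])
      (intro borel_measurable_lebesgue_on_borel series_measurable)
  then have "integrable (lebesgue_on {0..1}) (\<lambda>\<xi>. series \<xi> * fourier_basis (- j) \<xi> * cnj (fourier_basis 0 \<xi>))"
    by (rule L2_mult_cnj_integrable[OF _ L2_orthonormal.L2_basis[OF fourier_orthonormal]])
  then have int: "integrable (lebesgue_on {0..1}) (\<lambda>\<xi>. series \<xi> * cis (2 * pi * of_int j * \<xi>))"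
    unfolding fourier_basis_def by simp
  have eq: "cis (2 * pi * of_int k * \<xi>) * (series \<xi> * cis (2 * pi * of_int j * \<xi>)) = series \<xi> * cis (2 * pi * of_int (k + j) * \<xi>)" for k \<xi>
  proof -
    have "cis (2 * pi * of_int k * \<xi>) * cis (2 * pi * of_int j * \<xi>) = cis (2 * pi * of_int (k + j) * \<xi>)"
      unfolding cis_mult by (simp add: algebra_simps)
    then show ?thesis by (simp only: mult.left_commute[of "cis _" "series \<xi>"])
  qed
  show ?thesis
    using series_integral[OF int] unfolding eq series_coeff by simp
qed

text \<open>A finite part of the series is a trigonometric polynomial, which preserves the span, and
  the remainder is bounded uniformly by a tail of the sum of the weights.\<close>

lemma spanned_series_mult:
  assumes "spanned {0..1} fourier_basis u"
  shows "spanned {0..1} fourier_basis (\<lambda>\<xi>. series \<xi> * u \<xi>)"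
proof -
  interpret L2_orthonormal "{0..1}" fourier_basis by (rule fourier_orthonormal)
  note u = spanned_L2[OF assms]
  have sm: "series \<in> borel_measurable (lebesgue_on {0..1})"
    by (intro borel_measurable_lebesgue_on_borel series_measurable)
  show ?thesis
  proof (rule spanned_limit)
    show "L2 {0..1} (\<lambda>\<xi>. series \<xi> * u \<xi>)"
      by (rule L2_bounded_mult[OF u sm norm_series_le])
    fix e :: real assume "0 < e"
    \<comment> \<open>The 1 in the denominator covers u of norm zero and makes the final inequality
      strict.\<close>
    define d where "d = e / (L2norm {0..1} u + 1)"
    have nn: "0 \<le> L2norm {0..1} u" by simp
    have "0 < d" using \<open>0 < e\<close> nn unfolding d_def by (intro divide_pos_pos) linarith+
    then have "\<forall>\<^sub>F F in finite_subsets_at_top UNIV. dist (sum w F) (\<Sum>\<^sub>\<infinity>k. w k) < d"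
      using has_sum_infsum[OF w_summable] by (auto simp: has_sum_def dest: tendstoD)
    then obtain F where F: "finite F" "dist (sum w F) (\<Sum>\<^sub>\<infinity>k. w k) < d"
      unfolding eventually_finite_subsets_at_top by blast
    define p where "p \<xi> = (\<Sum>k\<in>F. of_real (w k) * cis (2 * pi * of_int k * \<xi>))" for \<xi>
    have pm: "p \<in> borel_measurable (lebesgue_on {0..1})"
      unfolding p_def[abs_def] by (intro borel_measurable_lebesgue_on_borel) measurable
    have tail: "norm (series \<xi> - p \<xi>) \<le> d" for \<xi>
    proof -
      have S: "((\<lambda>k. of_real (w k) * cis (2 * pi * of_int k * \<xi>)) has_sum (series \<xi> - p \<xi>)) (UNIV - F)"
        unfolding p_def by (intro has_sum_Diff series_has_sum has_sum_finite F) auto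
      have W: "(w has_sum ((\<Sum>\<^sub>\<infinity>k. w k) - sum w F)) (UNIV - F)"
        by (intro has_sum_Diff has_sum_infsum w_summable has_sum_finite F) auto
      have "norm (series \<xi> - p \<xi>) \<le> (\<Sum>\<^sub>\<infinity>k. w k) - sum w F"
        by (rule norm_has_sum_bound[OF _ S]) (use W in \<open>simp only: norm_term\<close>)
      then show ?thesis using F(2) by (simp add: dist_real_def)
    qed
    have "(\<lambda>\<xi>. p \<xi> * u \<xi>) = (\<lambda>\<xi>. \<Sum>k\<in>F. of_real (w k) * (cis (2 * pi * of_int k * \<xi>) * u \<xi>))"
      by (simp add: p_def sum_distrib_right mult.assoc)
    then have "spanned {0..1} fourier_basis (\<lambda>\<xi>. p \<xi> * u \<xi>)"
      using F(1) by (simp only:) (intro spanned_sum spanned_cmult spanned_cis_mult assms)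
    moreover have "L2norm {0..1} (\<lambda>\<xi>. series \<xi> * u \<xi> - p \<xi> * u \<xi>) < e"
    proof -
      have "L2norm {0..1} (\<lambda>\<xi>. (series \<xi> - p \<xi>) * u \<xi>) \<le> d * L2norm {0..1} u"
        using \<open>0 < d\<close> by (intro L2norm_bounded_mult u borel_measurable_diff sm pm tail) auto
      also have "\<dots> < e"
      proof -
        have "d * (L2norm {0..1} u + 1) = e" using add_nonneg_pos[OF nn, of 1] by (simp add: d_def)
        then show ?thesis using \<open>0 < d\<close> by (simp add: algebra_simps)
      qed
      finally show ?thesis by (simp add: left_diff_distrib)
    qed
    ultimately show "\<exists>v. spanned {0..1} fourier_basis v \<and> L2norm {0..1} (\<lambda>\<xi>. series \<xi> * u \<xi> - v \<xi>) < e"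
      by blast
  qed
qed

lemma w_summable_nat: "(\<lambda>n::nat. w (int n)) summable_on {1..}"
  using summable_on_subset_banach[OF w_summable, of "{1..}"]
  by (subst summable_on_reindex_bij_witness[where i = nat and j = int and T = "{1..}" and h = w]) auto

lemma cos_summable: "(\<lambda>n::nat. w (int n) * cos (2 * pi * n * \<xi>)) summable_on {1..}"
proof (rule abs_summable_summable, rule Infinite_Sum.abs_summable_on_comparison_test'[OF w_summable_nat])
  show "norm (w (int n) * cos (2 * pi * n * \<xi>)) \<le> w (int n)" for n :: nat
    using abs_cos_le_one by (simp add: abs_mult w_nonneg mult_left_le)
qed

lemma series_real:
  "series \<xi> = of_real (w 0 + 2 * (\<Sum>\<^sub>\<infinity>n\<in>{1::nat..}. w (int n) * cos (2 * pi * n * \<xi>)))"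
proof -
  define f where "f k = of_real (w k) * cis (2 * pi * k * \<xi>)" for k :: int
  have s: "f summable_on A" for A
    using summable_on_subset_banach[OF abs_summable_summable[OF term_summable[of \<xi>]]] unfolding f_def by auto
  have e: "{0..} \<union> {..<0} = (UNIV :: int set)" "{0} \<union> {1..} = {0::int..}" "{0::int..} \<inter> {..<0} = {}" "{0} \<inter> {1::int..} = {}" by auto
  have "infsum f UNIV = f 0 + infsum f {1..} + infsum f {..<0}"
    using infsum_Un_disjoint[OF s s e(3)] infsum_Un_disjoint[OF s s e(4)] unfolding e by simp
  also have "infsum f {1..} = (\<Sum>\<^sub>\<infinity>n\<in>{1::nat..}. f (int n))"
    by (rule infsum_reindex_bij_witness[where i = int and j = nat]) auto
  also have "infsum f {..<0} = (\<Sum>\<^sub>\<infinity>n\<in>{1::nat..}. f (- int n))"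
    by (rule infsum_reindex_bij_witness[where i = "\<lambda>n. - int n" and j = "\<lambda>k. nat (- k)"]) auto
  also have "f 0 + (\<Sum>\<^sub>\<infinity>n\<in>{1::nat..}. f (int n)) + (\<Sum>\<^sub>\<infinity>n\<in>{1::nat..}. f (- int n)) = f 0 + (\<Sum>\<^sub>\<infinity>n\<in>{1::nat..}. f (int n) + f (- int n))"
  proof -
    have "(\<lambda>n. f (int n)) summable_on {1..}"
      using s[of "{1..}"] by (subst summable_on_reindex_bij_witness[where i = nat and j = int and T = "{1..}" and h = f]) auto
    moreover have "(\<lambda>n. f (- int n)) summable_on {1..}"
      using s[of "{..<0}"] by (subst summable_on_reindex_bij_witness[where i = "\<lambda>k. nat (- k)" and j = "\<lambda>n. - int n" and T = "{..<0}" and h = f]) auto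
    ultimately show ?thesis by (simp add: infsum_add)
  qed
  also have "(\<lambda>n. f (int n) + f (- int n)) = (\<lambda>n. 2 * of_real (w (int n) * cos (2 * pi * n * \<xi>)))"
    by (auto simp: f_def w_even complex_eq_iff)
  also have "(\<Sum>\<^sub>\<infinity>n\<in>{1::nat..}. 2 * complex_of_real (w (int n) * cos (2 * pi * n * \<xi>))) = of_real (2 * (\<Sum>\<^sub>\<infinity>n\<in>{1::nat..}. w (int n) * cos (2 * pi * n * \<xi>)))"
    unfolding infsum_cmult_right' infsumI[OF has_sum_of_real[OF has_sum_infsum[OF cos_summable]]] by simp
  finally show ?thesis
    by (simp add: series_def f_def)
qed

end

section \<open>The two theta series and the size of their coefficients\<close>

definition odd_coeff :: "int \<Rightarrow> real" where
  "odd_coeff k = (if odd k then theta_coeff k else 0)"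

text \<open>The exponent is pi sqrt 3 / 2, at least 3 * 1.7 / 2 = 51/20 = 3 * 17/20. The quadratic
  Taylor bound gives exp (17/20) \<ge> 2.211, whose cube exceeds 10.\<close>

lemma theta_coeff_1_less: "theta_coeff 1 < 1 / 10"
proof -
  have s3: "17 / 10 \<le> sqrt 3" by (rule real_le_rsqrt) (simp add: power2_eq_square)
  have "3 * (17 / 10) / 2 \<le> pi * sqrt 3 / 2"
    using s3 pi_gt3 by (intro divide_right_mono mult_mono) auto
  then have ex: "51 / 20 \<le> pi\<^sup>2 / \<gamma>\<^sup>2"
    unfolding pi_over_gamma_power2[unfolded power_divide] by simp
  have "1 + 17 / 20 + (17 / 20)\<^sup>2 / 2 \<le> exp (17 / 20 :: real)"
    by (rule exp_lower_Taylor_quadratic) simp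
  then have "(2211 / 1000) ^ 3 \<le> exp (17 / 20 :: real) ^ 3"
    by (intro power_mono) (auto simp: power2_eq_square)
  also have "exp (17 / 20 :: real) ^ 3 = exp (51 / 20)"
    by (simp flip: exp_of_nat_mult)
  also have "\<dots> \<le> exp (pi\<^sup>2 / \<gamma>\<^sup>2)" using ex by simp
  finally have "10 < exp (pi\<^sup>2 / \<gamma>\<^sup>2)" by (simp add: power3_eq_cube)
  then show ?thesis
    by (simp add: theta_coeff_def exp_minus field_simps)
qed

lemma theta_coeff_power: "theta_coeff k = theta_coeff 1 ^ nat (k\<^sup>2)"
proof -
  have "theta_coeff k = exp (of_nat (nat (k\<^sup>2)) * - (pi\<^sup>2 / \<gamma>\<^sup>2))"
    by (simp add: theta_coeff_def mult.commute)
  then show ?thesis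
    unfolding exp_of_nat_mult by (simp add: theta_coeff_def)
qed

lemma theta_coeff_le: "theta_coeff k \<le> theta_coeff 1 ^ nat \<bar>k\<bar>"
proof -
  have "\<bar>k\<bar> * 1 \<le> \<bar>k\<bar> * \<bar>k\<bar>"
    by (cases "k = 0", simp, rule mult_left_mono) auto
  then have "nat \<bar>k\<bar> \<le> nat (k\<^sup>2)" by (simp add: power2_eq_square)
  then show ?thesis
    unfolding theta_coeff_power[of k] using theta_coeff_1_less by (intro power_decreasing) auto
qed

lemma theta_summable: "theta_coeff summable_on UNIV"
  by (rule summable_on_comparison_test[OF summable_on_int_power_abs[of "theta_coeff 1"]])
    (use theta_coeff_1_less theta_coeff_le in auto)

interpretation ell: even_summable theta_coeff
  by standard (auto simp: theta_summable)

interpretation hodd: even_summable odd_coeff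
proof
  show "odd_coeff summable_on UNIV"
    by (rule summable_on_comparison_test[OF theta_summable]) (auto simp: odd_coeff_def)
qed (auto simp: odd_coeff_def)

lemma ell_series: "ell.series \<xi> = of_real (ell \<xi>)"
  unfolding ell.series_real ell_def by (simp add: theta_coeff_def)

lemma hodd_nat: "hodd \<xi> = 2 * (\<Sum>\<^sub>\<infinity>n\<in>{1::nat..}. odd_coeff (int n) * cos (2 * pi * n * \<xi>))"
proof -
  have "(\<Sum>\<^sub>\<infinity>n\<in>{1::nat..}. odd_coeff (int n) * cos (2 * pi * n * \<xi>)) = (\<Sum>\<^sub>\<infinity>n\<in>{n. odd n}. theta_coeff (int n) * cos (2 * pi * n * \<xi>))"
    by (rule infsum_cong_neutral) (auto simp: odd_coeff_def elim: oddE)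
  also have "\<dots> = (\<Sum>\<^sub>\<infinity>k. exp (- (pi\<^sup>2 * (2 * real k + 1)\<^sup>2 / \<gamma>\<^sup>2)) * cos (2 * (2 * real k + 1) * pi * \<xi>))"
    by (rule infsum_reindex_bij_witness[where i = "\<lambda>k. 2 * k + 1" and j = "\<lambda>n. n div 2"])
      (auto simp: theta_coeff_def mult_ac add.commute elim!: oddE)
  finally show ?thesis by (simp add: hodd_def)
qed

lemma hodd_series: "hodd.series \<xi> = of_real (hodd \<xi>)"
  unfolding hodd.series_real hodd_nat by (simp add: odd_coeff_def)

lemma ell_nat: "ell \<xi> = 1 + 2 * (\<Sum>\<^sub>\<infinity>n\<in>{1::nat..}. theta_coeff (int n) * cos (2 * pi * n * \<xi>))"
  by (simp add: ell_def theta_coeff_def)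

lemma ell_measurable [measurable]: "ell \<in> borel_measurable borel"
proof -
  have "(\<lambda>\<xi>. Re (ell.series \<xi>)) \<in> borel_measurable borel" by measurable
  then show ?thesis by (simp add: ell_series)
qed

lemma hodd_measurable [measurable]: "hodd \<in> borel_measurable borel"
proof -
  have "(\<lambda>\<xi>. Re (hodd.series \<xi>)) \<in> borel_measurable borel" by measurable
  then show ?thesis by (simp add: hodd_series)
qed

text \<open>On the circle - \<xi> is 1 - \<xi>, so g is f reflected and conjugated. The equation for
  g is the reflected equation for f, and this symmetry ensures that it has the same coefficients a
  and b.\<close>

lemma ell_reflect: "ell (1 - \<xi>) = ell \<xi>" and hodd_reflect: "hodd (1 - \<xi>) = hodd \<xi>"
proof -
  have "cos (2 * pi * real n * (1 - \<xi>)) = cos (2 * pi * real n * \<xi>)" for n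
  proof -
    have "2 * pi * real n * (1 - \<xi>) = - (2 * pi * real n * \<xi>) + 2 * pi * real n" by (simp add: algebra_simps)
    then have "cis (2 * pi * real n * (1 - \<xi>)) = cis (- (2 * pi * real n * \<xi>))"
      using cis_multiple_2pi[of "real n"] by (metis Ints_of_nat cis_mult mult.right_neutral)
    then show ?thesis by (metis cis.sel(1) cos_minus)
  qed
  then show "ell (1 - \<xi>) = ell \<xi>" "hodd (1 - \<xi>) = hodd \<xi>"
    unfolding ell_nat hodd_nat by simp_all
qed

lemma coeff_a_reflect: "coeff_a (1 - \<xi>) = coeff_a \<xi>" and coeff_b_reflect: "coeff_b (1 - \<xi>) = coeff_b \<xi>"
  by (simp_all add: coeff_a_def coeff_b_def ell_reflect hodd_reflect)

lemma coeff_a_measurable [measurable]: "coeff_a \<in> borel_measurable borel"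
  unfolding coeff_a_def[abs_def] by measurable

lemma coeff_b_measurable [measurable]: "coeff_b \<in> borel_measurable borel"
  unfolding coeff_b_def[abs_def] by measurable

lemma mu_measurable [measurable]: "\<mu> \<in> borel_measurable borel"
  unfolding \<mu>_def[abs_def] by measurable

subsection \<open>Positivity of the symbol\<close>

lemma abs_sin_nat_mult_le: "\<bar>sin (real n * t)\<bar> \<le> real n * \<bar>sin t\<bar>"
proof (induction n)
  case (Suc n)
  have "\<bar>sin (real (Suc n) * t)\<bar> = \<bar>sin (real n * t) * cos t + cos (real n * t) * sin t\<bar>"
    by (simp add: distrib_right sin_add algebra_simps)
  also have "\<dots> \<le> \<bar>sin (real n * t)\<bar> * 1 + 1 * \<bar>sin t\<bar>"
    by (intro order_trans[OF abs_triangle_ineq] add_mono) (auto simp: abs_mult intro!: mult_left_le mult_left_le_one_le)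
  finally show ?case using Suc.IH by (simp add: algebra_simps)
qed simp

text \<open>Half-angle form of \<open>abs_sin_nat_mult_le\<close>. It compares every harmonic with
  the first one uniformly in \<xi>, in particular near the endpoints, where both sides
  vanish.\<close>

lemma one_minus_cos_nat_mult_le: "1 - cos (real n * x) \<le> (real n)\<^sup>2 * (1 - cos x)"
proof -
  have c: "1 - cos y = 2 * \<bar>sin (y / 2)\<bar>\<^sup>2" for y :: real
    using cos_double_sin[of "y / 2"] by simp
  have "\<bar>sin (real n * (x / 2))\<bar>\<^sup>2 \<le> (real n * \<bar>sin (x / 2)\<bar>)\<^sup>2"
    by (intro power_mono abs_sin_nat_mult_le) simp
  then show ?thesis
    unfolding c by (simp add: power_mult_distrib)
qed

text \<open>With q = \<open>theta_coeff 1\<close> < 1/10 the coefficient is q^(n^2). One factor q is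
  kept for comparison with the first odd term; the factor n^2 is absorbed by n^2 \<le> 2^(n^2 - 1),
  which leaves 5 (1/5)^(n^2), and n^2 \<ge> 2 n gives the geometric form.\<close>

lemma even_theta_coeff_bound:
  assumes "even n" "1 \<le> n"
  shows "theta_coeff (int n) * (real n)\<^sup>2 \<le> theta_coeff 1 * 5 * (1 / 25) ^ n"
proof -
  have n: "2 \<le> n" using assms by presburger
  define m where "m = n\<^sup>2 - 1"
  have "n * 2 \<le> n * n" using n by (intro mult_left_mono) auto
  then have m: "n\<^sup>2 = Suc m" "n * 2 \<le> Suc m" using n by (auto simp: m_def power2_eq_square)
  have "theta_coeff (int n) = theta_coeff 1 ^ Suc m"
    unfolding theta_coeff_power[of "int n"] m(1)[symmetric] by (simp add: nat_power_eq)
  then have "theta_coeff (int n) * (real n)\<^sup>2 = theta_coeff 1 * (theta_coeff 1 ^ m * real (Suc m))"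
    using m(1) by (metis mult.assoc of_nat_power power_Suc)
  also have "theta_coeff 1 ^ m * real (Suc m) \<le> (1 / 10) ^ m * 2 ^ m"
  proof (intro mult_mono power_mono)
    have "Suc m \<le> 2 ^ m" by (induction m) auto
    then show "real (Suc m) \<le> 2 ^ m" by (metis of_nat_le_iff of_nat_numeral of_nat_power)
  qed (use theta_coeff_1_less in auto)
  also have "(1 / 10) ^ m * 2 ^ m = 5 * (1 / 5 :: real) ^ Suc m"
    by (simp flip: power_mult_distrib)
  also have "(1 / 5 :: real) ^ Suc m \<le> (1 / 5) ^ (2 * n)"
    using m(2) by (intro power_decreasing) auto
  also have "(1 / 5 :: real) ^ (2 * n) = (1 / 25) ^ n"
    by (simp add: power_mult power2_eq_square)
  finally show ?thesis by simp
qed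

lemma (in even_summable) series_drop:
  "((\<lambda>n::nat. w (int n) * (1 - cos (2 * pi * n * \<xi>))) has_sum
    ((\<Sum>\<^sub>\<infinity>n\<in>{1::nat..}. w (int n) * cos (2 * pi * n * 0)) - (\<Sum>\<^sub>\<infinity>n\<in>{1::nat..}. w (int n) * cos (2 * pi * n * \<xi>)))) {1..}"
  using has_sum_add[OF has_sum_infsum[OF cos_summable[of 0]] has_sum_cmult_right[OF has_sum_infsum[OF cos_summable[of \<xi>]], of "-1"]]
  by (simp add: algebra_simps)

lemma ell_drop: "((\<lambda>n::nat. theta_coeff (int n) * (1 - cos (2 * pi * n * \<xi>))) has_sum ((ell 0 - ell \<xi>) / 2)) {1..}"
  using ell.series_drop[of \<xi>] by (simp add: ell_nat diff_divide_distrib)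

lemma hodd_drop: "((\<lambda>n::nat. odd_coeff (int n) * (1 - cos (2 * pi * n * \<xi>))) has_sum ((hodd 0 - hodd \<xi>) / 2)) {1..}"
  using hodd.series_drop[of \<xi>] by (simp add: hodd_nat diff_divide_distrib)

lemma hodd_drop_lower: "2 * theta_coeff 1 * (1 - cos (2 * pi * \<xi>)) \<le> hodd 0 - hodd \<xi>"
  using finite_sum_le_has_sum[OF hodd_drop[of \<xi>], of "{1}"] by (simp add: odd_coeff_def)

lemma hodd_le_ell_drop: "hodd 0 - hodd \<xi> \<le> ell 0 - ell \<xi>"
  using has_sum_mono[OF hodd_drop[of \<xi>] ell_drop[of \<xi>]] by (simp add: odd_coeff_def mult_right_mono)

text \<open>The two drops differ by the even harmonics alone, which are at most 5 (1/25)^n times the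
  first odd term. The geometric sum from n = 1 is 1/24, and doubling 5/24 gives 5/12.\<close>

lemma ell_drop_upper: "ell 0 - ell \<xi> \<le> hodd 0 - hodd \<xi> + 5 / 12 * theta_coeff 1 * (1 - cos (2 * pi * \<xi>))"
proof -
  define s where "s = 1 - cos (2 * pi * \<xi>)"
  have s: "0 \<le> s" by (simp add: s_def)
  have "((\<lambda>n. (1 / 25 :: real) ^ n) has_sum (1 / 24)) {1..}"
    using has_sum_geometric_from_1[of "1 / 25 :: real"] by simp
  then have G: "((\<lambda>n. theta_coeff 1 * 5 * s * (1 / 25) ^ n) has_sum (theta_coeff 1 * 5 * s * (1 / 24))) {1..}"
    by (rule has_sum_cmult_right)
  have "(ell 0 - ell \<xi>) / 2 \<le> (hodd 0 - hodd \<xi>) / 2 + theta_coeff 1 * 5 * s * (1 / 24)"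
  proof (rule has_sum_mono[OF ell_drop[of \<xi>] has_sum_add[OF hodd_drop[of \<xi>] G]])
    fix n :: nat assume n: "n \<in> {1..}"
    show "theta_coeff (int n) * (1 - cos (2 * pi * n * \<xi>)) \<le> odd_coeff (int n) * (1 - cos (2 * pi * n * \<xi>)) + theta_coeff 1 * 5 * s * (1 / 25) ^ n"
    proof (cases "even n")
      case True
      have "1 - cos (2 * pi * n * \<xi>) \<le> (real n)\<^sup>2 * s"
        using one_minus_cos_nat_mult_le[of n "2 * pi * \<xi>"] by (simp add: s_def mult_ac)
      then have "theta_coeff (int n) * (1 - cos (2 * pi * n * \<xi>)) \<le> theta_coeff (int n) * (real n)\<^sup>2 * s"
        unfolding mult.assoc by (intro mult_left_mono) auto
      also have "\<dots> \<le> theta_coeff 1 * 5 * (1 / 25) ^ n * s"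
        using even_theta_coeff_bound[OF True] n s by (intro mult_right_mono) auto
      finally show ?thesis using True by (simp add: odd_coeff_def mult_ac)
    qed (use s in \<open>simp add: odd_coeff_def\<close>)
  qed
  then show ?thesis unfolding s_def[symmetric] by (simp add: field_simps)
qed

section \<open>Bounds for a - b and a + b\<close>

lemma coeff_a_kappa: "coeff_a \<xi> = 2 * \<kappa> * (ell \<xi> * ell 0 - 2 * hodd \<xi> * hodd 0) - lam"
  and coeff_b_kappa: "coeff_b \<xi> = \<kappa> * ((ell \<xi>)\<^sup>2 - 2 * (hodd \<xi>)\<^sup>2)"
  and lam_kappa: "lam = \<kappa> * ((ell 0)\<^sup>2 - 2 * (hodd 0)\<^sup>2)"
  by (simp_all add: coeff_a_def coeff_b_def lam_def \<kappa>_def)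

lemma coeff_diff_eq: "coeff_a \<xi> - coeff_b \<xi> = \<kappa> * (2 * (hodd 0 - hodd \<xi>)\<^sup>2 - (ell 0 - ell \<xi>)\<^sup>2)"
  unfolding coeff_a_kappa coeff_b_kappa lam_kappa by (simp add: algebra_simps power2_eq_square)

text \<open>Completing squares in l and in h separately reduces the bounds for a + b to l being near
  1 and h near 0.\<close>

lemma coeff_sum_eq:
  "coeff_a \<xi> + coeff_b \<xi> = \<kappa> * ((ell \<xi> + ell 0)\<^sup>2 - 2 * (ell 0)\<^sup>2 - 2 * (hodd \<xi> + hodd 0)\<^sup>2 + 4 * (hodd 0)\<^sup>2)"
  unfolding coeff_a_kappa coeff_b_kappa lam_kappa by (simp add: algebra_simps power2_eq_square)

text \<open>Since 2 s \<le> H, the even harmonics add at most (5/24) H, so L \<le> (29/24) H. What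
  matters about the rounded constant 5/4 is that its square stays below 2.\<close>

lemma ell_drop_square_le: "(ell 0 - ell \<xi>)\<^sup>2 \<le> (5 / 4 * (hodd 0 - hodd \<xi>))\<^sup>2"
proof -
  define s where "s = theta_coeff 1 * (1 - cos (2 * pi * \<xi>))"
  define H L where "H = hodd 0 - hodd \<xi>" and "L = ell 0 - ell \<xi>"
  have s: "0 \<le> s" "2 * s \<le> H" "H \<le> L" "L \<le> H + 5 / 12 * s"
    using hodd_drop_lower[of \<xi>] ell_drop_upper[of \<xi>] hodd_le_ell_drop[of \<xi>] by (auto simp: s_def H_def L_def)
  have "L \<le> 5 / 4 * H" "0 \<le> L" using s by linarith+
  then show ?thesis
    unfolding H_def[symmetric] L_def[symmetric] by (rule power_mono)
qed

text \<open>The margin is 2 - 25/16 = 7/16, rounded down to 1/4.\<close>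

lemma coeff_diff_ge: "\<kappa> * (hodd 0 - hodd \<xi>)\<^sup>2 / 4 \<le> coeff_a \<xi> - coeff_b \<xi>"
proof -
  have "(hodd 0 - hodd \<xi>)\<^sup>2 / 4 \<le> 2 * (hodd 0 - hodd \<xi>)\<^sup>2 - (ell 0 - ell \<xi>)\<^sup>2"
  proof -
    have "(ell 0 - ell \<xi>)\<^sup>2 \<le> 25 / 16 * (hodd 0 - hodd \<xi>)\<^sup>2"
      using ell_drop_square_le[of \<xi>] unfolding power_mult_distrib by (simp add: power_divide)
    then show ?thesis using zero_le_power2[of "hodd 0 - hodd \<xi>"] by linarith
  qed
  from mult_left_mono[OF this, of \<kappa>] show ?thesis
    unfolding coeff_diff_eq by (simp add: less_imp_le)
qed

lemma coeff_diff_nonneg: "coeff_b \<xi> \<le> coeff_a \<xi>"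
proof -
  have "0 \<le> \<kappa> * (hodd 0 - hodd \<xi>)\<^sup>2 / 4" by (simp add: less_imp_le)
  then show ?thesis using coeff_diff_ge[of \<xi>] by linarith
qed

lemma coeff_diff_pos:
  assumes "0 < \<xi>" "\<xi> < 1"
  shows "coeff_b \<xi> < coeff_a \<xi>"
proof -
  have "cos (2 * pi * \<xi>) \<noteq> 1"
  proof
    assume "cos (2 * pi * \<xi>) = 1"
    then obtain n :: int where "2 * pi * \<xi> = real_of_int n * 2 * pi"
      using cos_one_2pi_int by blast
    then have "\<xi> = n" by simp
    then show False using assms by auto
  qed
  then have "cos (2 * pi * \<xi>) < 1"
    using cos_le_one[of "2 * pi * \<xi>"] by linarith
  then have "0 < 2 * theta_coeff 1 * (1 - cos (2 * pi * \<xi>))" by simp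
  then have "0 < hodd 0 - hodd \<xi>"
    using hodd_drop_lower[of \<xi>] by linarith
  then have "0 < \<kappa> * (hodd 0 - hodd \<xi>)\<^sup>2 / 4" by simp
  then show ?thesis using coeff_diff_ge[of \<xi>] by linarith
qed

text \<open>A geometric series of ratio 1/10. Doubled, it is the source of the bounds 11/9 for
  \<open>ell 0\<close> and 2/9 for \<open>hodd\<close>.\<close>

lemma theta_sum_bound: "(\<Sum>\<^sub>\<infinity>n\<in>{1::nat..}. theta_coeff (int n)) \<le> 1 / 9"
proof -
  have "((\<lambda>n. (1 / 10 :: real) ^ n) has_sum (1 / 9)) {1..}"
    using has_sum_geometric_from_1[of "1 / 10 :: real"] by simp
  moreover have "theta_coeff (int n) \<le> (1 / 10) ^ n" for n
    using theta_coeff_le[of "int n"] power_mono[of "theta_coeff 1" "1 / 10" n] theta_coeff_1_less by simp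
  ultimately show ?thesis
    by (intro has_sum_mono[OF has_sum_infsum[OF ell.w_summable_nat]])
qed

lemma abs_cos_series_le:
  assumes "even_summable w" "\<And>k. w k \<le> theta_coeff k"
  shows "\<bar>\<Sum>\<^sub>\<infinity>n\<in>{1::nat..}. w (int n) * cos (2 * pi * n * \<xi>)\<bar> \<le> (\<Sum>\<^sub>\<infinity>n\<in>{1::nat..}. theta_coeff (int n))"
proof -
  interpret even_summable w by fact
  have "norm (w (int n) * cos (2 * pi * n * \<xi>)) \<le> theta_coeff (int n)" for n :: nat
    using assms(2)[of "int n"] mult_mono[OF assms(2)[of "int n"] abs_cos_le_one[of "2 * pi * n * \<xi>"]]
    by (simp add: abs_mult w_nonneg)
  then have "norm (\<Sum>\<^sub>\<infinity>n\<in>{1::nat..}. w (int n) * cos (2 * pi * n * \<xi>)) \<le> (\<Sum>\<^sub>\<infinity>n\<in>{1::nat..}. theta_coeff (int n))"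
    by (intro norm_infsum_le[OF has_sum_infsum[OF cos_summable] has_sum_infsum[OF ell.w_summable_nat]])
  then show ?thesis by simp
qed

lemma ell_bounds: "\<bar>ell \<xi> - 1\<bar> \<le> ell 0 - 1" "ell 0 \<le> 11 / 9"
  using abs_cos_series_le[OF ell.even_summable_axioms order_refl, of \<xi>] theta_sum_bound unfolding ell_nat by auto

lemma hodd_bound: "\<bar>hodd \<xi>\<bar> \<le> 2 / 9"
proof -
  have "odd_coeff k \<le> theta_coeff k" for k by (simp add: odd_coeff_def)
  from abs_cos_series_le[OF hodd.even_summable_axioms this, of \<xi>] theta_sum_bound
  show ?thesis unfolding hodd_nat abs_mult by linarith
qed

text \<open>In multiples of 1/81 the lower bound is 324 - 242 - 32 = 50, which exceeds 81/2, and the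
  upper bound is 484 + 16 = 500, below 7 * 81. The lower one uses l(\<xi>) + l(0) \<ge> 2, that is
  |l(\<xi>) - 1| \<le> l(0) - 1.\<close>

lemma coeff_sum_bounds: "\<kappa> / 2 \<le> coeff_a \<xi> + coeff_b \<xi>" "coeff_a \<xi> + coeff_b \<xi> \<le> 7 * \<kappa>"
proof -
  define E where "E = (ell \<xi> + ell 0)\<^sup>2 - 2 * (ell 0)\<^sup>2 - 2 * (hodd \<xi> + hodd 0)\<^sup>2 + 4 * (hodd 0)\<^sup>2"
  have l: "2 \<le> ell \<xi> + ell 0" "ell \<xi> + ell 0 \<le> 22 / 9" "0 \<le> ell 0" "ell 0 \<le> 11 / 9"
    using ell_bounds(1)[of \<xi>] ell_bounds(2) by (auto simp: abs_le_iff)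
  have h: "\<bar>hodd \<xi> + hodd 0\<bar> \<le> 4 / 9" "\<bar>hodd 0\<bar> \<le> 2 / 9"
    using hodd_bound[of \<xi>] hodd_bound[of 0] by linarith+
  have "4 \<le> (ell \<xi> + ell 0)\<^sup>2" "(ell \<xi> + ell 0)\<^sup>2 \<le> 484 / 81" "(ell 0)\<^sup>2 \<le> 121 / 81"
    using power_mono[OF l(1), of 2] power_mono[OF l(2), of 2] power_mono[OF l(4,3), of 2] l by (simp_all add: power_divide)
  moreover have "(hodd \<xi> + hodd 0)\<^sup>2 \<le> 16 / 81" "(hodd 0)\<^sup>2 \<le> 4 / 81"
    using power_mono[OF h(1), of 2] power_mono[OF h(2), of 2] by (simp_all add: power_divide)
  moreover have "0 \<le> (hodd \<xi> + hodd 0)\<^sup>2" "0 \<le> (hodd 0)\<^sup>2" "0 \<le> (ell 0)\<^sup>2" by auto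
  ultimately have E: "1 / 2 \<le> E" "E \<le> 7"
    unfolding E_def by linarith+
  show "\<kappa> / 2 \<le> coeff_a \<xi> + coeff_b \<xi>" "coeff_a \<xi> + coeff_b \<xi> \<le> 7 * \<kappa>"
    using E mult_left_mono[OF E(1), of \<kappa>] mult_left_mono[OF E(2), of \<kappa>] unfolding coeff_sum_eq E_def[symmetric]
    by (simp_all add: less_imp_le mult.commute)
qed

lemma coeff_diff_le: "coeff_a \<xi> - coeff_b \<xi> \<le> \<kappa>"
proof -
  have "\<bar>hodd 0 - hodd \<xi>\<bar> \<le> 4 / 9"
    using hodd_bound[of \<xi>] hodd_bound[of 0] by linarith
  then have "(hodd 0 - hodd \<xi>)\<^sup>2 \<le> (4 / 9)\<^sup>2"
    using abs_le_square_iff[of "hodd 0 - hodd \<xi>" "4 / 9"] by simp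
  then have "(hodd 0 - hodd \<xi>)\<^sup>2 \<le> 16 / 81" by (simp add: power_divide)
  then have "2 * (hodd 0 - hodd \<xi>)\<^sup>2 - (ell 0 - ell \<xi>)\<^sup>2 \<le> 1"
    using zero_le_power2[of "ell 0 - ell \<xi>"] by linarith
  then show ?thesis
    unfolding coeff_diff_eq using mult_left_mono[of _ 1 \<kappa>] by (simp add: less_imp_le)
qed

subsection \<open>The equation on the Fourier side\<close>

lemma LLL_tilde_measurable: "u \<in> LLL_tilde \<Longrightarrow> u \<in> borel_measurable borel"
proof -
  assume "u \<in> LLL_tilde"
  then obtain F where F: "F holomorphic_on UNIV" "\<And>z. u z = exp (- of_real ((norm z)\<^sup>2 / 2)) * F z"
    by (auto simp: LLL_tilde_def)
  have "continuous_on UNIV (\<lambda>z. exp (- of_real ((norm z)\<^sup>2 / 2)) * F z)"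
    by (intro continuous_intros holomorphic_on_imp_continuous_on F) auto
  then show ?thesis
    unfolding F(2)[abs_def] by (rule borel_measurable_continuous_onI)
qed

lemma LLL_periodic_quasi_periodic:
  assumes "u \<in> LLL_periodic \<gamma>"
  shows "quasi_periodic u"
  unfolding quasi_periodic_def
proof
  fix z
  have "magnetic_translation (of_real \<gamma>) u z = u z"
    using assms by (simp add: LLL_periodic_def)
  then have "exp ((of_real \<gamma> * cnj z - of_real \<gamma> * z) / 2) * u (z + of_real \<gamma>) = u z"
    by (simp add: magnetic_translation_def)
  moreover have "exp ((of_real \<gamma> * cnj z - of_real \<gamma> * z) / 2) = cis (- (\<gamma> * Im z))"
    unfolding cis_conv_exp by (rule arg_cong[where f = exp]) (simp add: complex_eq_iff)
  ultimately have "cis (- (\<gamma> * Im z)) * u (z + of_real \<gamma>) = u z" by simp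
  then have "cis (\<gamma> * Im z) * (cis (- (\<gamma> * Im z)) * u (z + of_real \<gamma>)) = cis (\<gamma> * Im z) * u z" by simp
  then show "u (z + of_real \<gamma>) = cis (\<gamma> * Im z) * u z"
    by (simp add: cis_mult flip: mult.assoc)
qed

lemma quasi_periodic_norm_periodic:
  assumes "quasi_periodic u"
  shows "norm (u (Complex (x + of_int n * \<gamma>) y)) = norm (u (Complex x y))"
proof -
  have per: "norm (u (Complex (x + \<gamma>) y)) = norm (u (Complex x y))" for x
  proof -
    have "Complex (x + \<gamma>) y = Complex x y + of_real \<gamma>" by (simp add: complex_eq_iff)
    then show ?thesis using assms by (simp add: quasi_periodic_def norm_mult)
  qed
  interpret periodic_fun_simple "\<lambda>x. norm (u (Complex x y))" \<gamma>
    by standard (rule per)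
  show ?thesis by (rule plus_of_int)
qed

lemma power_le_exp:
  fixes x :: real
  assumes "0 \<le> x" "0 < m"
  shows "x ^ m \<le> real m ^ m * exp x"
proof -
  have "x / real m \<le> exp (x / real m)"
    using exp_ge_add_one_self[of "x / real m"] by linarith
  then have "(x / real m) ^ m \<le> exp (x / real m) ^ m"
    using assms by (intro power_mono) auto
  also have "exp (x / real m) ^ m = exp x"
    using assms by (simp flip: exp_of_nat_mult)
  finally show ?thesis
    using assms by (simp add: power_divide field_simps)
qed

text \<open>The modulus has period \<gamma> in x, so the real part may be taken in [0, \<gamma>].
  Polynomial growth in |z| then becomes growth in |Im z| alone, and the exponential absorbs every
  exponent M.\<close>

lemma LLL_periodic_bound:
  assumes "u \<in> LLL_periodic \<gamma>"
  obtains C where "\<And>z. norm (u z) \<le> C * exp \<bar>Im z\<bar>"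
proof -
  obtain M C where C: "\<And>z. norm (u z) \<le> C * sqrt (1 + (norm z)\<^sup>2) powr M"
    using assms by (auto simp: LLL_periodic_def LLL_tilde_def)
  \<comment> \<open>A natural exponent above M; the successor keeps it positive, as
    \<open>power_le_exp\<close> requires.\<close>
  define m where "m = Suc (nat \<lceil>M\<rceil>)"
  have m: "M \<le> real m" "0 < m"
    unfolding m_def by linarith+
  have "norm (u z) \<le> (\<bar>C\<bar> * real m ^ m * exp (1 + \<gamma>)) * exp \<bar>Im z\<bar>" for z
  proof -
    define n where "n = - \<lfloor>Re z / \<gamma>\<rfloor>"
    define x where "x = Re z + of_int n * \<gamma>"
    have x: "0 \<le> x" "x \<le> \<gamma>"
      using floor_divide_lower[OF gamma_pos(1), of "Re z"] floor_divide_upper[OF gamma_pos(1), of "Re z"]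
      by (simp_all add: x_def n_def algebra_simps)
    define b where "b = sqrt (1 + (norm (Complex x (Im z)))\<^sup>2)"
    have b1: "1 \<le> b" by (simp add: b_def)
    have "1 + (x\<^sup>2 + (Im z)\<^sup>2) \<le> (1 + x + \<bar>Im z\<bar>)\<^sup>2"
    proof -
      have "(1 + x + \<bar>Im z\<bar>)\<^sup>2 = 1 + (x\<^sup>2 + (Im z)\<^sup>2) + 2 * (x + \<bar>Im z\<bar> + x * \<bar>Im z\<bar>)"
        by (simp add: power2_eq_square algebra_simps)
      then show ?thesis using x by simp
    qed
    then have "sqrt (1 + (x\<^sup>2 + (Im z)\<^sup>2)) \<le> 1 + x + \<bar>Im z\<bar>"
      using x by (intro real_le_lsqrt) auto
    then have b2: "b \<le> 1 + \<gamma> + \<bar>Im z\<bar>"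
      unfolding b_def cmod_power2 complex.sel using x by linarith
    have "norm (u z) = norm (u (Complex x (Im z)))"
      unfolding x_def quasi_periodic_norm_periodic[OF LLL_periodic_quasi_periodic[OF assms]] by simp
    also have "\<dots> \<le> \<bar>C\<bar> * b powr M"
      using C[of "Complex x (Im z)"] unfolding b_def[symmetric] by (rule order_trans) (auto intro: mult_right_mono)
    finally have uC: "norm (u z) \<le> \<bar>C\<bar> * b powr M" .
    have "b powr M \<le> b powr real m"
      using b1 m by (intro powr_mono) auto
    also have "b powr real m = b ^ m"
      using b1 by (simp add: powr_realpow)
    also have "b ^ m \<le> (1 + \<gamma> + \<bar>Im z\<bar>) ^ m"
      using b1 b2 by (intro power_mono) auto
    also have "\<dots> \<le> real m ^ m * exp (1 + \<gamma> + \<bar>Im z\<bar>)"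
      using m by (intro power_le_exp) (auto simp: less_imp_le intro!: add_nonneg_nonneg)
    finally have "\<bar>C\<bar> * b powr M \<le> \<bar>C\<bar> * (real m ^ m * exp (1 + \<gamma> + \<bar>Im z\<bar>))"
      by (rule mult_left_mono) simp
    then show ?thesis
      using uC by (simp add: exp_add mult_ac)
  qed
  then show ?thesis by (rule that)
qed

lemma psi_quasi_periodic: "\<psi> k (z + of_real \<gamma>) = cis (\<gamma> * Im z) * \<psi> k z"
proof -
  have z: "z + of_real \<gamma> = Complex (Re z + \<gamma>) (Im z)" "z = Complex (Re z) (Im z)"
    by (simp_all add: complex_eq_iff)
  have "cis (2 * pi * k * (Re z + \<gamma>) / \<gamma> + (Re z + \<gamma>) * Im z - pi * (real_of_int k)\<^sup>2 / 2)
     = cis (2 * pi * k * Re z / \<gamma> + Re z * Im z - pi * (real_of_int k)\<^sup>2 / 2) * cis (\<gamma> * Im z) * cis (2 * pi * k)"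
    unfolding cis_mult by (rule arg_cong[where f = cis]) (simp add: distrib_left distrib_right add_divide_distrib)
  moreover have "cis (2 * pi * k) = 1"
    using cis_multiple_2pi[of "of_int k"] by simp
  ultimately have "cis (2 * pi * k * (Re z + \<gamma>) / \<gamma> + (Re z + \<gamma>) * Im z - pi * (real_of_int k)\<^sup>2 / 2)
     = cis (2 * pi * k * Re z / \<gamma> + Re z * Im z - pi * (real_of_int k)\<^sup>2 / 2) * cis (\<gamma> * Im z)"
    by simp
  then have "\<psi> k (Complex (Re z + \<gamma>) (Im z)) = cis (\<gamma> * Im z) * \<psi> k (Complex (Re z) (Im z))"
    unfolding psi_Complex by (simp add: mult_ac)
  then show ?thesis unfolding z(1) by simp
qed

lemma Psi0_quasi_periodic: "\<Psi>\<^sub>0 (z + of_real \<gamma>) = cis (\<gamma> * Im z) * \<Psi>\<^sub>0 z"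
  unfolding \<Psi>\<^sub>0_def psi_quasi_periodic by (rule infsum_cmult_right')

definition linearised_potential :: "(complex \<Rightarrow> complex) \<Rightarrow> complex \<Rightarrow> complex" where
  "linearised_potential u w = 2 * of_real ((norm (\<Psi>\<^sub>0 w))\<^sup>2) * u w + (\<Psi>\<^sub>0 w)\<^sup>2 * cnj (u w)"

text \<open>Phases are counted: the modulus of \<open>\<Psi>\<^sub>0\<close> contributes none, and
  its square contributes two, one of which is undone by the conjugate of u.\<close>

lemma linearised_potential_quasi_periodic:
  assumes "quasi_periodic u"
  shows "quasi_periodic (linearised_potential u)"
  unfolding quasi_periodic_def
proof
  fix z
  have u: "u (z + of_real \<gamma>) = cis (\<gamma> * Im z) * u z" using assms by (simp add: quasi_periodic_def)
  have "(cis (\<gamma> * Im z))\<^sup>2 * cnj (cis (\<gamma> * Im z)) = cis (\<gamma> * Im z)"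
    by (simp add: power2_eq_square cis_cnj cis_mult)
  then show "linearised_potential u (z + of_real \<gamma>) = cis (\<gamma> * Im z) * linearised_potential u z"
    unfolding linearised_potential_def u Psi0_quasi_periodic
    by (simp add: norm_mult power_mult_distrib distrib_left)
qed

lemma linearised_potential_measurable [measurable]:
  assumes [measurable]: "u \<in> borel_measurable borel"
  shows "linearised_potential u \<in> borel_measurable borel"
  unfolding linearised_potential_def[abs_def] by measurable

lemma linearised_potential_bound:
  assumes "\<And>z. norm (u z) \<le> C * exp \<bar>Im z\<bar>"
  obtains C' where "\<And>z. norm (linearised_potential u z) \<le> C' * exp \<bar>Im z\<bar>"
proof -
  obtain B where B: "\<And>z. norm (\<Psi>\<^sub>0 z) \<le> B" "0 \<le> B" using Psi0_bounded by metis
  have "norm (linearised_potential u z) \<le> (3 * B\<^sup>2 * C) * exp \<bar>Im z\<bar>" for z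
  proof -
    have b: "(norm (\<Psi>\<^sub>0 z))\<^sup>2 \<le> B\<^sup>2" using B by (intro power_mono) auto
    have "norm (linearised_potential u z) \<le> 2 * (norm (\<Psi>\<^sub>0 z))\<^sup>2 * norm (u z) + (norm (\<Psi>\<^sub>0 z))\<^sup>2 * norm (u z)"
      unfolding linearised_potential_def by (rule order_trans[OF norm_triangle_ineq]) (simp add: norm_mult norm_power)
    also have "\<dots> = 3 * ((norm (\<Psi>\<^sub>0 z))\<^sup>2 * norm (u z))" by simp
    also have "\<dots> \<le> 3 * (B\<^sup>2 * (C * exp \<bar>Im z\<bar>))"
      using b assms[of z] by (intro mult_left_mono mult_mono) auto
    finally show ?thesis by (simp add: mult_ac)
  qed
  then show ?thesis by (rule that)
qed

section \<open>Matrix elements of the linearised potential\<close>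

lemma has_sum_single:
  fixes F :: "int \<Rightarrow> complex"
  assumes "(F has_sum S) UNIV" "\<And>k. k \<noteq> k0 \<Longrightarrow> F k = 0"
  shows "S = F k0"
proof -
  have "(F has_sum F k0) UNIV"
    by (rule has_sum_finite_neutralI[of "{k0}"]) (use assms(2) in auto)
  then show ?thesis by (rule has_sum_unique[OF assms(1)])
qed

lemma strip_product_integrable:
  assumes "L2 (strip \<gamma>) u" "L2 (strip \<gamma>) w" "b \<in> borel_measurable borel" "\<And>z. norm (b z) \<le> K"
  shows "integrable (lebesgue_on (strip \<gamma>)) (\<lambda>z. b z * u z * cnj (w z))"
  by (rule L2_mult_cnj_integrable[OF L2_bounded_mult[OF assms(1) borel_measurable_lebesgue_on_borel[OF assms(3)] assms(4)] assms(2)])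

lemma L2_psi: "L2 (strip \<gamma>) (\<psi> n)"
  by (rule L2_orthonormal.L2_basis[OF psi_orthonormal])

lemma psi_bounded: "norm (\<psi> n z) \<le> amp"
  using norm_psi[of n "Re z" "Im z"] by (simp add: mult_left_le less_imp_le)

lemma ell_0_has_sum: "((\<lambda>q. complex_of_real (theta_coeff q)) has_sum of_real (ell 0)) UNIV"
  using ell.series_has_sum[of 0] by (simp add: ell_series)

lemma hodd_0_has_sum: "((\<lambda>q. complex_of_real (odd_coeff q)) has_sum of_real (hodd 0)) UNIV"
  using hodd.series_has_sum[of 0] by (simp add: hodd_series)

text \<open>The identity (-1)^(p q) = 1 - 2 [p odd] [q odd] splits the coupling into two products
  and produces the combination l^2 - 2 h^2 in all coefficients.\<close>

lemma parity_theta: "parity_sign p q * theta_coeff p * theta_coeff q = theta_coeff p * theta_coeff q - 2 * odd_coeff p * odd_coeff q"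
  by (simp add: parity_sign_def odd_coeff_def)

text \<open>Both factors \<open>\<Psi>\<^sub>0\<close> are expanded, one after the other. For a
  fixed index k in the outer sum only m + k - n survives in the inner one; the outer sum then runs
  over q = k - n and produces the values at 0 of the two theta series.\<close>

lemma Psi0_norm_square_matrix:
  "integral\<^sup>L (lebesgue_on (strip \<gamma>)) (\<lambda>z. \<psi> m z * of_real ((norm (\<Psi>\<^sub>0 z))\<^sup>2) * cnj (\<psi> n z))
    = of_real (\<kappa> * (theta_coeff (m - n) * ell 0 - 2 * odd_coeff (m - n) * hodd 0))"
proof -
  let ?j = "m - n"
  let ?M = "lebesgue_on (strip \<gamma>)"
  obtain B where B: "\<And>z. norm (\<Psi>\<^sub>0 z) \<le> B" "0 \<le> B" using Psi0_bounded by metis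
  have inner: "integral\<^sup>L ?M (\<lambda>z. \<psi> k z * (\<psi> m z * cnj (\<Psi>\<^sub>0 z) * cnj (\<psi> n z)))
     = of_real (\<kappa> * parity_sign ?j (k - n) * theta_coeff ?j * theta_coeff (k - n))" for k
  proof -
    \<comment> \<open>\<open>Psi0_integral_expand\<close> expands an unconjugated
      \<open>\<Psi>\<^sub>0\<close>, so the integral containing its conjugate is handled through the
      conjugate integral.\<close>
    have H: "integrable ?M (\<lambda>z. cnj (\<psi> k z) * \<psi> n z * cnj (\<psi> m z))"
      by (rule strip_product_integrable[OF L2_psi L2_psi, of _ amp]) (simp_all add: psi_bounded)
    have I: "integral\<^sup>L ?M (\<lambda>z. \<psi> k' z * (cnj (\<psi> k z) * \<psi> n z * cnj (\<psi> m z))) =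
        cnj (integral\<^sup>L ?M (\<lambda>z. \<psi> m z * \<psi> k z * cnj (\<psi> k' z) * cnj (\<psi> n z)))" for k'
      by (subst Bochner_Integration.integral_cnj[symmetric]) (simp add: mult_ac)
    have "integral\<^sup>L ?M (\<lambda>z. \<Psi>\<^sub>0 z * (cnj (\<psi> k z) * \<psi> n z * cnj (\<psi> m z))) =
       cnj (integral\<^sup>L ?M (\<lambda>z. \<psi> m z * \<psi> k z * cnj (\<psi> (m + k - n) z) * cnj (\<psi> n z)))"
      using has_sum_single[OF Psi0_integral_expand[OF H], of "m + k - n"] unfolding I psi_quartic by simp
    then have "cnj (integral\<^sup>L ?M (\<lambda>z. \<Psi>\<^sub>0 z * (cnj (\<psi> k z) * \<psi> n z * cnj (\<psi> m z)))) =
       of_real (\<kappa> * parity_sign ?j (k - n) * theta_coeff ?j * theta_coeff (k - n))"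
      unfolding psi_quartic by simp
    then show ?thesis
      by (subst (asm) Bochner_Integration.integral_cnj[symmetric]) (simp add: mult_ac)
  qed
  have "integrable ?M (\<lambda>z. cnj (\<Psi>\<^sub>0 z) * \<psi> m z * cnj (\<psi> n z))"
    by (rule strip_product_integrable[OF L2_psi L2_psi, of _ B]) (simp_all add: B)
  then have "integrable ?M (\<lambda>z. \<psi> m z * cnj (\<Psi>\<^sub>0 z) * cnj (\<psi> n z))"
    by (simp add: mult.commute)
  from Psi0_integral_expand[OF this]
  have S: "((\<lambda>k. of_real (\<kappa> * parity_sign ?j (k - n) * theta_coeff ?j * theta_coeff (k - n))) has_sum
      integral\<^sup>L ?M (\<lambda>z. \<Psi>\<^sub>0 z * (\<psi> m z * cnj (\<Psi>\<^sub>0 z) * cnj (\<psi> n z)))) UNIV"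
    unfolding inner .
  have "((\<lambda>q. of_real \<kappa> * (of_real (theta_coeff ?j) * of_real (theta_coeff q) + of_real (- 2 * odd_coeff ?j) * of_real (odd_coeff q)))
      has_sum (complex_of_real \<kappa> * (of_real (theta_coeff ?j) * of_real (ell 0) + of_real (- 2 * odd_coeff ?j) * of_real (hodd 0)))) UNIV"
    by (intro has_sum_cmult_right has_sum_add ell_0_has_sum hodd_0_has_sum)
  also have "(\<lambda>q. of_real \<kappa> * (of_real (theta_coeff ?j) * of_real (theta_coeff q) + of_real (- 2 * odd_coeff ?j) * of_real (odd_coeff q)))
     = (\<lambda>q. complex_of_real (\<kappa> * parity_sign ?j q * theta_coeff ?j * theta_coeff q))"
  proof
    fix q
    have "\<kappa> * parity_sign ?j q * theta_coeff ?j * theta_coeff q = \<kappa> * (theta_coeff ?j * theta_coeff q - 2 * odd_coeff ?j * odd_coeff q)"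
      unfolding parity_theta[symmetric] by (simp only: mult.assoc)
    from this show "of_real \<kappa> * (of_real (theta_coeff ?j) * of_real (theta_coeff q) + of_real (- 2 * odd_coeff ?j) * of_real (odd_coeff q))
      = complex_of_real (\<kappa> * parity_sign ?j q * theta_coeff ?j * theta_coeff q)"
      by (simp only:) simp
  qed
  finally have T: "((\<lambda>k. of_real (\<kappa> * parity_sign ?j (k - n) * theta_coeff ?j * theta_coeff (k - n))) has_sum
      (complex_of_real \<kappa> * (of_real (theta_coeff ?j) * of_real (ell 0) + of_real (- 2 * odd_coeff ?j) * of_real (hodd 0)))) UNIV"
    by (subst has_sum_reindex_bij_witness[where i = "\<lambda>q. q + n" and j = "\<lambda>k. k - n" and T = UNIV
      and h = "\<lambda>q. complex_of_real (\<kappa> * parity_sign ?j q * theta_coeff ?j * theta_coeff q)"]) auto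
  have eq: "\<psi> m z * of_real ((norm (\<Psi>\<^sub>0 z))\<^sup>2) * cnj (\<psi> n z) = \<Psi>\<^sub>0 z * (\<psi> m z * cnj (\<Psi>\<^sub>0 z) * cnj (\<psi> n z))" for z
    unfolding complex_norm_square by (simp only: mult_ac)
  show ?thesis
    unfolding eq has_sum_unique[OF S T] by simp
qed

text \<open>The inner expansion leaves only the index m + n - k. The sum over k is an
  autocorrelation and is left unevaluated: up to a change of sign of its index it has the same terms
  as the one in \<open>coeff_b_matrix\<close>, and uniqueness of sums then equates the two
  integrals.\<close>

lemma Psi0_square_matrix:
  "((\<lambda>k. of_real (\<kappa> * (theta_coeff k * theta_coeff (k + (m - n)) - 2 * odd_coeff k * odd_coeff (k + (m - n))))) has_sum
    integral\<^sup>L (lebesgue_on (strip \<gamma>)) (\<lambda>z. cnj (\<psi> m z) * (\<Psi>\<^sub>0 z)\<^sup>2 * cnj (\<psi> n z))) UNIV"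
proof -
  let ?M = "lebesgue_on (strip \<gamma>)"
  obtain B where B: "\<And>z. norm (\<Psi>\<^sub>0 z) \<le> B" "0 \<le> B" using Psi0_bounded by metis
  have inner: "integral\<^sup>L ?M (\<lambda>z. \<psi> k z * (\<Psi>\<^sub>0 z * cnj (\<psi> m z) * cnj (\<psi> n z)))
     = of_real (\<kappa> * parity_sign (m - k) (k - n) * theta_coeff (m - k) * theta_coeff (k - n))" for k
  proof -
    have H: "integrable ?M (\<lambda>z. \<psi> k z * cnj (\<psi> m z) * cnj (\<psi> n z))"
      by (rule strip_product_integrable[OF L2_cnj[OF L2_psi] L2_psi, of _ amp]) (simp_all add: psi_bounded)
    have I: "integral\<^sup>L ?M (\<lambda>z. \<psi> k' z * (\<psi> k z * cnj (\<psi> m z) * cnj (\<psi> n z))) =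
        integral\<^sup>L ?M (\<lambda>z. \<psi> k' z * \<psi> k z * cnj (\<psi> m z) * cnj (\<psi> n z))" for k'
      by (simp add: mult_ac)
    have "integral\<^sup>L ?M (\<lambda>z. \<Psi>\<^sub>0 z * (\<psi> k z * cnj (\<psi> m z) * cnj (\<psi> n z))) =
       integral\<^sup>L ?M (\<lambda>z. \<psi> (m + n - k) z * \<psi> k z * cnj (\<psi> m z) * cnj (\<psi> n z))"
      using has_sum_single[OF Psi0_integral_expand[OF H], of "m + n - k"] unfolding I psi_quartic by simp
    then show ?thesis
      unfolding psi_quartic by (simp add: mult_ac)
  qed
  have "integrable ?M (\<lambda>z. \<Psi>\<^sub>0 z * cnj (\<psi> m z) * cnj (\<psi> n z))"
    by (rule strip_product_integrable[OF L2_cnj[OF L2_psi] L2_psi, of _ B]) (simp_all add: B)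
  from Psi0_integral_expand[OF this]
  have S: "((\<lambda>k. of_real (\<kappa> * parity_sign (m - k) (k - n) * theta_coeff (m - k) * theta_coeff (k - n))) has_sum
      integral\<^sup>L ?M (\<lambda>z. \<Psi>\<^sub>0 z * (\<Psi>\<^sub>0 z * cnj (\<psi> m z) * cnj (\<psi> n z)))) UNIV"
    unfolding inner .
  have eq: "\<kappa> * (theta_coeff k * theta_coeff (k + (m - n)) - 2 * odd_coeff k * odd_coeff (k + (m - n)))
     = \<kappa> * parity_sign (m - (n - k)) ((n - k) - n) * theta_coeff (m - (n - k)) * theta_coeff ((n - k) - n)" for k
  proof -
    have a: "m - (n - k) = k + (m - n)" "(n - k) - n = - k" by auto
    have "parity_sign k (k + (m - n)) * theta_coeff k * theta_coeff (k + (m - n)) = parity_sign (k + (m - n)) k * theta_coeff (k + (m - n)) * theta_coeff k"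
      by (simp add: parity_sign_commute[of k])
    then show ?thesis
      unfolding a parity_theta[symmetric] parity_sign_minus theta_coeff_minus by (simp only: mult.assoc)
  qed
  have "((\<lambda>k. complex_of_real (\<kappa> * (theta_coeff k * theta_coeff (k + (m - n)) - 2 * odd_coeff k * odd_coeff (k + (m - n))))) has_sum
      integral\<^sup>L ?M (\<lambda>z. \<Psi>\<^sub>0 z * (\<Psi>\<^sub>0 z * cnj (\<psi> m z) * cnj (\<psi> n z)))) UNIV"
    unfolding eq using S
    by (subst has_sum_reindex_bij_witness[where i = "\<lambda>k. n - k" and j = "\<lambda>k. n - k" and T = UNIV
      and h = "\<lambda>k. complex_of_real (\<kappa> * parity_sign (m - k) (k - n) * theta_coeff (m - k) * theta_coeff (k - n))"]) auto
  then show ?thesis by (simp add: power2_eq_square mult_ac)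
qed

lemma cnj_fourier_basis: "fourier_basis m \<xi> * cnj (fourier_basis n \<xi>) = cis (2 * pi * of_int (n - m) * \<xi>)"
  unfolding fourier_basis_def cis_cnj cis_mult by (simp add: algebra_simps)

lemma ell_fourier_coeff: "integral\<^sup>L (lebesgue_on {0..1}) (\<lambda>\<xi>. of_real (ell \<xi>) * cis (2 * pi * of_int j * \<xi>)) = of_real (theta_coeff j)"
  using ell.series_coeff[of j] by (simp add: ell_series)

lemma hodd_fourier_coeff: "integral\<^sup>L (lebesgue_on {0..1}) (\<lambda>\<xi>. of_real (hodd \<xi>) * cis (2 * pi * of_int j * \<xi>)) = of_real (odd_coeff j)"
  using hodd.series_coeff[of j] by (simp add: hodd_series)

lemma L2_fourier: "L2 {0..1} (fourier_basis n)"
  by (rule L2_orthonormal.L2_basis[OF fourier_orthonormal])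

lemma unit_product_integrable:
  assumes "b \<in> borel_measurable borel" "\<And>\<xi>. norm (b \<xi>) \<le> K"
  shows "integrable (lebesgue_on {0..1}) (\<lambda>\<xi>. b \<xi> * cis (2 * pi * of_int j * \<xi>))"
proof -
  have "integrable (lebesgue_on {0..1}) (\<lambda>\<xi>. b \<xi> * fourier_basis 0 \<xi> * cnj (fourier_basis j \<xi>))"
    by (rule L2_mult_cnj_integrable[OF L2_bounded_mult[OF L2_fourier borel_measurable_lebesgue_on_borel[OF assms(1)] assms(2)] L2_fourier])
  then show ?thesis unfolding mult.assoc cnj_fourier_basis by simp
qed

lemma norm_ell_le: "norm (complex_of_real (ell \<xi>)) \<le> 2"
  using ell_bounds(1)[of \<xi>] ell_bounds(2) by (simp add: abs_le_iff)

lemma norm_hodd_le: "norm (complex_of_real (hodd \<xi>)) \<le> 1"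
  using hodd_bound[of \<xi>] unfolding norm_of_real by linarith

text \<open>Since \<open>coeff_a\<close> has \<open>lam\<close> already subtracted, adding it back
  gives the multiplier of the potential itself.\<close>

lemma coeff_a_matrix:
  "integral\<^sup>L (lebesgue_on {0..1}) (\<lambda>\<xi>. of_real (coeff_a \<xi> + lam) * cis (2 * pi * of_int j * \<xi>))
    = of_real (2 * \<kappa> * (theta_coeff j * ell 0 - 2 * odd_coeff j * hodd 0))"
proof -
  have eq: "of_real (coeff_a \<xi> + lam) * cis (2 * pi * of_int j * \<xi>) =
      of_real (2 * \<kappa> * ell 0) * (of_real (ell \<xi>) * cis (2 * pi * of_int j * \<xi>)) - of_real (4 * \<kappa> * hodd 0) * (of_real (hodd \<xi>) * cis (2 * pi * of_int j * \<xi>))" for \<xi>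
    by (simp add: coeff_a_kappa algebra_simps)
  have i: "integrable (lebesgue_on {0..1}) (\<lambda>\<xi>. of_real (ell \<xi>) * cis (2 * pi * of_int j * \<xi>))"
      "integrable (lebesgue_on {0..1}) (\<lambda>\<xi>. of_real (hodd \<xi>) * cis (2 * pi * of_int j * \<xi>))"
    by (rule unit_product_integrable[OF _ norm_ell_le], measurable) (rule unit_product_integrable[OF _ norm_hodd_le], measurable)
  show ?thesis
    unfolding eq Bochner_Integration.integral_diff[OF integrable_mult_right[OF i(1)] integrable_mult_right[OF i(2)]]
      integral_mult_right_zero ell_fourier_coeff hodd_fourier_coeff
    by (simp add: algebra_simps)
qed

lemma coeff_b_matrix:
  "((\<lambda>k. of_real (\<kappa> * (theta_coeff k * theta_coeff (k + j) - 2 * odd_coeff k * odd_coeff (k + j)))) has_sum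
    integral\<^sup>L (lebesgue_on {0..1}) (\<lambda>\<xi>. of_real (coeff_b \<xi>) * cis (2 * pi * of_int j * \<xi>))) UNIV"
proof -
  let ?l = "\<lambda>\<xi>. complex_of_real (ell \<xi>) * (of_real (ell \<xi>) * cis (2 * pi * of_int j * \<xi>))"
  let ?h = "\<lambda>\<xi>. complex_of_real (hodd \<xi>) * (of_real (hodd \<xi>) * cis (2 * pi * of_int j * \<xi>))"
  have n: "norm (complex_of_real (ell \<xi>) * of_real (ell \<xi>)) \<le> 4" "norm (complex_of_real (hodd \<xi>) * of_real (hodd \<xi>)) \<le> 1" for \<xi>
  proof -
    have "norm (complex_of_real (ell \<xi>)) * norm (complex_of_real (ell \<xi>)) \<le> 2 * 2"
      by (intro mult_mono norm_ell_le) (simp_all only: norm_ge_zero zero_le_numeral)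
    moreover have "norm (complex_of_real (hodd \<xi>)) * norm (complex_of_real (hodd \<xi>)) \<le> 1 * 1"
      by (intro mult_mono norm_hodd_le) (simp_all only: norm_ge_zero zero_le_one)
    ultimately show "norm (complex_of_real (ell \<xi>) * of_real (ell \<xi>)) \<le> 4" "norm (complex_of_real (hodd \<xi>) * of_real (hodd \<xi>)) \<le> 1"
      unfolding norm_mult by linarith+
  qed
  have i: "integrable (lebesgue_on {0..1}) ?l" "integrable (lebesgue_on {0..1}) ?h"
    unfolding mult.assoc[symmetric]
    by (rule unit_product_integrable[OF _ n(1)], measurable) (rule unit_product_integrable[OF _ n(2)], measurable)
  have "((\<lambda>k. of_real \<kappa> * of_real (theta_coeff k * theta_coeff (k + j)) + of_real (- 2 * \<kappa>) * of_real (odd_coeff k * odd_coeff (k + j))) has_sum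
      of_real \<kappa> * integral\<^sup>L (lebesgue_on {0..1}) ?l + of_real (- 2 * \<kappa>) * integral\<^sup>L (lebesgue_on {0..1}) ?h) UNIV"
    by (rule has_sum_add[OF has_sum_cmult_right[OF ell.series_square_coeff[of j, unfolded ell_series]]
      has_sum_cmult_right[OF hodd.series_square_coeff[of j, unfolded hodd_series]]])
  also have "of_real \<kappa> * integral\<^sup>L (lebesgue_on {0..1}) ?l + of_real (- 2 * \<kappa>) * integral\<^sup>L (lebesgue_on {0..1}) ?h
     = integral\<^sup>L (lebesgue_on {0..1}) (\<lambda>\<xi>. of_real \<kappa> * ?l \<xi> + of_real (- 2 * \<kappa>) * ?h \<xi>)"
    unfolding Bochner_Integration.integral_add[OF integrable_mult_right[OF i(1)] integrable_mult_right[OF i(2)]]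
      integral_mult_right_zero ..
  also have "(\<lambda>\<xi>. of_real \<kappa> * ?l \<xi> + of_real (- 2 * \<kappa>) * ?h \<xi>) = (\<lambda>\<xi>. of_real (coeff_b \<xi>) * cis (2 * pi * of_int j * \<xi>))"
    by (auto simp: coeff_b_kappa power2_eq_square algebra_simps)
  finally have "((\<lambda>k. of_real \<kappa> * of_real (theta_coeff k * theta_coeff (k + j)) + of_real (- 2 * \<kappa>) * of_real (odd_coeff k * odd_coeff (k + j))) has_sum
      integral\<^sup>L (lebesgue_on {0..1}) (\<lambda>\<xi>. of_real (coeff_b \<xi>) * cis (2 * pi * of_int j * \<xi>))) UNIV" .
  moreover have "of_real \<kappa> * of_real (theta_coeff k * theta_coeff (k + j)) + of_real (- 2 * \<kappa>) * of_real (odd_coeff k * odd_coeff (k + j))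
     = complex_of_real (\<kappa> * (theta_coeff k * theta_coeff (k + j) - 2 * odd_coeff k * odd_coeff (k + j)))" for k
    by (simp add: algebra_simps)
  ultimately show ?thesis by (simp only:)
qed

section \<open>Reflection of the unit interval\<close>

lemma integrable_unit_reflect:
  fixes u :: "real \<Rightarrow> 'b::euclidean_space"
  assumes "integrable (lebesgue_on {0..1}) u"
  shows "integrable (lebesgue_on {0..1}) (\<lambda>x. u (1 - x))"
    and "integral\<^sup>L (lebesgue_on {0..1}) (\<lambda>x. u (1 - x)) = integral\<^sup>L (lebesgue_on {0..1}) u"
proof -
  have "has_bochner_integral lebesgue (\<lambda>x. indicator {0..1} x *\<^sub>R u x) (integral\<^sup>L (lebesgue_on {0..1}) u)"
    using assms by (simp add: has_bochner_integral_iff integrable_restrict_space integral_restrict_space)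
  then have "has_bochner_integral lebesgue (\<lambda>x. indicator {0..1} (1 + - 1 * x) *\<^sub>R u (1 + - 1 * x)) (integral\<^sup>L (lebesgue_on {0..1}) u)"
    using has_bochner_integral_lebesgue_real_affine_iff[of "- 1" "\<lambda>x. indicator {0..1} x *\<^sub>R u x" _ 1] by simp
  moreover have "indicator {0..1} (1 + - 1 * x) = (indicator {0..1} x :: real)" for x :: real
    by (auto simp: indicator_def)
  ultimately have "has_bochner_integral lebesgue (\<lambda>x. indicator {0..1} x *\<^sub>R u (1 - x)) (integral\<^sup>L (lebesgue_on {0..1}) u)"
    by simp
  then show "integrable (lebesgue_on {0..1}) (\<lambda>x. u (1 - x))"
    "integral\<^sup>L (lebesgue_on {0..1}) (\<lambda>x. u (1 - x)) = integral\<^sup>L (lebesgue_on {0..1}) u"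
    by (simp_all add: has_bochner_integral_iff integrable_restrict_space integral_restrict_space)
qed

lemma L2_reflect:
  fixes u :: "real \<Rightarrow> complex"
  assumes "L2 {0..1} u"
  shows "L2 {0..1} (\<lambda>x. cnj (u (1 - x)))" "L2norm {0..1} (\<lambda>x. cnj (u (1 - x))) = L2norm {0..1} u"
proof -
  \<comment> \<open>Pairing with the constant function 1 shows that u is integrable; measurability
    of the reflected function is then part of its integrability.\<close>
  have "integrable (lebesgue_on {0..1}) (\<lambda>x. u x * cnj (fourier_basis 0 x))"
    by (rule L2_mult_cnj_integrable[OF assms L2_fourier])
  then have "integrable (lebesgue_on {0..1}) u"
    by (simp add: fourier_basis_def)
  then have m: "(\<lambda>x. u (1 - x)) \<in> borel_measurable (lebesgue_on {0..1})"
    by (intro borel_measurable_integrable integrable_unit_reflect(1))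
  have "integrable (lebesgue_on {0..1}) (\<lambda>x. (norm (u x))\<^sup>2)"
    using assms by (simp add: L2_def)
  note r = integrable_unit_reflect[OF this]
  show "L2 {0..1} (\<lambda>x. cnj (u (1 - x)))"
    using r(1) m by (simp add: L2_def borel_measurable_cnj)
  show "L2norm {0..1} (\<lambda>x. cnj (u (1 - x))) = L2norm {0..1} u"
    using r(2) by (simp add: L2norm_def)
qed

lemma fourier_basis_reflect: "cnj (fourier_basis n (1 - \<xi>)) = fourier_basis n \<xi>"
proof -
  have "cis (2 * pi * of_int n * (1 - \<xi>)) = cis (- (2 * pi * of_int n * \<xi>)) * cis (2 * pi * of_int n)"
    unfolding cis_mult by (rule arg_cong[where f = cis]) (simp add: right_diff_distrib)
  moreover have "cis (2 * pi * of_int n) = 1"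
    using cis_multiple_2pi[of "of_int n"] by simp
  ultimately have "cis (2 * pi * of_int n * (1 - \<xi>)) = cis (- (2 * pi * of_int n * \<xi>))"
    by simp
  then show ?thesis by (simp add: fourier_basis_def cis_cnj)
qed

text \<open>Reflecting and conjugating fixes each exponential and preserves the norm, so the
  expansion keeps its index and only the coefficients are conjugated.\<close>

lemma L2_has_sum_reflect:
  assumes "L2_has_sum {0..1} (\<lambda>n \<xi>. c n * fourier_basis n \<xi>) f"
  shows "L2_has_sum {0..1} (\<lambda>n \<xi>. cnj (c n) * fourier_basis n \<xi>) (\<lambda>\<xi>. cnj (f (1 - \<xi>)))"
  unfolding L2_has_sum_def
proof (intro conjI allI)
  note A = L2_has_sumD[OF assms]
  show "L2 {0..1} (\<lambda>\<xi>. cnj (c n) * fourier_basis n \<xi>)" for n by (intro L2_cmult L2_fourier)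
  show "L2 {0..1} (\<lambda>\<xi>. cnj (f (1 - \<xi>)))" by (rule L2_reflect(1)[OF A(2)])
  have eq: "L2norm {0..1} (\<lambda>\<xi>. cnj (f (1 - \<xi>)) - (\<Sum>n\<in>N. cnj (c n) * fourier_basis n \<xi>)) = L2norm {0..1} (\<lambda>\<xi>. f \<xi> - (\<Sum>n\<in>N. c n * fourier_basis n \<xi>))"
    if "finite N" for N
  proof -
    have "L2 {0..1} (\<lambda>\<xi>. f \<xi> - (\<Sum>n\<in>N. c n * fourier_basis n \<xi>))"
      using that by (intro L2_diff A L2_sum L2_cmult L2_fourier)
    from L2_reflect(2)[OF this] show ?thesis
      by (simp add: fourier_basis_reflect)
  qed
  show "((\<lambda>N. L2norm {0..1} (\<lambda>\<xi>. cnj (f (1 - \<xi>)) - (\<Sum>n\<in>N. cnj (c n) * fourier_basis n \<xi>))) \<longlongrightarrow> 0) (finite_subsets_at_top UNIV)"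
    by (rule Lim_transform_eventually[OF A(3)]) (auto intro!: eventually_finite_subsets_at_top_weakI simp: eq)
qed

lemma abs_coeff_b_le: "\<bar>coeff_b \<xi>\<bar> \<le> 7 * \<kappa>" and abs_coeff_a_le: "\<bar>coeff_a \<xi>\<bar> \<le> 7 * \<kappa>"
proof -
  have k: "0 < \<kappa>" by simp
  have "- (7 * \<kappa>) \<le> coeff_a \<xi> - coeff_b \<xi>"
  proof -
    have "(ell 0 - ell \<xi>)\<^sup>2 \<le> (4 / 9)\<^sup>2"
      using ell_bounds(1)[of \<xi>] ell_bounds(2) hodd_le_ell_drop[of \<xi>] hodd_drop_lower[of \<xi>]
      by (intro power_mono) (auto simp: abs_le_iff intro: order_trans[OF mult_nonneg_nonneg])
    then have "(ell 0 - ell \<xi>)\<^sup>2 \<le> 16 / 81" by (simp add: power_divide)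
    then have "- 7 \<le> 2 * (hodd 0 - hodd \<xi>)\<^sup>2 - (ell 0 - ell \<xi>)\<^sup>2"
      using zero_le_power2[of "hodd 0 - hodd \<xi>"] by linarith
    from mult_left_mono[OF this, of \<kappa>] k show ?thesis
      unfolding coeff_diff_eq by (simp add: mult.commute)
  qed
  then show "\<bar>coeff_b \<xi>\<bar> \<le> 7 * \<kappa>" "\<bar>coeff_a \<xi>\<bar> \<le> 7 * \<kappa>"
    using coeff_sum_bounds[of \<xi>] coeff_diff_le[of \<xi>] k by linarith+
qed

lemma L2ip_real_mult: "L2ip S (\<lambda>x. of_real (r x) * u x) w = L2ip S u (\<lambda>x. of_real (r x) * w x)"
  unfolding L2ip_def by (simp add: mult_ac)

text \<open>Both sides are expanded in the coefficients c of the solution, and the resulting sums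
  have the same terms. Multipliers are first moved onto the test function, and the antilinear term
  is written as the conjugate of an inner product with v, so that \<open>L2_has_sum_ip\<close>
  applies to each part.\<close>

lemma linearised_coeff:
  assumes V: "L2_has_sum (strip \<gamma>) (\<lambda>n z. c n * \<psi> n z) v"
    and F: "L2_has_sum {0..1} (\<lambda>n \<xi>. c n * fourier_basis n \<xi>) f"
    and G: "L2_has_sum {0..1} (\<lambda>n \<xi>. cnj (c n) * fourier_basis n \<xi>) g"
  shows "L2ip (strip \<gamma>) (linearised_potential v) (\<psi> n) =
    L2ip {0..1} (\<lambda>\<xi>. of_real (coeff_a \<xi> + lam) * f \<xi> + of_real (coeff_b \<xi>) * g \<xi>) (fourier_basis n)"
proof -
  let ?S = "strip \<gamma>"
  let ?A = "\<lambda>\<xi>. complex_of_real (coeff_a \<xi> + lam)"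
  let ?B = "\<lambda>\<xi>. complex_of_real (coeff_b \<xi>)"
  let ?R = "\<lambda>z. complex_of_real ((norm (\<Psi>\<^sub>0 z))\<^sup>2)"
  obtain B where B: "\<And>z. norm (\<Psi>\<^sub>0 z) \<le> B" "0 \<le> B" using Psi0_bounded by metis
  have B2: "norm (?R z) \<le> B\<^sup>2" "norm ((\<Psi>\<^sub>0 z)\<^sup>2) \<le> B\<^sup>2" for z
    using power_mono[OF B(1), of z 2] by (simp_all add: norm_power)
  have m: "(\<lambda>z. ?R z) \<in> borel_measurable (lebesgue_on ?S)"
    "(\<lambda>z. (\<Psi>\<^sub>0 z)\<^sup>2) \<in> borel_measurable (lebesgue_on ?S)"
    by (intro borel_measurable_lebesgue_on_borel; measurable)+
  define w1 where "w1 z = ?R z * \<psi> n z" for z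
  define w2 where "w2 z = (\<Psi>\<^sub>0 z)\<^sup>2 * cnj (\<psi> n z)" for z
  have w: "L2 ?S w1" "L2 ?S w2"
    unfolding w1_def[abs_def] w2_def[abs_def]
    by (rule L2_bounded_mult[OF _ m(1) B2(1)], rule L2_psi) (rule L2_bounded_mult[OF _ m(2) B2(2)], rule L2_cnj, rule L2_psi)
  note v = L2_has_sumD(2)[OF V]
  have "L2ip ?S (linearised_potential v) (\<psi> n) =
    L2ip ?S (\<lambda>z. 2 * (?R z * v z)) (\<psi> n) + L2ip ?S (\<lambda>z. (\<Psi>\<^sub>0 z)\<^sup>2 * cnj (v z)) (\<psi> n)"
    unfolding linearised_potential_def[abs_def] mult.assoc
    by (intro L2ip_add_left L2_psi L2_cmult L2_bounded_mult[OF _ m(1) B2(1)] L2_bounded_mult[OF _ m(2) B2(2)] L2_cnj v)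
  also have "L2ip ?S (\<lambda>z. 2 * (?R z * v z)) (\<psi> n) = 2 * L2ip ?S v w1"
    unfolding L2ip_cmult_left L2ip_real_mult w1_def[abs_def] ..
  also have "L2ip ?S (\<lambda>z. (\<Psi>\<^sub>0 z)\<^sup>2 * cnj (v z)) (\<psi> n) = cnj (L2ip ?S v w2)"
    unfolding L2ip_cnj unfolding L2ip_def w2_def by (simp add: mult_ac)
  finally have lhs: "L2ip ?S (linearised_potential v) (\<psi> n) = 2 * L2ip ?S v w1 + cnj (L2ip ?S v w2)" .
  define M1 where "M1 k = 2 * complex_of_real (\<kappa> * (theta_coeff (k - n) * ell 0 - 2 * odd_coeff (k - n) * hodd 0))" for k
  define M2 where "M2 k = integral\<^sup>L (lebesgue_on ?S) (\<lambda>z. cnj (\<psi> k z) * (\<Psi>\<^sub>0 z)\<^sup>2 * cnj (\<psi> n z))" for k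
  have A1: "((\<lambda>k. M1 k * c k) has_sum (2 * L2ip ?S v w1)) UNIV"
  proof -
    have "L2ip ?S (\<psi> k) w1 = of_real (\<kappa> * (theta_coeff (k - n) * ell 0 - 2 * odd_coeff (k - n) * hodd 0))" for k
      unfolding Psi0_norm_square_matrix[symmetric] L2ip_def w1_def by (simp add: mult_ac)
    then have "2 * L2ip ?S (\<lambda>z. c k * \<psi> k z) w1 = M1 k * c k" for k
      unfolding L2ip_cmult_left M1_def by simp
    then show ?thesis
      using has_sum_cmult_right[OF L2_has_sum_ip[OF V w(1)], of 2] by simp
  qed
  have A2: "((\<lambda>k. M2 k * cnj (c k)) has_sum cnj (L2ip ?S v w2)) UNIV"
  proof -
    have "cnj (L2ip ?S (\<lambda>z. c k * \<psi> k z) w2) = M2 k * cnj (c k)" for k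
      unfolding L2ip_cmult_left complex_cnj_mult L2ip_cnj M2_def unfolding L2ip_def w2_def by (simp add: mult_ac)
    then show ?thesis
      using L2_has_sum_ip[OF V w(2)] has_sum_cnj_iff[of "\<lambda>k. L2ip ?S (\<lambda>z. c k * \<psi> k z) w2"] by simp
  qed
  have bnd: "norm (?A \<xi>) \<le> 7 * \<kappa> + \<bar>lam\<bar>" "norm (?B \<xi>) \<le> 7 * \<kappa>" for \<xi>
    using abs_coeff_a_le[of \<xi>] abs_coeff_b_le[of \<xi>] by (auto simp del: of_real_add)
  have ma: "(\<lambda>\<xi>. ?A \<xi>) \<in> borel_measurable (lebesgue_on {0..1})"
    and mb: "(\<lambda>\<xi>. ?B \<xi>) \<in> borel_measurable (lebesgue_on {0..1})"
    by (intro borel_measurable_lebesgue_on_borel; measurable)+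
  note f = L2_has_sumD(2)[OF F] and g = L2_has_sumD(2)[OF G]
  have rhs: "L2ip {0..1} (\<lambda>\<xi>. ?A \<xi> * f \<xi> + ?B \<xi> * g \<xi>) (fourier_basis n) =
     L2ip {0..1} f (\<lambda>\<xi>. ?A \<xi> * fourier_basis n \<xi>) + L2ip {0..1} g (\<lambda>\<xi>. ?B \<xi> * fourier_basis n \<xi>)"
    unfolding L2ip_real_mult[symmetric]
    by (intro L2ip_add_left L2_fourier L2_bounded_mult[OF f ma bnd(1)] L2_bounded_mult[OF g mb bnd(2)])
  have B1: "((\<lambda>k. M1 k * c k) has_sum L2ip {0..1} f (\<lambda>\<xi>. ?A \<xi> * fourier_basis n \<xi>)) UNIV"
  proof -
    have e: "L2ip {0..1} (\<lambda>\<xi>. c k * fourier_basis k \<xi>) (\<lambda>\<xi>. ?A \<xi> * fourier_basis n \<xi>) = M1 k * c k" for k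
    proof -
      have "L2ip {0..1} (fourier_basis k) (\<lambda>\<xi>. ?A \<xi> * fourier_basis n \<xi>) =
         integral\<^sup>L (lebesgue_on {0..1}) (\<lambda>\<xi>. ?A \<xi> * cis (2 * pi * of_int (n - k) * \<xi>))"
        unfolding L2ip_def cnj_fourier_basis[symmetric] complex_cnj_mult complex_cnj_complex_of_real by (simp only: mult_ac)
      also have "\<dots> = M1 k"
        unfolding coeff_a_matrix M1_def using theta_coeff_minus[of "k - n"] hodd.w_even[of "k - n"] by simp
      finally show ?thesis unfolding L2ip_cmult_left by simp
    qed
    show ?thesis
      using L2_has_sum_ip[OF F L2_bounded_mult[OF L2_fourier[of n] ma bnd(1)]] unfolding e .
  qed
  have B2: "((\<lambda>k. M2 k * cnj (c k)) has_sum L2ip {0..1} g (\<lambda>\<xi>. ?B \<xi> * fourier_basis n \<xi>)) UNIV"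
  proof -
    have e: "L2ip {0..1} (\<lambda>\<xi>. cnj (c k) * fourier_basis k \<xi>) (\<lambda>\<xi>. ?B \<xi> * fourier_basis n \<xi>) = M2 k * cnj (c k)" for k
    proof -
      have "L2ip {0..1} (fourier_basis k) (\<lambda>\<xi>. ?B \<xi> * fourier_basis n \<xi>) =
         integral\<^sup>L (lebesgue_on {0..1}) (\<lambda>\<xi>. ?B \<xi> * cis (2 * pi * of_int (n - k) * \<xi>))"
        unfolding L2ip_def cnj_fourier_basis[symmetric] complex_cnj_mult complex_cnj_complex_of_real by (simp only: mult_ac)
      also have "\<dots> = M2 k"
      proof (rule has_sum_unique[OF coeff_b_matrix])
        \<comment> \<open>The two autocorrelations carry the offsets n - k and k - n; they are
          matched by reversing the summation index, since the weights are even.\<close>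
        define h where "h j l = complex_of_real (\<kappa> * (theta_coeff l * theta_coeff (l + j) - 2 * odd_coeff l * odd_coeff (l + j)))" for j l
        have "h (k - n) (- l) = h (n - k) l" for l
        proof -
          have "- l + (k - n) = - (l + (n - k))" by simp
          then show ?thesis unfolding h_def by (simp only: theta_coeff_minus hodd.w_even)
        qed
        then have "(h (n - k) has_sum M2 k) UNIV = (h (k - n) has_sum M2 k) UNIV"
          by (intro has_sum_reindex_bij_witness[where i = uminus and j = uminus]) auto
        then show "((\<lambda>l. complex_of_real (\<kappa> * (theta_coeff l * theta_coeff (l + (n - k)) - 2 * odd_coeff l * odd_coeff (l + (n - k))))) has_sum M2 k) UNIV"
          using Psi0_square_matrix[of k n] unfolding h_def M2_def by simp
      qed
      finally show ?thesis unfolding L2ip_cmult_left by simp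
    qed
    show ?thesis
      using L2_has_sum_ip[OF G L2_bounded_mult[OF L2_fourier[of n] mb bnd(2)]] unfolding e .
  qed
  show ?thesis
    unfolding lhs rhs has_sum_unique[OF A1 B1] has_sum_unique[OF A2 B2] ..
qed

section \<open>Transport of the time derivative to the circle\<close>

definition has_L2_deriv :: "real set \<Rightarrow> (real \<Rightarrow> real \<Rightarrow> complex) \<Rightarrow> (real \<Rightarrow> complex) \<Rightarrow> real \<Rightarrow> bool" where
  "has_L2_deriv S u u' t \<longleftrightarrow>
     ((\<lambda>s. L2norm S (\<lambda>x. (u s x - u t x) / of_real (s - t) - u' x)) \<longlongrightarrow> 0) (at t within {0..})"

lemma L2_has_sum_divided_difference:
  assumes "L2_has_sum S (\<lambda>n x. c n * \<phi> n x) u" "L2_has_sum S (\<lambda>n x. d n * \<phi> n x) w"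
  shows "L2_has_sum S (\<lambda>n x. (c n - d n) / r * \<phi> n x) (\<lambda>x. (u x - w x) / r)"
  using L2_has_sum_linear[OF assms, of "1 / r" "- 1 / r"] by (simp add: algebra_simps diff_divide_distrib)

lemma at_within_nonneg_nontrivial: "0 \<le> t \<Longrightarrow> at t within {0::real..} \<noteq> bot"
proof
  assume t: "0 \<le> t" and "at t within {0..} = bot"
  moreover have "at_right t \<le> at t within {0..}"
    using t by (intro at_le) auto
  ultimately have "at_right t = bot" by (simp add: bot_unique)
  then show False using trivial_limit_at_right_real[of t] by simp
qed

lemma transform_reflect:
  assumes "solution_with_transforms v c f g" "0 \<le> t"
  shows "g t = (\<lambda>\<xi>. cnj (f t (1 - \<xi>)))"
proof
  fix \<xi>
  have "f t (- \<xi> + 1) = f t (- \<xi>)" "g t \<xi> = cnj (f t (- \<xi>))"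
    using assms unfolding solution_with_transforms_def by blast+
  then show "g t \<xi> = cnj (f t (1 - \<xi>))" by (simp add: add.commute)
qed

text \<open>The derivative on the strip and the candidate on the circle have the same coefficients
  and both lie in the spans of their systems. Hence the errors of the difference quotients on the
  two sides have the same expansion, and by the isometry the same norm.\<close>

lemma transform_has_L2_deriv:
  assumes sol: "solution_with_transforms v c f g" and t: "0 \<le> t"
  shows "has_L2_deriv {0..1} f (\<lambda>\<xi>. - \<i> * (of_real (coeff_a \<xi>) * f t \<xi> + of_real (coeff_b \<xi>) * g t \<xi>)) t"
proof -
  let ?S = "strip \<gamma>"
  let ?V = "linearised_potential (v t)"
  let ?h = "\<lambda>\<xi>. of_real (coeff_a \<xi>) * f t \<xi> + of_real (coeff_b \<xi>) * g t \<xi>"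
  let ?Q = "\<lambda>s z. (v s z - v t z) / of_real (s - t)"
  let ?q = "\<lambda>s \<xi>. (f s \<xi> - f t \<xi>) / of_real (s - t)"
  interpret P: L2_orthonormal "strip \<gamma>" \<psi> by (rule psi_orthonormal)
  interpret E: L2_orthonormal "{0..1}" fourier_basis by (rule fourier_orthonormal)
  have V: "L2_has_sum ?S (\<lambda>n z. c s n * \<psi> n z) (v s)" if "0 \<le> s" for s
    using sol that by (simp add: solution_with_transforms_def)
  have F: "L2_has_sum {0..1} (\<lambda>n \<xi>. c s n * fourier_basis n \<xi>) (f s)" if "0 \<le> s" for s
    using sol that by (simp add: solution_with_transforms_def fourier_basis_exp)
  note g = transform_reflect[OF sol t]
  have G: "L2_has_sum {0..1} (\<lambda>n \<xi>. cnj (c t n) * fourier_basis n \<xi>) (g t)"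
    unfolding g by (rule L2_has_sum_reflect[OF F[OF t]])
  have "linearised_LLL_solution v"
    using sol by (simp add: solution_with_transforms_def)
  then obtain v' where v: "v t \<in> L2_LLL_periodic \<gamma>" and v': "v' \<in> L2_LLL_periodic \<gamma>" and dv: "has_L2_time_deriv v v' t"
    and eq: "\<And>z. \<i> * v' z + of_real lam * v t z = LLL_proj ?V z"
    using t unfolding linearised_LLL_solution_def linearised_potential_def by blast
  define f' where "f' \<xi> = - \<i> * ?h \<xi>" for \<xi>
  have vm [measurable]: "v t \<in> borel_measurable borel" "v' \<in> borel_measurable borel"
    using v v' by (auto simp: L2_LLL_periodic_def LLL_periodic_def intro: LLL_tilde_measurable)
  have L2v: "L2 ?S (v t)" "L2 ?S v'"
    using v v' by (auto simp: L2_LLL_periodic_def)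
  have eq': "LLL_proj ?V = (\<lambda>z. \<i> * v' z + of_real lam * v t z)"
    using eq by auto
  have vper: "v t \<in> LLL_periodic \<gamma>" using v by (simp add: L2_LLL_periodic_def)
  obtain C where "\<And>z. norm (v t z) \<le> C * exp \<bar>Im z\<bar>"
    using LLL_periodic_bound[OF vper] by metis
  then obtain C' where C': "\<And>z. norm (linearised_potential (v t) z) \<le> C' * exp \<bar>Im z\<bar>"
    using linearised_potential_bound by metis
  \<comment> \<open>A nested combination of two terms at a time, the shape that
    \<open>spanned_linear\<close> and the multiplication lemmas consume.\<close>
  have a_eq: "?h \<xi> =
      1 * (of_real (2 * \<kappa> * ell 0) * (ell.series \<xi> * f t \<xi>) + of_real (- 4 * \<kappa> * hodd 0) * (hodd.series \<xi> * f t \<xi>)) +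
      1 * (of_real (- lam) * f t \<xi> + 1 * (of_real \<kappa> * (ell.series \<xi> * (ell.series \<xi> * g t \<xi>)) + of_real (- 2 * \<kappa>) * (hodd.series \<xi> * (hodd.series \<xi> * g t \<xi>))))" for \<xi>
    unfolding coeff_a_kappa coeff_b_kappa ell_series hodd_series by (simp add: power2_eq_square algebra_simps)
  have sf: "spanned {0..1} fourier_basis (f t)" and sg: "spanned {0..1} fourier_basis (g t)"
    by (rule E.spannedI[OF F[OF t]], rule E.spannedI[OF G])
  have sab: "spanned {0..1} fourier_basis ?h"
    unfolding a_eq
    by (intro E.spanned_linear[where p = 1 and r = 1] E.spanned_linear[where r = 1] E.spanned_linear ell.spanned_series_mult hodd.spanned_series_mult sf sg)
  then have sf': "spanned {0..1} fourier_basis f'"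
    unfolding f'_def[abs_def] by (rule E.spanned_cmult)
  have coeff: "L2ip ?S v' (\<psi> n) = L2ip {0..1} f' (fourier_basis n)" for n
  proof -
    have "L2ip ?S (LLL_proj ?V) (\<psi> n) = L2ip ?S ?V (\<psi> n)"
    proof (rule LLL_proj_ip_psi[OF _ _ C'])
      show "quasi_periodic ?V"
        by (intro linearised_potential_quasi_periodic LLL_periodic_quasi_periodic vper)
      show "LLL_proj ?V \<in> borel_measurable borel" unfolding eq' by measurable
      show "L2 ?S (LLL_proj ?V)" unfolding eq' by (intro L2_add L2_cmult L2v)
    qed measurable
    moreover have "L2ip ?S (LLL_proj ?V) (\<psi> n) = \<i> * L2ip ?S v' (\<psi> n) + of_real lam * c t n"
      unfolding eq' by (subst L2ip_add_left) (auto intro!: L2_cmult L2v L2_psi simp: L2ip_cmult_left P.coeff_eq[OF V[OF t]])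
    moreover have "L2ip {0..1} (\<lambda>\<xi>. of_real (coeff_a \<xi> + lam) * f t \<xi> + of_real (coeff_b \<xi>) * g t \<xi>) (fourier_basis n) =
       L2ip {0..1} ?h (fourier_basis n) + of_real lam * c t n"
    proof -
      have "(\<lambda>\<xi>. of_real (coeff_a \<xi> + lam) * f t \<xi> + of_real (coeff_b \<xi>) * g t \<xi>) = (\<lambda>\<xi>. ?h \<xi> + of_real lam * f t \<xi>)"
        by (auto simp: algebra_simps)
      then show ?thesis
        by (simp only:) (subst L2ip_add_left, auto intro!: spanned_L2[OF sab] L2_cmult spanned_L2[OF sf] L2_fourier simp: L2ip_cmult_left E.coeff_eq[OF F[OF t]])
    qed
    ultimately have "\<i> * L2ip ?S v' (\<psi> n) = L2ip {0..1} ?h (fourier_basis n)"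
      using linearised_coeff[OF V[OF t] F[OF t] G, of n] by simp
    then have "- \<i> * (\<i> * L2ip ?S v' (\<psi> n)) = L2ip {0..1} f' (fourier_basis n)"
      unfolding f'_def[abs_def] L2ip_cmult_left by simp
    then show ?thesis by (simp flip: mult.assoc)
  qed
  have Q: "L2_has_sum ?S (\<lambda>n z. (c s n - c t n) / of_real (s - t) * \<psi> n z) (?Q s)" if "0 \<le> s" for s
    by (rule L2_has_sum_divided_difference[OF V[OF that] V[OF t]])
  have q: "L2_has_sum {0..1} (\<lambda>n \<xi>. (c s n - c t n) / of_real (s - t) * fourier_basis n \<xi>) (?q s)" if "0 \<le> s" for s
    by (rule L2_has_sum_divided_difference[OF F[OF that] F[OF t]])
  have pos: "\<forall>\<^sub>F s in at t within {0..}. 0 \<le> s"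
    by (simp add: eventually_at_filter)
  \<comment> \<open>Difference quotients of the solution lie in the span and converge in norm to the
    derivative, and the span is closed.\<close>
  have sv': "spanned ?S \<psi> v'"
  proof (rule P.spanned_limit[OF L2v(2)])
    fix e :: real assume "0 < e"
    then have "\<forall>\<^sub>F s in at t within {0..}. L2norm ?S (\<lambda>z. ?Q s z - v' z) < e"
      using dv unfolding has_L2_time_deriv_def by (auto dest: tendstoD)
    with pos have "\<forall>\<^sub>F s in at t within {0..}. 0 \<le> s \<and> L2norm ?S (\<lambda>z. ?Q s z - v' z) < e"
      by eventually_elim simp
    then obtain s where s: "0 \<le> s" "L2norm ?S (\<lambda>z. ?Q s z - v' z) < e"
      using eventually_happens'[OF at_within_nonneg_nontrivial[OF t]] by blast
    show "\<exists>w. spanned ?S \<psi> w \<and> L2norm ?S (\<lambda>x. v' x - w x) < e"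
      using P.spannedI[OF Q[OF s(1)]] s(2) unfolding L2norm_minus_commute[of _ _ v'] by blast
  qed
  have "L2norm {0..1} (\<lambda>\<xi>. ?q s \<xi> - f' \<xi>) = L2norm ?S (\<lambda>z. ?Q s z - v' z)" if s: "0 \<le> s" for s
  proof -
    \<comment> \<open>The common coefficients of both errors; on the circle side
      \<open>coeff\<close> replaces those of the candidate by those of the derivative on the
      strip.\<close>
    define d where "d n = (c s n - c t n) / of_real (s - t) - L2ip ?S v' (\<psi> n)" for n
    have "L2_has_sum ?S (\<lambda>n z. d n * \<psi> n z) (\<lambda>z. ?Q s z - v' z)"
      using L2_has_sum_linear[OF Q[OF s] sv'[unfolded spanned_def], of 1 "- 1"] by (simp add: d_def left_diff_distrib)
    moreover have "L2_has_sum {0..1} (\<lambda>n \<xi>. d n * fourier_basis n \<xi>) (\<lambda>\<xi>. ?q s \<xi> - f' \<xi>)"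
      using L2_has_sum_linear[OF q[OF s] sf'[unfolded spanned_def], of 1 "- 1"] by (simp add: d_def coeff left_diff_distrib)
    ultimately show ?thesis
      by (rule L2_isometry[OF psi_orthonormal fourier_orthonormal, symmetric])
  qed
  then have "\<forall>\<^sub>F s in at t within {0..}. L2norm ?S (\<lambda>z. ?Q s z - v' z) = L2norm {0..1} (\<lambda>\<xi>. ?q s \<xi> - f' \<xi>)"
    using pos by (auto elim: eventually_mono)
  then show ?thesis
    using dv unfolding has_L2_time_deriv_def has_L2_deriv_def f'_def[symmetric]
    by (rule Lim_transform_eventually[rotated])
qed

subsection \<open>Solving the system and the estimates\<close>

lemma has_L2_deriv_linear:
  assumes u: "\<And>s. 0 \<le> s \<Longrightarrow> L2 S (u s)" "L2 S u'" "has_L2_deriv S u u' t"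
    and w: "\<And>s. 0 \<le> s \<Longrightarrow> L2 S (w s)" "L2 S w'" "has_L2_deriv S w w' t"
    and t: "0 \<le> t"
  shows "has_L2_deriv S (\<lambda>s x. u s x + r * w s x) (\<lambda>x. u' x + r * w' x) t"
  unfolding has_L2_deriv_def
proof (rule Lim_null_comparison)
  let ?q = "\<lambda>u u' s x. (u s x - u t x) / of_real (s - t) - u' x :: complex"
  show "((\<lambda>s. L2norm S (?q u u' s) + norm r * L2norm S (?q w w' s)) \<longlongrightarrow> 0) (at t within {0..})"
    using tendsto_add[OF u(3)[unfolded has_L2_deriv_def] tendsto_mult_left[OF w(3)[unfolded has_L2_deriv_def], of "norm r"]] by simp
  have "norm (L2norm S (\<lambda>x. (u s x + r * w s x - (u t x + r * w t x)) / of_real (s - t) - (u' x + r * w' x)))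
      \<le> L2norm S (?q u u' s) + norm r * L2norm S (?q w w' s)" if s: "0 \<le> s" for s
  proof -
    have eq: "(u s x + r * w s x - (u t x + r * w t x)) / of_real (s - t) - (u' x + r * w' x) = ?q u u' s x + r * ?q w w' s x" for x
      by (simp add: diff_divide_distrib add_divide_distrib algebra_simps)
    have "L2norm S (\<lambda>x. ?q u u' s x + r * ?q w w' s x) \<le> L2norm S (?q u u' s) + L2norm S (\<lambda>x. r * ?q w w' s x)"
      using u w s t by (intro L2norm_triangle L2_cmult L2_diff L2_divide) auto
    then show ?thesis unfolding eq L2norm_cmult by simp
  qed
  then show "\<forall>\<^sub>F s in at t within {0..}. norm (L2norm S (\<lambda>x. (u s x + r * w s x - (u t x + r * w t x)) / of_real (s - t) - (u' x + r * w' x)))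
      \<le> L2norm S (?q u u' s) + norm r * L2norm S (?q w w' s)"
    by (auto simp: eventually_at_filter)
qed

lemma has_L2_deriv_reflect:
  assumes "\<And>s. 0 \<le> s \<Longrightarrow> L2 {0..1} (u s)" "L2 {0..1} u'" "has_L2_deriv {0..1} u u' t" "0 \<le> t"
  shows "has_L2_deriv {0..1} (\<lambda>s x. cnj (u s (1 - x))) (\<lambda>x. cnj (u' (1 - x))) t"
proof -
  have "L2norm {0..1} (\<lambda>x. (cnj (u s (1 - x)) - cnj (u t (1 - x))) / of_real (s - t) - cnj (u' (1 - x)))
     = L2norm {0..1} (\<lambda>x. (u s x - u t x) / of_real (s - t) - u' x)" if "0 \<le> s" for s
  proof -
    have "L2 {0..1} (\<lambda>x. (u s x - u t x) / of_real (s - t) - u' x)"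
      using assms that by (intro L2_diff L2_divide) auto
    from L2_reflect(2)[OF this] show ?thesis by simp
  qed
  then have "\<forall>\<^sub>F s in at t within {0..}. L2norm {0..1} (\<lambda>x. (u s x - u t x) / of_real (s - t) - u' x) =
     L2norm {0..1} (\<lambda>x. (cnj (u s (1 - x)) - cnj (u t (1 - x))) / of_real (s - t) - cnj (u' (1 - x)))"
    by (auto simp: eventually_at_filter)
  then show ?thesis
    using assms(3) unfolding has_L2_deriv_def by (rule Lim_transform_eventually[rotated])
qed

text \<open>Packages cosine and sine with their derivatives so that the product rule is proved once.
  The quadratic remainder makes the difference quotients of \<theta> (m x (T - t)) converge
  uniformly in x for bounded m.\<close>

definition trig_profile :: "(real \<Rightarrow> real) \<Rightarrow> (real \<Rightarrow> real) \<Rightarrow> bool" where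
  "trig_profile \<theta> \<theta>' \<longleftrightarrow> \<theta> \<in> borel_measurable borel \<and> \<theta>' \<in> borel_measurable borel \<and>
     (\<forall>x. \<bar>\<theta> x\<bar> \<le> 1) \<and> (\<forall>x. \<bar>\<theta>' x\<bar> \<le> 1) \<and> (\<forall>x y. \<bar>\<theta> x - \<theta> y\<bar> \<le> \<bar>x - y\<bar>) \<and>
     (\<forall>x y. \<bar>\<theta> x - \<theta> y - (x - y) * \<theta>' y\<bar> \<le> (x - y)\<^sup>2)"

lemma cis_taylor_bounds:
  "norm (cis x - cis y) \<le> \<bar>x - y\<bar>" "norm (cis x - cis y - of_real (x - y) * (\<i> * cis y)) \<le> (x - y)\<^sup>2"
proof -
  have x: "cis x = cis y * cis (x - y)" unfolding cis_mult by simp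
  have "norm (cis (x - y) - 1) \<le> \<bar>x - y\<bar>"
    using iexp_approx1[of "x - y" 0] by (simp add: cis_conv_exp)
  then show "norm (cis x - cis y) \<le> \<bar>x - y\<bar>"
    unfolding x using norm_mult[of "cis y" "cis (x - y) - 1"] by (simp add: right_diff_distrib)
  have "norm (cis (x - y) - (1 + \<i> * of_real (x - y))) \<le> (x - y)\<^sup>2 / 2"
    using iexp_approx1[of "x - y" 1] by (simp add: cis_conv_exp power2_eq_square numeral_2_eq_2)
  also have "\<dots> \<le> (x - y)\<^sup>2" by simp
  finally have "norm (cis y * (cis (x - y) - (1 + \<i> * of_real (x - y)))) \<le> (x - y)\<^sup>2"
    by (simp add: norm_mult)
  also have "cis y * (cis (x - y) - (1 + \<i> * of_real (x - y))) = cis x - cis y - of_real (x - y) * (\<i> * cis y)"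
    unfolding x by (simp add: algebra_simps)
  finally show "norm (cis x - cis y - of_real (x - y) * (\<i> * cis y)) \<le> (x - y)\<^sup>2" .
qed

lemma trig_profile_cos: "trig_profile cos (\<lambda>x. - sin x)"
  unfolding trig_profile_def
proof (intro conjI allI)
  show "\<bar>cos x - cos y\<bar> \<le> \<bar>x - y\<bar>" for x y :: real
    using order_trans[OF abs_Re_le_cmod cis_taylor_bounds(1)[of x y]] by simp
  show "\<bar>cos x - cos y - (x - y) * - sin y\<bar> \<le> (x - y)\<^sup>2" for x y :: real
    using order_trans[OF abs_Re_le_cmod cis_taylor_bounds(2)[of x y]] by simp
qed auto

lemma trig_profile_sin: "trig_profile sin cos"
  unfolding trig_profile_def
proof (intro conjI allI)
  show "\<bar>sin x - sin y\<bar> \<le> \<bar>x - y\<bar>" for x y :: real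
    using order_trans[OF abs_Im_le_cmod cis_taylor_bounds(1)[of x y]] by simp
  show "\<bar>sin x - sin y - (x - y) * cos y\<bar> \<le> (x - y)\<^sup>2" for x y :: real
    using order_trans[OF abs_Im_le_cmod cis_taylor_bounds(2)[of x y]] by simp
qed auto

lemma has_vector_derivative_quotientI:
  fixes F :: "real \<Rightarrow> 'b::real_normed_vector"
  assumes "((\<lambda>s. (F s - F t) /\<^sub>R (s - t)) \<longlongrightarrow> D) (at t within A)"
  shows "(F has_vector_derivative D) (at t within A)"
  unfolding has_vector_derivative_def has_derivative_within
proof (rule conjI[OF bounded_linear_scaleR_left tendsto_norm_zero_cancel])
  have "norm ((F s - F t) /\<^sub>R (s - t) - D) = norm ((1 / norm (s - t)) *\<^sub>R (F s - (F t + (s - t) *\<^sub>R D)))" if "s \<noteq> t" for s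
  proof -
    have "inverse (s - t) *\<^sub>R ((s - t) *\<^sub>R D) = D" using that by simp
    then have "(F s - F t) /\<^sub>R (s - t) - D = inverse (s - t) *\<^sub>R (F s - (F t + (s - t) *\<^sub>R D))"
      by (simp only: diff_diff_eq[symmetric] scaleR_diff_right)
    moreover have "\<bar>inverse (s - t)\<bar> = \<bar>1 / norm (s - t)\<bar>"
      by (simp add: inverse_eq_divide)
    ultimately show ?thesis by (simp only: norm_scaleR)
  qed
  then have "\<forall>\<^sub>F s in at t within A. norm ((F s - F t) /\<^sub>R (s - t) - D) = norm ((1 / norm (s - t)) *\<^sub>R (F s - (F t + (s - t) *\<^sub>R D)))"
    by (auto simp: eventually_at_filter)
  then show "((\<lambda>s. norm ((1 / norm (s - t)) *\<^sub>R (F s - (F t + (s - t) *\<^sub>R D)))) \<longlongrightarrow> 0) (at t within A)"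
    using tendsto_norm_zero[OF LIM_zero[OF assms]] by (rule Lim_transform_eventually[rotated])
qed

text \<open>A product rule in weak form: the difference quotient of the multiplier converges
  uniformly, that of u in norm, and Cauchy-Schwarz passes both limits to the pairing with
  \<phi>.\<close>

lemma L2ip_trig_pairing_deriv:
  assumes \<theta>: "trig_profile \<theta> \<theta>'"
    and \<rho>: "\<rho> \<in> borel_measurable borel" "\<And>x. norm (\<rho> x) \<le> K"
    and m: "m \<in> borel_measurable borel" "\<And>x. \<bar>m x\<bar> \<le> M"
    and u: "\<And>s. 0 \<le> s \<Longrightarrow> L2 S (u s)" "L2 S u'" "has_L2_deriv S u u' t"
    and \<phi>: "L2 S \<phi>" and t: "0 \<le> t"
  shows "((\<lambda>s. L2ip S (\<lambda>x. \<rho> x * of_real (\<theta> (m x * (T - s))) * u s x) \<phi>) has_vector_derivative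
    L2ip S (\<lambda>x. \<rho> x * of_real (- m x * \<theta>' (m x * (T - t))) * u t x + \<rho> x * of_real (\<theta> (m x * (T - t))) * u' x) \<phi>) (at t within {0..})"
proof -
  \<comment> \<open>The first summand is the Taylor remainder of the multiplier acting on u at time
    t, the second its Lipschitz variation acting on u'. Both vanish as s tends to t.\<close>
  let ?e = "\<lambda>s. K * (M\<^sup>2 * \<bar>s - t\<bar>) * L2norm S (u t) + K * (M * \<bar>s - t\<bar>) * L2norm S u'"
  note [measurable] = \<rho>(1) m(1)
  have \<theta>m [measurable]: "\<theta> \<in> borel_measurable borel" "\<theta>' \<in> borel_measurable borel"
    using \<theta> by (auto simp: trig_profile_def)
  have K: "0 \<le> K" using \<rho>(2) norm_ge_zero order_trans by blast
  have M: "0 \<le> M" using m(2) abs_ge_zero order_trans by blast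
  define \<Theta> where "\<Theta> s x = \<rho> x * of_real (\<theta> (m x * (T - s)))" for s x
  define \<Theta>' where "\<Theta>' x = \<rho> x * of_real (- m x * \<theta>' (m x * (T - t)))" for x
  have ms [measurable]: "\<Theta> s \<in> borel_measurable (lebesgue_on S)" "\<Theta>' \<in> borel_measurable (lebesgue_on S)" for s
    unfolding \<Theta>_def[abs_def] \<Theta>'_def[abs_def] by (intro borel_measurable_lebesgue_on_borel; measurable)+
  have b1: "norm (\<Theta> s x) \<le> K" for s x
    using mult_mono[OF \<rho>(2)[of x], of "\<bar>\<theta> (m x * (T - s))\<bar>" 1] \<theta> K by (simp add: \<Theta>_def norm_mult trig_profile_def)
  have b2: "norm (\<Theta>' x) \<le> K * M" for x
  proof -
    have "\<bar>m x\<bar> * \<bar>\<theta>' (m x * (T - t))\<bar> \<le> M * 1"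
      using \<theta> m(2)[of x] M by (intro mult_mono) (auto simp: trig_profile_def)
    then have "norm (\<rho> x) * (\<bar>m x\<bar> * \<bar>\<theta>' (m x * (T - t))\<bar>) \<le> K * M"
      using \<rho>(2)[of x] K by (intro mult_mono) auto
    then show ?thesis by (simp add: \<Theta>'_def norm_mult abs_mult)
  qed
  have b3: "norm (\<Theta> s x - \<Theta> t x) \<le> K * (M * \<bar>s - t\<bar>)" for s x
  proof -
    have "\<bar>\<theta> (m x * (T - s)) - \<theta> (m x * (T - t))\<bar> \<le> \<bar>m x * (T - s) - m x * (T - t)\<bar>"
      using \<theta> by (simp add: trig_profile_def)
    also have "\<dots> = \<bar>m x\<bar> * \<bar>s - t\<bar>"
      unfolding right_diff_distrib[symmetric] abs_mult by (simp add: abs_minus_commute)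
    also have "\<dots> \<le> M * \<bar>s - t\<bar>" by (intro mult_right_mono m) simp
    finally have "norm (\<rho> x) * \<bar>\<theta> (m x * (T - s)) - \<theta> (m x * (T - t))\<bar> \<le> K * (M * \<bar>s - t\<bar>)"
      using \<rho>(2)[of x] K by (intro mult_mono) auto
    then show ?thesis
      unfolding \<Theta>_def right_diff_distrib[symmetric] of_real_diff[symmetric] norm_mult norm_of_real .
  qed
  have b4: "norm ((\<Theta> s x - \<Theta> t x) / of_real (s - t) - \<Theta>' x) \<le> K * (M\<^sup>2 * \<bar>s - t\<bar>)" if "s \<noteq> t" for s x
  proof -
    let ?x = "m x * (T - s)" and ?y = "m x * (T - t)"
    have d: "?x - ?y = - m x * (s - t)" by (simp add: algebra_simps)
    have "\<bar>\<theta> ?x - \<theta> ?y - (?x - ?y) * \<theta>' ?y\<bar> \<le> (?x - ?y)\<^sup>2"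
      using \<theta> by (simp only: trig_profile_def)
    also have "\<dots> = (m x)\<^sup>2 * (s - t)\<^sup>2" unfolding d by (simp add: power_mult_distrib)
    also have "\<dots> \<le> M\<^sup>2 * (s - t)\<^sup>2"
      using m(2)[of x] M by (intro mult_right_mono) (auto simp: abs_le_square_iff[symmetric])
    finally have "\<bar>\<theta> ?x - \<theta> ?y - (?x - ?y) * \<theta>' ?y\<bar> / \<bar>s - t\<bar> \<le> M\<^sup>2 * (s - t)\<^sup>2 / \<bar>s - t\<bar>"
      by (rule divide_right_mono) simp
    also have "M\<^sup>2 * (s - t)\<^sup>2 / \<bar>s - t\<bar> = M\<^sup>2 * \<bar>s - t\<bar>"
    proof -
      define d where "d = \<bar>s - t\<bar>"
      have "d \<noteq> 0" "(s - t)\<^sup>2 = d * d" using that by (simp_all add: d_def power2_eq_square)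
      then show ?thesis unfolding d_def[symmetric] by simp
    qed
    finally have "\<bar>(\<theta> ?x - \<theta> ?y - (?x - ?y) * \<theta>' ?y) / (s - t)\<bar> \<le> M\<^sup>2 * \<bar>s - t\<bar>"
      by (simp only: abs_divide)
    then have "norm (\<rho> x) * \<bar>(\<theta> ?x - \<theta> ?y - (?x - ?y) * \<theta>' ?y) / (s - t)\<bar> \<le> K * (M\<^sup>2 * \<bar>s - t\<bar>)"
      using \<rho>(2)[of x] K by (intro mult_mono) auto
    moreover have "(\<Theta> s x - \<Theta> t x) / of_real (s - t) - \<Theta>' x = \<rho> x * of_real ((\<theta> ?x - \<theta> ?y - (?x - ?y) * \<theta>' ?y) / (s - t))"
      unfolding d \<Theta>_def \<Theta>'_def using that by (simp add: field_simps)
    ultimately show ?thesis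
      unfolding norm_mult by (simp only: norm_mult norm_of_real)
  qed
  let ?q = "\<lambda>s x. (u s x - u t x) / of_real (s - t) - u' x"
  let ?R = "\<lambda>s x. (\<Theta> s x * u s x - \<Theta> t x * u t x) / of_real (s - t) - (\<Theta>' x * u t x + \<Theta> t x * u' x)"
  have L2q: "L2 S (?q s)" if "0 \<le> s" for s
    using u t that by (intro L2_diff L2_divide) auto
  have L2R: "L2 S (?R s)" if "0 \<le> s" for s
    using u t that by (intro L2_diff L2_divide L2_add L2_bounded_mult[OF _ ms(1) b1] L2_bounded_mult[OF _ ms(2) b2]) auto
  have R: "L2norm S (?R s) \<le> K * L2norm S (?q s) + ?e s"
    if s: "0 \<le> s" "s \<noteq> t" for s
  proof -
    \<comment> \<open>Adding and subtracting multiples of u at time t and of u' isolates the three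
      errors: of the quotient of u, of the quotient of the multiplier, and of its variation.\<close>
    have eq: "?R s x = \<Theta> s x * ?q s x + (((\<Theta> s x - \<Theta> t x) / of_real (s - t) - \<Theta>' x) * u t x + (\<Theta> s x - \<Theta> t x) * u' x)" for x
      by (simp add: diff_divide_distrib algebra_simps)
    have m2: "(\<lambda>x. (\<Theta> s x - \<Theta> t x) / of_real (s - t) - \<Theta>' x) \<in> borel_measurable (lebesgue_on S)"
      "(\<lambda>x. \<Theta> s x - \<Theta> t x) \<in> borel_measurable (lebesgue_on S)" by measurable
    have l: "L2 S (\<lambda>x. \<Theta> s x * ?q s x)" "L2 S (\<lambda>x. ((\<Theta> s x - \<Theta> t x) / of_real (s - t) - \<Theta>' x) * u t x)" "L2 S (\<lambda>x. (\<Theta> s x - \<Theta> t x) * u' x)"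
      by (rule L2_bounded_mult[OF L2q[OF s(1)] ms(1) b1], rule L2_bounded_mult[OF u(1)[OF t] m2(1) b4[OF s(2)]],
        rule L2_bounded_mult[OF u(2) m2(2) b3])
    have "L2norm S (?R s) \<le> L2norm S (\<lambda>x. \<Theta> s x * ?q s x) + (L2norm S (\<lambda>x. ((\<Theta> s x - \<Theta> t x) / of_real (s - t) - \<Theta>' x) * u t x) + L2norm S (\<lambda>x. (\<Theta> s x - \<Theta> t x) * u' x))"
      unfolding eq by (rule order_trans[OF L2norm_triangle[OF l(1) L2_add[OF l(2,3)]]]) (intro add_left_mono L2norm_triangle l)
    also have "\<dots> \<le> K * L2norm S (?q s) + ?e s"
      using K M
      by (intro add_mono L2norm_bounded_mult[OF L2q[OF s(1)] ms(1) b1] L2norm_bounded_mult[OF u(1)[OF t] m2(1) b4[OF s(2)]]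
        L2norm_bounded_mult[OF u(2) m2(2) b3]) auto
    finally show ?thesis .
  qed
  have lim: "((\<lambda>s. (K * L2norm S (?q s) + ?e s) * L2norm S \<phi>) \<longlongrightarrow> 0) (at t within {0..})"
  proof -
    have "((\<lambda>s. (K * L2norm S (?q s) + ?e s) * L2norm S \<phi>)
       \<longlongrightarrow> (K * 0 + (K * (M\<^sup>2 * \<bar>t - t\<bar>) * L2norm S (u t) + K * (M * \<bar>t - t\<bar>) * L2norm S u')) * L2norm S \<phi>) (at t within {0..})"
      by (intro tendsto_intros u(3)[unfolded has_L2_deriv_def])
    then show ?thesis by simp
  qed
  let ?I = "\<lambda>s. L2ip S (\<lambda>x. \<Theta> s x * u s x) \<phi>" and ?D = "L2ip S (\<lambda>x. \<Theta>' x * u t x + \<Theta> t x * u' x) \<phi>"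
  have "norm ((?I s - ?I t) /\<^sub>R (s - t) - ?D) \<le> (K * L2norm S (?q s) + ?e s) * L2norm S \<phi>"
    if s: "0 \<le> s" "s \<noteq> t" for s
  proof -
    have l: "L2 S (\<lambda>x. \<Theta> s x * u s x)" "L2 S (\<lambda>x. \<Theta> t x * u t x)" "L2 S (\<lambda>x. \<Theta>' x * u t x + \<Theta> t x * u' x)"
      using u t s by (intro L2_add L2_bounded_mult[OF _ ms(1) b1] L2_bounded_mult[OF _ ms(2) b2]; auto)+
    have "L2ip S (?R s) \<phi> = L2ip S (\<lambda>x. (\<Theta> s x * u s x - \<Theta> t x * u t x) / of_real (s - t)) \<phi> - ?D"
      by (rule L2ip_diff_left[OF L2_divide[OF L2_diff[OF l(1,2)]] l(3) \<phi>])
    also have "L2ip S (\<lambda>x. (\<Theta> s x * u s x - \<Theta> t x * u t x) / of_real (s - t)) \<phi> = L2ip S (\<lambda>x. inverse (of_real (s - t)) * (\<Theta> s x * u s x - \<Theta> t x * u t x)) \<phi>"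
      by (simp add: divide_inverse mult.commute)
    also have "\<dots> = (?I s - ?I t) /\<^sub>R (s - t)"
      unfolding L2ip_cmult_left L2ip_diff_left[OF l(1,2) \<phi>] by (simp add: scaleR_conv_of_real)
    finally have "norm ((?I s - ?I t) /\<^sub>R (s - t) - ?D) \<le> L2norm S (?R s) * L2norm S \<phi>"
      using L2ip_Cauchy_Schwarz[OF L2R[OF s(1)] \<phi>] by simp
    also have "\<dots> \<le> (K * L2norm S (?q s) + ?e s) * L2norm S \<phi>"
      by (intro mult_right_mono R s) simp
    finally show ?thesis .
  qed
  then have "\<forall>\<^sub>F s in at t within {0..}. norm ((?I s - ?I t) /\<^sub>R (s - t) - ?D) \<le>
      (K * L2norm S (?q s) + ?e s) * L2norm S \<phi>"
    by (auto simp: eventually_at_filter)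
  from Lim_null_comparison[OF this lim]
  have "((\<lambda>s. (?I s - ?I t) /\<^sub>R (s - t)) \<longlongrightarrow> ?D) (at t within {0..})"
    by (rule LIM_zero_cancel)
  then have "(?I has_vector_derivative ?D) (at t within {0..})"
    by (rule has_vector_derivative_quotientI)
  then show ?thesis unfolding \<Theta>_def \<Theta>'_def .
qed

section \<open>Conserved quantities and the explicit propagator\<close>

lemma L2norm_zero_AE:
  assumes "L2 S u" "L2norm S u = 0"
  shows "AE x in lebesgue_on S. u x = 0"
proof -
  have "integral\<^sup>L (lebesgue_on S) (\<lambda>x. (norm (u x))\<^sup>2) = 0"
    using assms(2) by (simp add: L2norm_def)
  then have "AE x in lebesgue_on S. (norm (u x))\<^sup>2 = 0"
    using assms(1) by (subst (asm) integral_nonneg_eq_0_iff_AE) (auto simp: L2_def)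
  then show ?thesis by simp
qed

text \<open>The test function is the difference of W at times T and 0. The constancy of its pairing
  with W makes its squared norm zero.\<close>

lemma L2_conserved_AE:
  assumes W: "\<And>t. 0 \<le> t \<Longrightarrow> L2 S (W t)" and T: "0 \<le> T"
    and deriv: "\<And>t \<phi>. 0 \<le> t \<Longrightarrow> L2 S \<phi> \<Longrightarrow> ((\<lambda>s. L2ip S (W s) \<phi>) has_vector_derivative 0) (at t within {0..})"
  shows "AE x in lebesgue_on S. W T x = W 0 x"
proof -
  define \<phi> where "\<phi> x = W T x - W 0 x" for x
  have \<phi>: "L2 S \<phi>" unfolding \<phi>_def[abs_def] using W T by (intro L2_diff) auto
  obtain c where c: "\<And>t. 0 \<le> t \<Longrightarrow> L2ip S (W t) \<phi> = c"
    using has_vector_derivative_zero_constant[of "{0..}" "\<lambda>s. L2ip S (W s) \<phi>"] deriv[OF _ \<phi>] by auto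
  have "L2ip S \<phi> \<phi> = L2ip S (W T) \<phi> - L2ip S (W 0) \<phi>"
    using W T \<phi> unfolding \<phi>_def[abs_def] by (intro L2ip_diff_left) auto
  then have "L2ip S \<phi> \<phi> = 0" using c T by simp
  then have "L2norm S \<phi> = 0" by (simp add: L2ip_self)
  from L2norm_zero_AE[OF \<phi> this] show ?thesis by (simp add: \<phi>_def)
qed

text \<open>For fixed \<open>T\<close>, evolving the data at time \<open>t\<close> by the explicit propagator up to time \<open>T\<close> gives a quantity
  that does not depend on \<open>t\<close>. The second identity carries the factor \<open>m\<close> because \<open>q/m\<close> is unbounded.\<close>

lemma linear_system_solution:
  fixes u w :: "real \<Rightarrow> real \<Rightarrow> complex" and p q m :: "real \<Rightarrow> real"
  assumes L2: "\<And>t. 0 \<le> t \<Longrightarrow> L2 S (u t)" "\<And>t. 0 \<le> t \<Longrightarrow> L2 S (w t)"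
    and u': "\<And>t. 0 \<le> t \<Longrightarrow> has_L2_deriv S u (\<lambda>x. - \<i> * of_real (p x) * w t x) t"
    and w': "\<And>t. 0 \<le> t \<Longrightarrow> has_L2_deriv S w (\<lambda>x. - \<i> * of_real (q x) * u t x) t"
    and pm: "p \<in> borel_measurable borel" "\<And>x. \<bar>p x\<bar> \<le> P"
    and qm: "q \<in> borel_measurable borel" "\<And>x. \<delta> \<le> q x" "\<And>x. q x \<le> Q" "0 < \<delta>"
    and mm: "m \<in> borel_measurable borel" "\<And>x. \<bar>m x\<bar> \<le> M" "\<And>x. (m x)\<^sup>2 = p x * q x"
    and T: "0 \<le> T"
  shows "AE x in lebesgue_on S. u T x = of_real (cos (m x * T)) * u 0 x - \<i> * of_real (m x / q x * sin (m x * T)) * w 0 x"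
    and "AE x in lebesgue_on S. of_real (m x) * w T x = of_real (m x * cos (m x * T)) * w 0 x - \<i> * of_real (q x * sin (m x * T)) * u 0 x"
proof -
  let ?c = "\<lambda>t x. complex_of_real (cos (m x * (T - t)))"
  let ?s = "\<lambda>t x. complex_of_real (sin (m x * (T - t)))"
  let ?p = "\<lambda>x. - \<i> * complex_of_real (p x)"
  let ?q = "\<lambda>x. - \<i> * complex_of_real (q x)"
  let ?r = "\<lambda>x. - \<i> * complex_of_real (m x / q x)"
  note [measurable] = pm(1) qm(1) mm(1)
  have q0: "0 < q x" for x using qm(2)[of x] qm(4) by linarith
  have M: "0 \<le> M" using mm(2) abs_ge_zero order_trans by blast
  have bm: "norm (complex_of_real (m x)) \<le> M" "norm (?r x) \<le> M / \<delta>" "norm (?q x) \<le> Q"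
    "norm (?p x) \<le> P" for x
    using mm(2)[of x] qm(3)[of x] q0[of x] pm(2)[of x] frac_le[OF M mm(2)[of x] qm(4) qm(2)[of x]]
    by (simp_all add: norm_mult norm_divide)
  have mlu: "(\<lambda>x. ?p x) \<in> borel_measurable (lebesgue_on S)" "(\<lambda>x. ?q x) \<in> borel_measurable (lebesgue_on S)"
    by (intro borel_measurable_lebesgue_on_borel; measurable)+
  have L2': "L2 S (\<lambda>x. ?p x * w t x)" "L2 S (\<lambda>x. ?q x * u t x)" if "0 \<le> t" for t
    by (rule L2_bounded_mult[OF L2(2)[OF that] mlu(1) bm(4)], rule L2_bounded_mult[OF L2(1)[OF that] mlu(2) bm(3)])
  have trig_L2: "L2 S (\<lambda>x. \<rho> x * of_real (\<theta> (m x * s)) * h x)"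
    if "L2 S h" "\<rho> \<in> borel_measurable borel" "\<And>x. norm (\<rho> x) \<le> K" "trig_profile \<theta> \<theta>'" for \<rho> \<theta> \<theta>' h s K
  proof (rule L2_bounded_mult[OF that(1)])
    have [measurable]: "\<theta> \<in> borel_measurable borel" "\<rho> \<in> borel_measurable borel" using that by (auto simp: trig_profile_def)
    show "(\<lambda>x. \<rho> x * of_real (\<theta> (m x * s))) \<in> borel_measurable (lebesgue_on S)"
      by (intro borel_measurable_lebesgue_on_borel) measurable
    show "norm (\<rho> x * of_real (\<theta> (m x * s))) \<le> K" for x
      using that(4) mult_left_le[of "\<bar>\<theta> (m x * s)\<bar>" "norm (\<rho> x)"] order_trans[OF _ that(3)[of x]]
      by (simp add: trig_profile_def norm_mult)
  qed
  \<comment> \<open>A common form for both identities. The conditions \<open>cancel\<close> are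
    exactly what makes the derivatives of the cosine and sine terms cancel, so no derivative
    survives.\<close>
  have conserved: "AE x in lebesgue_on S. W T x = W 0 x"
    if W: "\<And>t x. W t x = \<rho> x * ?c t x * h t x + \<sigma> x * ?s t x * k t x"
      and hk: "\<And>t. 0 \<le> t \<Longrightarrow> L2 S (h t)" "\<And>t. 0 \<le> t \<Longrightarrow> L2 S (k t)"
        "\<And>t. 0 \<le> t \<Longrightarrow> L2 S (h' t)" "\<And>t. 0 \<le> t \<Longrightarrow> L2 S (k' t)"
        "\<And>t. 0 \<le> t \<Longrightarrow> has_L2_deriv S h (h' t) t" "\<And>t. 0 \<le> t \<Longrightarrow> has_L2_deriv S k (k' t) t"
      and \<rho>: "\<rho> \<in> borel_measurable borel" "\<And>x. norm (\<rho> x) \<le> K" and \<sigma>: "\<sigma> \<in> borel_measurable borel" "\<And>x. norm (\<sigma> x) \<le> K'"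
      and cancel: "\<And>t x. \<rho> x * h' t x = \<sigma> x * of_real (m x) * k t x" "\<And>t x. \<sigma> x * k' t x = - \<rho> x * of_real (m x) * h t x"
    for W h k h' k' :: "real \<Rightarrow> real \<Rightarrow> complex" and \<rho> \<sigma> :: "real \<Rightarrow> complex" and K K' :: real
  proof (rule L2_conserved_AE[OF _ T])
    have W': "W t = (\<lambda>x. \<rho> x * ?c t x * h t x + \<sigma> x * ?s t x * k t x)" for t
      using W by auto
    have l: "L2 S (\<lambda>x. \<rho> x * ?c t x * h t x)" "L2 S (\<lambda>x. \<sigma> x * ?s t x * k t x)" if "0 \<le> t" for t
      by (rule trig_L2[OF hk(1)[OF that] \<rho> trig_profile_cos], rule trig_L2[OF hk(2)[OF that] \<sigma> trig_profile_sin])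
    show "L2 S (W t)" if "0 \<le> t" for t
      unfolding W' by (rule L2_add[OF l[OF that]])
    fix t :: real and \<phi> assume t: "0 \<le> t" and \<phi>: "L2 S \<phi>"
    let ?A = "\<lambda>x. \<rho> x * of_real (- m x * - sin (m x * (T - t))) * h t x + \<rho> x * ?c t x * h' t x"
    let ?B = "\<lambda>x. \<sigma> x * of_real (- m x * cos (m x * (T - t))) * k t x + \<sigma> x * ?s t x * k' t x"
    have D: "((\<lambda>s. L2ip S (\<lambda>x. \<rho> x * ?c s x * h s x) \<phi> + L2ip S (\<lambda>x. \<sigma> x * ?s s x * k s x) \<phi>)
       has_vector_derivative L2ip S ?A \<phi> + L2ip S ?B \<phi>) (at t within {0..})"
      by (intro has_vector_derivative_add
        L2ip_trig_pairing_deriv[OF trig_profile_cos \<rho> mm(1,2) hk(1,3,5) \<phi>]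
        L2ip_trig_pairing_deriv[OF trig_profile_sin \<sigma> mm(1,2) hk(2,4,6) \<phi>] t)
    have Z: "L2ip S ?A \<phi> + L2ip S ?B \<phi> = 0"
    proof -
      have "?B x = - ?A x" for x
      proof -
        have "?A x = (\<rho> x * of_real (m x) * h t x) * ?s t x + ?c t x * (\<rho> x * h' t x)"
          by (simp add: mult_ac)
        also have "\<dots> = (\<rho> x * of_real (m x) * h t x) * ?s t x + ?c t x * (\<sigma> x * of_real (m x) * k t x)"
          unfolding cancel ..
        finally have A: "?A x = \<dots>" .
        have "?B x = - (?c t x * (\<sigma> x * of_real (m x) * k t x)) + ?s t x * (\<sigma> x * k' t x)"
          by (simp add: mult_ac)
        also have "\<dots> = - (?c t x * (\<sigma> x * of_real (m x) * k t x)) + ?s t x * (- \<rho> x * of_real (m x) * h t x)"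
          unfolding cancel ..
        finally have B: "?B x = \<dots>" .
        show ?thesis unfolding A B by (simp add: mult_ac)
      qed
      then show ?thesis
        using L2ip_cmult_left[of S "- 1" ?A \<phi>] by simp
    qed
    have E: "L2ip S (W s) \<phi> = L2ip S (\<lambda>x. \<rho> x * ?c s x * h s x) \<phi> + L2ip S (\<lambda>x. \<sigma> x * ?s s x * k s x) \<phi>"
      if "s \<in> {0..}" for s
      unfolding W' using that by (intro L2ip_add_left l \<phi>) simp_all
    show "((\<lambda>s. L2ip S (W s) \<phi>) has_vector_derivative 0) (at t within {0..})"
      by (rule has_vector_derivative_transform[OF _ E D[unfolded Z]]) (use t in simp)
  qed
  have meq: "complex_of_real (p x) = of_real (m x / q x * m x)" for x
    using mm(3)[of x] q0[of x] by (simp add: power2_eq_square field_simps flip: of_real_mult)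
  have msq: "complex_of_real (m x) * complex_of_real (m x) = of_real (p x) * of_real (q x)" for x
    using mm(3)[of x] by (simp add: power2_eq_square flip: of_real_mult)
  \<comment> \<open>At t = T the sine vanishes and the cosine is 1, which leaves the solution at
    time T; at t = 0 the explicit formula appears.\<close>
  define W1 where "W1 t x = 1 * ?c t x * u t x + (?r x) * ?s t x * w t x" for t x
  define W2 where "W2 t x = of_real (m x) * ?c t x * w t x + (?q x) * ?s t x * u t x" for t x
  have "AE x in lebesgue_on S. W1 T x = W1 0 x"
  proof (rule conserved[where W = W1 and \<rho> = "\<lambda>_. 1" and \<sigma> = "\<lambda>x. ?r x" and h = u and k = w
      and h' = "\<lambda>t x. ?p x * w t x" and k' = "\<lambda>t x. ?q x * u t x", OF W1_def L2 L2' u' w'])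
    show "1 * (?p x * w t x) = ?r x * complex_of_real (m x) * w t x" for t x
      unfolding meq by (simp add: mult_ac)
    show "?r x * (?q x * u t x) = - 1 * complex_of_real (m x) * u t x" for t x
    proof -
      have "?r x * (?q x * u t x) = (- \<i> * - \<i>) * (complex_of_real (m x / q x) * complex_of_real (q x)) * u t x"
        by (simp only: mult_ac)
      also have "complex_of_real (m x / q x) * complex_of_real (q x) = complex_of_real (m x)"
        using q0[of x] by simp
      finally show ?thesis by simp
    qed
    show "norm (1::complex) \<le> 1" by simp
    show "norm (?r x) \<le> M / \<delta>" for x by (rule bm)
  qed measurable
  then show "AE x in lebesgue_on S. u T x = of_real (cos (m x * T)) * u 0 x - \<i> * of_real (m x / q x * sin (m x * T)) * w 0 x"
    by eventually_elim (simp add: W1_def mult_ac)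
  have "AE x in lebesgue_on S. W2 T x = W2 0 x"
  proof (rule conserved[where W = W2 and \<rho> = "\<lambda>x. of_real (m x)" and \<sigma> = "\<lambda>x. ?q x" and h = w and k = u
      and h' = "\<lambda>t x. ?q x * u t x" and k' = "\<lambda>t x. ?p x * w t x", OF W2_def L2(2,1) L2'(2,1) w' u'])
    show "complex_of_real (m x) * (?q x * u t x) = ?q x * complex_of_real (m x) * u t x" for t x
      by simp
    show "?q x * (?p x * w t x) = - complex_of_real (m x) * complex_of_real (m x) * w t x" for t x
    proof -
      have "?q x * (?p x * w t x) = (- \<i> * - \<i>) * (of_real (p x) * of_real (q x)) * w t x"
        by (simp only: mult_ac)
      then show ?thesis unfolding msq[symmetric] by simp
    qed
    show "norm (complex_of_real (m x)) \<le> M" "norm (?q x) \<le> Q" for x by (rule bm)+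
  qed measurable
  then show "AE x in lebesgue_on S. of_real (m x) * w T x = of_real (m x * cos (m x * T)) * w 0 x - \<i> * of_real (q x * sin (m x * T)) * u 0 x"
    by eventually_elim (simp add: W2_def mult_ac)
qed

section \<open>Size of \<open>\<mu>\<close> and the estimates\<close>

lemma coeff_product_nonneg: "0 \<le> (coeff_a \<xi> - coeff_b \<xi>) * (coeff_a \<xi> + coeff_b \<xi>)"
  using coeff_diff_nonneg[of \<xi>] coeff_sum_bounds(1)[of \<xi>] kappa_pos(1) by (intro mult_nonneg_nonneg) linarith+

lemma mu_eq: "\<mu> \<xi> = sqrt ((coeff_a \<xi> - coeff_b \<xi>) * (coeff_a \<xi> + coeff_b \<xi>))"
  unfolding \<mu>_def by (simp add: power2_eq_square algebra_simps)

lemma mu_square: "(\<mu> \<xi>)\<^sup>2 = (coeff_a \<xi> - coeff_b \<xi>) * (coeff_a \<xi> + coeff_b \<xi>)"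
  unfolding mu_eq using coeff_product_nonneg by simp

lemma mu_nonneg: "0 \<le> \<mu> \<xi>"
  unfolding mu_eq using coeff_product_nonneg by simp

lemma mu_le: "\<mu> \<xi> \<le> 3 * \<kappa>"
proof (rule power2_le_imp_le)
  have "(coeff_a \<xi> - coeff_b \<xi>) * (coeff_a \<xi> + coeff_b \<xi>) \<le> \<kappa> * (7 * \<kappa>)"
    using coeff_diff_nonneg[of \<xi>] coeff_diff_le[of \<xi>] coeff_sum_bounds[of \<xi>] kappa_pos(1) by (intro mult_mono) linarith+
  also have "\<dots> \<le> (3 * \<kappa>)\<^sup>2" by (simp add: power2_eq_square)
  finally show "(\<mu> \<xi>)\<^sup>2 \<le> (3 * \<kappa>)\<^sup>2" unfolding mu_square .
qed (simp add: less_imp_le)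

lemma mu_pos:
  assumes "0 < \<xi>" "\<xi> < 1"
  shows "0 < \<mu> \<xi>"
proof -
  have "0 < (coeff_a \<xi> - coeff_b \<xi>) * (coeff_a \<xi> + coeff_b \<xi>)"
    using coeff_diff_pos[OF assms] coeff_sum_bounds(1)[of \<xi>] kappa_pos(1) by (intro mult_pos_pos) linarith+
  then show ?thesis
    unfolding mu_eq by simp
qed

lemma trig_combination_bound:
  fixes X Y :: complex
  assumes "0 \<le> \<alpha>" "0 \<le> \<beta>"
  shows "norm (of_real (\<alpha> * cos x) * X - \<i> * of_real (\<beta> * sin x) * Y) \<le> \<alpha> * norm X + \<beta> * norm Y"
proof -
  have "norm (of_real (\<alpha> * cos x) * X - \<i> * of_real (\<beta> * sin x) * Y) \<le> \<alpha> * \<bar>cos x\<bar> * norm X + \<beta> * \<bar>sin x\<bar> * norm Y"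
    using norm_triangle_ineq4[of "of_real (\<alpha> * cos x) * X" "\<i> * of_real (\<beta> * sin x) * Y"] assms
    by (simp add: norm_mult abs_mult)
  also have "\<dots> \<le> \<alpha> * 1 * norm X + \<beta> * 1 * norm Y"
    using assms by (intro add_mono mult_right_mono mult_left_mono) auto
  finally show ?thesis by simp
qed

text \<open>The propagator bounded pointwise by |cos|, |sin| \<le> 1, which removes the time. The
  bound \<mu> / (a + b) \<le> 2 \<mu> / \<kappa> keeps the factor \<mu> next to f - g, and the
  second bound stays multiplied by \<mu>, so that any power of \<mu> can be divided out
  later.\<close>

lemma transforms_AE_bounds:
  assumes sol: "solution_with_transforms v c f g" and T: "0 \<le> T"
  shows "AE \<xi> in lebesgue_on {0..1}. 0 < \<mu> \<xi> \<and>
      norm (f T \<xi> + g T \<xi>) \<le> norm (f 0 \<xi> + g 0 \<xi>) + 2 / \<kappa> * (\<mu> \<xi> * norm (f 0 \<xi> - g 0 \<xi>)) \<and>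
      \<mu> \<xi> * norm (f T \<xi> - g T \<xi>) \<le> \<mu> \<xi> * norm (f 0 \<xi> - g 0 \<xi>) + 7 * \<kappa> * norm (f 0 \<xi> + g 0 \<xi>)"
    and "L2 {0..1} (f T)" "L2 {0..1} (g T)" "L2norm {0..1} (g T) = L2norm {0..1} (f T)"
proof -
  let ?p = "\<lambda>\<xi>. norm (f 0 \<xi> + g 0 \<xi>)"
  let ?m = "\<lambda>\<xi>. norm (f 0 \<xi> - g 0 \<xi>)"
  let ?S = "{0..1::real}"
  have L2f: "L2 ?S (f t)" if "0 \<le> t" for t
    using sol that by (auto simp: solution_with_transforms_def dest: L2_has_sumD(2))
  have g: "g t = (\<lambda>\<xi>. cnj (f t (1 - \<xi>)))" if "0 \<le> t" for t
    by (rule transform_reflect[OF sol that])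
  have L2g: "L2 ?S (g t)" if "0 \<le> t" for t
    unfolding g[OF that] by (rule L2_reflect(1)[OF L2f[OF that]])
  show "L2 ?S (f T)" "L2 ?S (g T)" by (rule L2f[OF T], rule L2g[OF T])
  show "L2norm ?S (g T) = L2norm ?S (f T)"
    unfolding g[OF T] by (rule L2_reflect(2)[OF L2f[OF T]])
  define f' where "f' t \<xi> = - \<i> * (of_real (coeff_a \<xi>) * f t \<xi> + of_real (coeff_b \<xi>) * g t \<xi>)" for t \<xi>
  define g' where "g' t \<xi> = \<i> * (of_real (coeff_a \<xi>) * g t \<xi> + of_real (coeff_b \<xi>) * f t \<xi>)" for t \<xi>
  have bnd: "norm (complex_of_real (coeff_a \<xi>)) \<le> 7 * \<kappa>" "norm (complex_of_real (coeff_b \<xi>)) \<le> 7 * \<kappa>" for \<xi>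
    using abs_coeff_a_le[of \<xi>] abs_coeff_b_le[of \<xi>] by auto
  have cm: "(\<lambda>\<xi>. complex_of_real (coeff_a \<xi>)) \<in> borel_measurable (lebesgue_on ?S)" "(\<lambda>\<xi>. complex_of_real (coeff_b \<xi>)) \<in> borel_measurable (lebesgue_on ?S)"
    by (intro borel_measurable_lebesgue_on_borel; measurable)+
  have L2': "L2 ?S (f' t)" "L2 ?S (g' t)" if "0 \<le> t" for t
    unfolding f'_def[abs_def] g'_def[abs_def]
    by (intro L2_cmult L2_add L2_bounded_mult[OF _ cm(1) bnd(1)] L2_bounded_mult[OF _ cm(2) bnd(2)] L2f L2g that)+
  have df: "has_L2_deriv ?S f (f' t) t" if "0 \<le> t" for t
    unfolding f'_def[abs_def] by (rule transform_has_L2_deriv[OF sol that])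
  \<comment> \<open>Conjugation turns the factor - i into i and reflection exchanges f and g, so the
    equation for f yields the one for g.\<close>
  have dg: "has_L2_deriv ?S g (g' t) t" if t: "0 \<le> t" for t
  proof -
    have "cnj (f' t (1 - x)) = g' t x" for x
      unfolding f'_def g'_def coeff_a_reflect coeff_b_reflect g[OF t] by simp
    then have "has_L2_deriv ?S (\<lambda>s x. cnj (f s (1 - x))) (g' t) t"
      using has_L2_deriv_reflect[OF L2f L2'(1)[OF t] df[OF t] t] by simp
    moreover have "\<forall>\<^sub>F s in at t within {0..}. (\<lambda>x. cnj (f s (1 - x))) = g s"
      using g by (auto simp: eventually_at_filter)
    ultimately show ?thesis
      unfolding has_L2_deriv_def using g[OF t]
      by (elim Lim_transform_eventually) (auto elim!: eventually_mono simp: fun_eq_iff)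
  qed
  have du: "has_L2_deriv ?S (\<lambda>t x. f t x + g t x) (\<lambda>x. - \<i> * of_real (coeff_a x - coeff_b x) * (f t x - g t x)) t" if "0 \<le> t" for t
  proof -
    have "f' t x + 1 * g' t x = - \<i> * of_real (coeff_a x - coeff_b x) * (f t x - g t x)" for x
      unfolding f'_def g'_def by (simp add: algebra_simps)
    then show ?thesis
      using has_L2_deriv_linear[OF L2f L2'(1)[OF that] df[OF that] L2g L2'(2)[OF that] dg[OF that] that, of 1] by simp
  qed
  have dw: "has_L2_deriv ?S (\<lambda>t x. f t x - g t x) (\<lambda>x. - \<i> * of_real (coeff_a x + coeff_b x) * (f t x + g t x)) t" if "0 \<le> t" for t
  proof -
    have "f' t x + (- 1) * g' t x = - \<i> * of_real (coeff_a x + coeff_b x) * (f t x + g t x)" for x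
      unfolding f'_def g'_def by (simp add: algebra_simps)
    then show ?thesis
      using has_L2_deriv_linear[OF L2f L2'(1)[OF that] df[OF that] L2g L2'(2)[OF that] dg[OF that] that, of "- 1"] by simp
  qed
  have "\<bar>coeff_a x - coeff_b x\<bar> \<le> \<kappa>" for x
    using coeff_diff_nonneg[of x] coeff_diff_le[of x] by simp
  moreover have "\<bar>\<mu> x\<bar> \<le> 3 * \<kappa>" for x
    using mu_nonneg[of x] mu_le[of x] by simp
  ultimately have sol_AE:
    "AE x in lebesgue_on ?S. f T x + g T x = of_real (cos (\<mu> x * T)) * (f 0 x + g 0 x) - \<i> * of_real (\<mu> x / (coeff_a x + coeff_b x) * sin (\<mu> x * T)) * (f 0 x - g 0 x)"
    "AE x in lebesgue_on ?S. of_real (\<mu> x) * (f T x - g T x) = of_real (\<mu> x * cos (\<mu> x * T)) * (f 0 x - g 0 x) - \<i> * of_real ((coeff_a x + coeff_b x) * sin (\<mu> x * T)) * (f 0 x + g 0 x)"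
    using linear_system_solution[where S = ?S and u = "\<lambda>t x. f t x + g t x" and w = "\<lambda>t x. f t x - g t x"
      and p = "\<lambda>x. coeff_a x - coeff_b x" and q = "\<lambda>x. coeff_a x + coeff_b x" and m = \<mu>,
      OF L2_add[OF L2f L2g] L2_diff[OF L2f L2g] du dw borel_measurable_diff[OF coeff_a_measurable coeff_b_measurable] _
      borel_measurable_add[OF coeff_a_measurable coeff_b_measurable] coeff_sum_bounds half_gt_zero[OF kappa_pos(1)] mu_measurable _ mu_square T]
    by blast+
  \<comment> \<open>Positivity holds in the open interval; at the endpoints a - b vanishes, but they
    form a null set.\<close>
  have pos: "AE \<xi> in lebesgue_on ?S. 0 < \<mu> \<xi>"
  proof -
    have "AE \<xi> in lebesgue. \<xi> \<noteq> (0::real)" "AE \<xi> in lebesgue. \<xi> \<noteq> (1::real)"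
      using AE_completion[OF AE_lborel_singleton] by blast+
    then have "AE \<xi> in lebesgue. \<xi> \<in> ?S \<longrightarrow> 0 < \<mu> \<xi>"
      by eventually_elim (auto intro: mu_pos)
    then show ?thesis by (subst AE_restrict_space_iff) auto
  qed
  show "AE \<xi> in lebesgue_on ?S. 0 < \<mu> \<xi> \<and>
      norm (f T \<xi> + g T \<xi>) \<le> ?p \<xi> + 2 / \<kappa> * (\<mu> \<xi> * ?m \<xi>) \<and>
      \<mu> \<xi> * norm (f T \<xi> - g T \<xi>) \<le> \<mu> \<xi> * ?m \<xi> + 7 * \<kappa> * ?p \<xi>"
    using pos sol_AE
  proof eventually_elim
    case (elim \<xi>)
    let ?q = "coeff_a \<xi> + coeff_b \<xi>"
    have q: "\<kappa> / 2 \<le> ?q" "?q \<le> 7 * \<kappa>" "0 < ?q"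
      using coeff_sum_bounds[of \<xi>] kappa_pos(1) by linarith+
    have "norm (f T \<xi> + g T \<xi>) \<le> 1 * ?p \<xi> + \<mu> \<xi> / ?q * ?m \<xi>"
      unfolding elim(2) using trig_combination_bound[of 1 "\<mu> \<xi> / ?q" "\<mu> \<xi> * T" "f 0 \<xi> + g 0 \<xi>" "f 0 \<xi> - g 0 \<xi>"] elim(1) q(3) by simp
    also have "\<mu> \<xi> / ?q \<le> \<mu> \<xi> / (\<kappa> / 2)"
      using q elim(1) by (intro divide_left_mono) auto
    finally have 1: "norm (f T \<xi> + g T \<xi>) \<le> ?p \<xi> + 2 / \<kappa> * (\<mu> \<xi> * ?m \<xi>)"
      by (simp add: mult_right_mono mult_ac)
    have "\<mu> \<xi> * norm (f T \<xi> - g T \<xi>) = norm (of_real (\<mu> \<xi>) * (f T \<xi> - g T \<xi>))"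
      using elim(1) by (simp add: norm_mult)
    also have "\<dots> \<le> \<mu> \<xi> * ?m \<xi> + ?q * ?p \<xi>"
      unfolding elim(3) using elim(1) q(3) by (intro trig_combination_bound) auto
    also have "\<dots> \<le> \<mu> \<xi> * ?m \<xi> + 7 * \<kappa> * ?p \<xi>"
      using q(2) by (intro add_left_mono mult_right_mono) auto
    finally show ?case using 1 elim(1) by blast
  qed
qed

text \<open>Dividing the pointwise bounds by \<mu>^(j + 1) gives a system for the two weighted
  quotients in which no \<mu> remains. Therefore the constants do not involve j, whatever its
  sign.\<close>

lemma weighted_estimate:
  fixes j :: real
  assumes sol: "solution_with_transforms v c f g" and T: "0 \<le> T"
  defines "U t \<xi> \<equiv> (f t \<xi> + g t \<xi>) / of_real (\<mu> \<xi> powr (j + 1))"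
    and "W t \<xi> \<equiv> (f t \<xi> - g t \<xi>) / of_real (\<mu> \<xi> powr j)"
  assumes U0: "L2 {0..1} (U 0)" and W0: "L2 {0..1} (W 0)"
  shows "L2 {0..1} (U T)" "L2 {0..1} (W T)"
    "L2norm {0..1} (U T) \<le> L2norm {0..1} (U 0) + 2 / \<kappa> * L2norm {0..1} (W 0)"
    "L2norm {0..1} (W T) \<le> L2norm {0..1} (W 0) + 7 * \<kappa> * L2norm {0..1} (U 0)"
    "L2norm {0..1} (U T) + L2norm {0..1} (W T) \<le> (1 + 2 / \<kappa> + 7 * \<kappa>) * (L2norm {0..1} (U 0) + L2norm {0..1} (W 0))"
proof -
  note B = transforms_AE_bounds[OF sol T]
  have m: "U T \<in> borel_measurable (lebesgue_on {0..1})" "W T \<in> borel_measurable (lebesgue_on {0..1})"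
  proof -
    have "(\<lambda>\<xi>. complex_of_real (\<mu> \<xi> powr r)) \<in> borel_measurable (lebesgue_on {0..1})" for r
      by (intro borel_measurable_lebesgue_on_borel) measurable
    then show "U T \<in> borel_measurable (lebesgue_on {0..1})" "W T \<in> borel_measurable (lebesgue_on {0..1})"
      unfolding U_def[abs_def] W_def[abs_def]
      using L2_measurable[OF B(2)] L2_measurable[OF B(3)]
      by (auto intro!: borel_measurable_divide borel_measurable_add borel_measurable_diff)
  qed
  have UA: "AE \<xi> in lebesgue_on {0..1}. norm (U T \<xi>) \<le> 1 * norm (U 0 \<xi>) + 2 / \<kappa> * norm (W 0 \<xi>)"
    using B(1)
  proof eventually_elim
    case (elim \<xi>)
    define P where "P = \<mu> \<xi> powr j"
    have P: "0 < P" "\<mu> \<xi> powr (j + 1) = P * \<mu> \<xi>" using elim by (simp_all add: P_def powr_add)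
    have "norm (U T \<xi>) = norm (f T \<xi> + g T \<xi>) / (P * \<mu> \<xi>)"
      using P elim by (simp add: U_def norm_divide norm_mult)
    also have "\<dots> \<le> (norm (f 0 \<xi> + g 0 \<xi>) + 2 / \<kappa> * (\<mu> \<xi> * norm (f 0 \<xi> - g 0 \<xi>))) / (P * \<mu> \<xi>)"
      using P elim by (intro divide_right_mono) auto
    also have "\<dots> = 1 * norm (U 0 \<xi>) + 2 / \<kappa> * norm (W 0 \<xi>)"
    proof -
      have "norm (U 0 \<xi>) = norm (f 0 \<xi> + g 0 \<xi>) / (P * \<mu> \<xi>)" "norm (W 0 \<xi>) = norm (f 0 \<xi> - g 0 \<xi>) / P"
        using P elim by (simp_all add: U_def W_def norm_divide norm_mult flip: P_def)
      then show ?thesis using P elim by (simp add: add_divide_distrib)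
    qed
    finally show ?case .
  qed
  have WA: "AE \<xi> in lebesgue_on {0..1}. norm (W T \<xi>) \<le> 1 * norm (W 0 \<xi>) + 7 * \<kappa> * norm (U 0 \<xi>)"
    using B(1)
  proof eventually_elim
    case (elim \<xi>)
    define P where "P = \<mu> \<xi> powr j"
    have P: "0 < P" "\<mu> \<xi> powr (j + 1) = P * \<mu> \<xi>" using elim by (simp_all add: P_def powr_add)
    have "norm (W T \<xi>) = \<mu> \<xi> * norm (f T \<xi> - g T \<xi>) / (P * \<mu> \<xi>)"
      using P elim by (simp add: W_def norm_divide flip: P_def)
    also have "\<dots> \<le> (\<mu> \<xi> * norm (f 0 \<xi> - g 0 \<xi>) + 7 * \<kappa> * norm (f 0 \<xi> + g 0 \<xi>)) / (P * \<mu> \<xi>)"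
      using P elim by (intro divide_right_mono) auto
    also have "\<dots> = 1 * norm (W 0 \<xi>) + 7 * \<kappa> * norm (U 0 \<xi>)"
    proof -
      have "norm (U 0 \<xi>) = norm (f 0 \<xi> + g 0 \<xi>) / (P * \<mu> \<xi>)" "norm (W 0 \<xi>) = norm (f 0 \<xi> - g 0 \<xi>) / P"
        using P elim by (simp_all add: U_def W_def norm_divide norm_mult flip: P_def)
      then show ?thesis using P elim by (simp add: add_divide_distrib)
    qed
    finally show ?case .
  qed
  have k: "0 \<le> 2 / \<kappa>" "0 \<le> 7 * \<kappa>" by (simp_all add: less_imp_le)
  show "L2 {0..1} (U T)" "L2 {0..1} (W T)"
    and UT: "L2norm {0..1} (U T) \<le> L2norm {0..1} (U 0) + 2 / \<kappa> * L2norm {0..1} (W 0)"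
    and WT: "L2norm {0..1} (W T) \<le> L2norm {0..1} (W 0) + 7 * \<kappa> * L2norm {0..1} (U 0)"
    using L2norm_le_combination[OF m(1) U0 W0 zero_le_one k(1) UA] L2norm_le_combination[OF m(2) W0 U0 zero_le_one k(2) WA]
    by simp_all
  define X Y where "X = L2norm {0..1} (U 0)" and "Y = L2norm {0..1} (W 0)"
  have "L2norm {0..1} (U T) + L2norm {0..1} (W T) \<le> (X + 2 / \<kappa> * Y) + (Y + 7 * \<kappa> * X)"
    unfolding X_def Y_def by (rule add_mono[OF UT WT])
  also have "\<dots> \<le> (X + 2 / \<kappa> * Y) + (Y + 7 * \<kappa> * X) + (2 / \<kappa> * X + 7 * \<kappa> * Y)"
    by (simp add: X_def Y_def less_imp_le)
  also have "\<dots> = (1 + 2 / \<kappa> + 7 * \<kappa>) * (X + Y)"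
    by (simp add: algebra_simps add_divide_distrib)
  finally show "L2norm {0..1} (U T) + L2norm {0..1} (W T) \<le> (1 + 2 / \<kappa> + 7 * \<kappa>) * (L2norm {0..1} (U 0) + L2norm {0..1} (W 0))"
    unfolding X_def Y_def .
qed

text \<open>The case j = 0, with f recovered as half of (f + g) + (f - g) and f + g controlled
  through \<mu> \<le> 3 \<kappa>. At time 0 the difference f - g has at most twice the norm of f,
  because g has the same norm as f.\<close>

lemma unweighted_estimate:
  assumes sol: "solution_with_transforms v c f g" and T: "0 \<le> T"
  defines "U t \<xi> \<equiv> (f t \<xi> + g t \<xi>) / of_real (\<mu> \<xi>)"
  assumes U0: "L2 {0..1} (U 0)"
  shows "L2 {0..1} (U T)"
    "L2norm {0..1} (U T) + L2norm {0..1} (f T) \<le> (7 + 4 / \<kappa> + 5 * \<kappa>) * (L2norm {0..1} (U 0) + L2norm {0..1} (f 0))"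
proof -
  let ?N = "L2norm {0..1}"
  \<comment> \<open>Both \<open>0 powr 0\<close> and division by 0 have the value 0, so W vanishes
    where \<mu> does and need not equal f - g there. Hence W at time 0 is only dominated by f -
    g.\<close>
  define W where "W t \<xi> = (f t \<xi> - g t \<xi>) / of_real (\<mu> \<xi> powr 0)" for t \<xi>
  note B = transforms_AE_bounds[OF sol T] and B0 = transforms_AE_bounds[OF sol order_refl]
  have U: "U = (\<lambda>t \<xi>. (f t \<xi> + g t \<xi>) / of_real (\<mu> \<xi> powr (0 + 1)))"
    by (simp add: U_def[abs_def] mu_nonneg)
  have f0g0: "L2 {0..1} (\<lambda>\<xi>. f 0 \<xi> - g 0 \<xi>)" by (intro L2_diff B0)
  have Wm: "W 0 \<in> borel_measurable (lebesgue_on {0..1})"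
  proof -
    have "(\<lambda>\<xi>. complex_of_real (\<mu> \<xi> powr 0)) \<in> borel_measurable (lebesgue_on {0..1})"
      by (intro borel_measurable_lebesgue_on_borel) measurable
    then show ?thesis
      unfolding W_def[abs_def] using L2_measurable[OF f0g0] by (intro borel_measurable_divide)
  qed
  have W_AE: "AE \<xi> in lebesgue_on {0..1}. norm (W 0 \<xi>) \<le> norm (f 0 \<xi> - g 0 \<xi>)"
    by (rule AE_I2) (simp add: W_def)
  have W0: "L2 {0..1} (W 0)" by (rule L2_dominated[OF Wm f0g0 W_AE])
  have "?N (W 0) \<le> ?N (\<lambda>\<xi>. f 0 \<xi> - g 0 \<xi>)"
    by (rule L2norm_mono[OF Wm f0g0 W_AE])
  also have "\<dots> \<le> ?N (f 0) + ?N (g 0)"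
    using L2norm_triangle[OF B0(2) L2_uminus[OF B0(3)]] by (simp add: L2norm_uminus)
  finally have W0f: "?N (W 0) \<le> 2 * ?N (f 0)" using B0(4) by simp
  have E: "L2 {0..1} (U T)" "L2 {0..1} (W T)"
    "?N (U T) \<le> ?N (U 0) + 2 / \<kappa> * ?N (W 0)"
    "?N (W T) \<le> ?N (W 0) + 7 * \<kappa> * ?N (U 0)"
    using weighted_estimate[OF sol T, where j = 0] U0 W0 unfolding U W_def[abs_def] by blast+
  show "L2 {0..1} (U T)" by (rule E(1))
  have "AE \<xi> in lebesgue_on {0..1}. norm (f T \<xi>) \<le> 3 * \<kappa> / 2 * norm (U T \<xi>) + 1 / 2 * norm (W T \<xi>)"
    using B(1)
  proof eventually_elim
    case (elim \<xi>)
    have "f T \<xi> = ((f T \<xi> + g T \<xi>) + (f T \<xi> - g T \<xi>)) / 2" by simp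
    then have "norm (f T \<xi>) \<le> (norm (f T \<xi> + g T \<xi>) + norm (f T \<xi> - g T \<xi>)) / 2"
      using norm_triangle_ineq[of "f T \<xi> + g T \<xi>" "f T \<xi> - g T \<xi>"] by (simp add: norm_divide)
    also have "norm (f T \<xi> + g T \<xi>) = \<mu> \<xi> * norm (U T \<xi>)"
      using elim by (simp add: U_def norm_divide)
    also have "norm (f T \<xi> - g T \<xi>) = norm (W T \<xi>)"
      using elim by (simp add: W_def norm_divide)
    also have "(\<mu> \<xi> * norm (U T \<xi>) + norm (W T \<xi>)) / 2 \<le> (3 * \<kappa> * norm (U T \<xi>) + norm (W T \<xi>)) / 2"
      using mu_le[of \<xi>] by (intro divide_right_mono add_right_mono mult_right_mono) auto
    also have "\<dots> = 3 * \<kappa> / 2 * norm (U T \<xi>) + 1 / 2 * norm (W T \<xi>)"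
      by (simp add: add_divide_distrib)
    finally show ?case .
  qed
  then have F: "?N (f T) \<le> 3 * \<kappa> / 2 * ?N (U T) + 1 / 2 * ?N (W T)"
    by (intro L2norm_le_combination(2)[OF L2_measurable[OF B(2)] E(1,2)]) (auto simp: less_imp_le)
  have "3 * \<kappa> / 2 * ?N (U T) \<le> 3 * \<kappa> / 2 * (?N (U 0) + 2 / \<kappa> * ?N (W 0))"
    by (rule mult_left_mono[OF E(3)]) (simp add: less_imp_le)
  also have "\<dots> = 3 / 2 * (\<kappa> * ?N (U 0)) + 3 * ?N (W 0)"
    by (simp add: field_simps)
  finally have H: "3 * \<kappa> / 2 * ?N (U T) \<le> 3 / 2 * (\<kappa> * ?N (U 0)) + 3 * ?N (W 0)" .
  have "2 / \<kappa> * ?N (W 0) \<le> 2 / \<kappa> * (2 * ?N (f 0))"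
    by (rule mult_left_mono[OF W0f]) (simp add: less_imp_le)
  then have R: "2 / \<kappa> * ?N (W 0) \<le> 4 * (inverse \<kappa> * ?N (f 0))"
    by (simp add: divide_inverse)
  \<comment> \<open>The bookkeeping behind the constant: 5 = 3/2 + 7/2 multiplies \<kappa> times the
    norm of U, and 7 = 2 (3 + 1/2) multiplies the norm of f, both at time 0.\<close>
  have lin: "a + b \<le> x + 4 * i + 5 * s + 7 * y"
    if "a \<le> x + r" "w \<le> z + 7 * s" "b \<le> h + 1 / 2 * w" "h \<le> 3 / 2 * s + 3 * z" "r \<le> 4 * i" "z \<le> 2 * y"
    for a b w x y z r s h i :: real
    using that by linarith
  have *: "?N (U T) + ?N (f T) \<le>
     ?N (U 0) + 4 * (inverse \<kappa> * ?N (f 0)) + 5 * (\<kappa> * ?N (U 0)) + 7 * ?N (f 0)"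
    by (rule lin[OF E(3) E(4)[unfolded mult.assoc] F H R W0f])
  show "?N (U T) + ?N (f T) \<le> (7 + 4 / \<kappa> + 5 * \<kappa>) * (?N (U 0) + ?N (f 0))"
  proof -
    have nn: "0 \<le> inverse \<kappa> * ?N (U 0)" "0 \<le> \<kappa> * ?N (f 0)" "0 \<le> ?N (U 0)"
      by (simp_all add: less_imp_le)
    have "(7 + 4 / \<kappa> + 5 * \<kappa>) * (?N (U 0) + ?N (f 0)) =
      7 * ?N (U 0) + 7 * ?N (f 0) + 4 * (inverse \<kappa> * ?N (U 0)) + 4 * (inverse \<kappa> * ?N (f 0))
        + 5 * (\<kappa> * ?N (U 0)) + 5 * (\<kappa> * ?N (f 0))"
      by (simp add: divide_inverse algebra_simps)
    then show ?thesis using * nn by linarith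
  qed
qed

theorem theorem5p10:
  "(\<exists>C>0. \<forall>v c f g. solution_with_transforms v c f g \<longrightarrow>
      L2 {0..1} (\<lambda>\<xi>. (f 0 \<xi> + g 0 \<xi>) / of_real (\<mu> \<xi>)) \<longrightarrow>
      L2 {0..1} (f 0) \<longrightarrow>
      (\<forall>t\<ge>0.
         L2 {0..1} (\<lambda>\<xi>. (f t \<xi> + g t \<xi>) / of_real (\<mu> \<xi>)) \<and>
         L2 {0..1} (f t) \<and>
         L2norm {0..1} (\<lambda>\<xi>. (f t \<xi> + g t \<xi>) / of_real (\<mu> \<xi>)) + L2norm {0..1} (f t)
         \<le> C * (L2norm {0..1} (\<lambda>\<xi>. (f 0 \<xi> + g 0 \<xi>) / of_real (\<mu> \<xi>)) + L2norm {0..1} (f 0))))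
   \<and>
   (\<forall>j::real. \<exists>C>0. \<forall>v c f g. solution_with_transforms v c f g \<longrightarrow>
      L2 {0..1} (\<lambda>\<xi>. (f 0 \<xi> + g 0 \<xi>) / of_real (\<mu> \<xi> powr (j + 1))) \<longrightarrow>
      L2 {0..1} (\<lambda>\<xi>. (f 0 \<xi> - g 0 \<xi>) / of_real (\<mu> \<xi> powr j)) \<longrightarrow>
      (\<forall>t\<ge>0.
         L2 {0..1} (\<lambda>\<xi>. (f t \<xi> + g t \<xi>) / of_real (\<mu> \<xi> powr (j + 1))) \<and>
         L2 {0..1} (\<lambda>\<xi>. (f t \<xi> - g t \<xi>) / of_real (\<mu> \<xi> powr j)) \<and>
         L2norm {0..1} (\<lambda>\<xi>. (f t \<xi> + g t \<xi>) / of_real (\<mu> \<xi> powr (j + 1)))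
           + L2norm {0..1} (\<lambda>\<xi>. (f t \<xi> - g t \<xi>) / of_real (\<mu> \<xi> powr j))
         \<le> C * (L2norm {0..1} (\<lambda>\<xi>. (f 0 \<xi> + g 0 \<xi>) / of_real (\<mu> \<xi> powr (j + 1)))
                + L2norm {0..1} (\<lambda>\<xi>. (f 0 \<xi> - g 0 \<xi>) / of_real (\<mu> \<xi> powr j)))))"
proof (rule conjI, goal_cases)
  case 1
  have "0 < 7 + 4 / \<kappa> + 5 * \<kappa>" by (simp add: add_pos_pos)
  then show ?case
    by (intro exI[of _ "7 + 4 / \<kappa> + 5 * \<kappa>"] conjI allI impI)
      (assumption | rule unweighted_estimate transforms_AE_bounds(2), assumption, assumption)+
next
  case 2
  have "0 < 1 + 2 / \<kappa> + 7 * \<kappa>" by (simp add: add_pos_pos)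
  then show ?case
    by (intro allI exI[of _ "1 + 2 / \<kappa> + 7 * \<kappa>"] conjI impI)
      (assumption | rule weighted_estimate(1,2,5), assumption, assumption)+
qed

end
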